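(* For each $k\in\mathbb{N}$, there is a polynomial-time certifying algorithm for $k$-Coloring of (co-gem, paraglider)-free graphs.
   Context: All graphs are finite, simple and undirected; $\mathbb{N}=\{1,2,3,\ldots\}$. For a fixed $k$, the $k$-Coloring problem asks whether a given graph $G$ is $k$-colorable (i.e. $\chi(G)\le k$). A graph $G$ is $m$-vertex-critical if $\chi(G)=m$ and $\chi(G-v)<m$ for all $v\in V(G)$. An algorithm is certifying if with each output it returns a certificate of correctness that can be verified in polynomial time; for $k$-Coloring, such an algorithm outputs a $k$-coloring of $G$ when $G$ is $k$-colorable, and a $(k+1)$-vertex-critical induced subgraph of $G$ otherwise. A graph is $(H_1,H_2)$-free if it contains neither $H_1$ nor $H_2$ as an induced subgraph. The co-gem is $P_4+P_1$, the disjoint union of a chordless path on four vertices and an isolated vertex. The paraglider is the complement of $P_2+P_3$; equivalently, the five-vertex graph with vertices $a,b,c,x,y$ and edges $ab, ax, ay, bx, by, cx, cy$. *)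

theory Defs
  imports "HOL-Computational_Algebra.Polynomial"
begin

section \<open>Graphs\<close>

type_synonym 'a graph = "'a set \<times> 'a set set"

abbreviation verts :: "'a graph \<Rightarrow> 'a set" where "verts \<equiv> fst"
abbreviation edges :: "'a graph \<Rightarrow> 'a set set" where "edges \<equiv> snd"

definition simple_graph :: "'a graph \<Rightarrow> bool" where
  "simple_graph G \<longleftrightarrow> finite (verts G) \<and>
     (\<forall>e\<in>edges G. \<exists>u v. u \<noteq> v \<and> e = {u, v} \<and> u \<in> verts G \<and> v \<in> verts G)"

definition adj :: "'a graph \<Rightarrow> 'a \<Rightarrow> 'a \<Rightarrow> bool" where
  "adj G u v \<longleftrightarrow> {u, v} \<in> edges G"

definition induced :: "'a graph \<Rightarrow> 'a set \<Rightarrow> 'a graph" where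
  "induced G S = (verts G \<inter> S, {e \<in> edges G. e \<subseteq> S})"

definition contains_induced :: "'a graph \<Rightarrow> 'b graph \<Rightarrow> bool" where
  "contains_induced G H \<longleftrightarrow> (\<exists>f. inj_on f (verts H) \<and> f ` verts H \<subseteq> verts G \<and>
     (\<forall>u\<in>verts H. \<forall>v\<in>verts H. adj H u v \<longleftrightarrow> adj G (f u) (f v)))"

definition co_gem :: "nat graph" where
  "co_gem = ({0, 1, 2, 3, 4}, {{0, 1}, {1, 2}, {2, 3}})"

text \<open>With \<open>a, b, c, x, y\<close> numbered \<open>0, 1, 2, 3, 4\<close>; the missing edges are \<open>ac, bc, xy\<close>.\<close>

definition paraglider :: "nat graph" where
  "paraglider = ({0, 1, 2, 3, 4},
     {{0, 1}, {0, 3}, {0, 4}, {1, 3}, {1, 4}, {2, 3}, {2, 4}})"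

definition proper_coloring :: "nat \<Rightarrow> 'a graph \<Rightarrow> ('a \<Rightarrow> nat) \<Rightarrow> bool" where
  "proper_coloring k G c \<longleftrightarrow> (\<forall>v\<in>verts G. c v < k) \<and>
     (\<forall>u\<in>verts G. \<forall>v\<in>verts G. adj G u v \<longrightarrow> c u \<noteq> c v)"

definition colorable :: "nat \<Rightarrow> 'a graph \<Rightarrow> bool" where
  "colorable k G \<longleftrightarrow> (\<exists>c. proper_coloring k G c)"

definition chromatic_number :: "'a graph \<Rightarrow> nat" where
  "chromatic_number G = (LEAST k. colorable k G)"

definition vertex_critical :: "nat \<Rightarrow> 'a graph \<Rightarrow> bool" where
  "vertex_critical m G \<longleftrightarrow> chromatic_number G = m \<and>
     (\<forall>v\<in>verts G. chromatic_number (induced G (verts G - {v})) < m)"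


section \<open>Random access machine programs\<close>

text \<open>
  The model of computation is the unit-cost random access machine whose only arithmetic
  operations are addition and truncated subtraction, with structured control flow. A program
  uses finitely many arrays of natural numbers, named by natural numbers; a scalar is cell 0 of
  an array. Without multiplication, bit lengths grow by at most a constant (depending on the
  program) per step, so that polynomial time agrees with polynomial time on Turing machines.
  Evaluating an expression is not charged separately, as the sizes of the expressions in a
  program are bounded by a constant.
\<close>

type_synonym state = "nat \<Rightarrow> nat \<Rightarrow> nat"

datatype aexp = Num nat | Get nat aexp | Plus aexp aexp | Minus aexp aexp

datatype bexp = Less aexp aexp | Eq aexp aexp | Not bexp | And bexp bexp

datatype com =
    Skip
  | Store nat aexp aexp
  | Seq com com
  | Cond bexp com com
  | While bexp com

fun aval :: "aexp \<Rightarrow> state \<Rightarrow> nat" where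
  "aval (Num m) s = m"
| "aval (Get x a) s = s x (aval a s)"
| "aval (Plus a b) s = aval a s + aval b s"
| "aval (Minus a b) s = aval a s - aval b s"

fun bval :: "bexp \<Rightarrow> state \<Rightarrow> bool" where
  "bval (Less a b) s \<longleftrightarrow> aval a s < aval b s"
| "bval (Eq a b) s \<longleftrightarrow> aval a s = aval b s"
| "bval (Not b) s \<longleftrightarrow> \<not> bval b s"
| "bval (And b c) s \<longleftrightarrow> bval b s \<and> bval c s"

text \<open>\<open>exec c s t s'\<close>: started in \<open>s\<close>, the program \<open>c\<close> halts in \<open>s'\<close> after exactly \<open>t\<close> steps.\<close>

inductive exec :: "com \<Rightarrow> state \<Rightarrow> nat \<Rightarrow> state \<Rightarrow> bool" where
  Skip: "exec Skip s 1 s"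
| Store: "exec (Store x a b) s 1 (s(x := (s x)(aval a s := aval b s)))"
| Seq: "exec c s t s' \<Longrightarrow> exec d s' u s'' \<Longrightarrow> exec (Seq c d) s (t + u) s''"
| CondTrue: "bval b s \<Longrightarrow> exec c s t s' \<Longrightarrow> exec (Cond b c d) s (1 + t) s'"
| CondFalse: "\<not> bval b s \<Longrightarrow> exec d s t s' \<Longrightarrow> exec (Cond b c d) s (1 + t) s'"
| WhileFalse: "\<not> bval b s \<Longrightarrow> exec (While b c) s 1 s"
| WhileTrue: "bval b s \<Longrightarrow> exec c s t s' \<Longrightarrow> exec (While b c) s' u s'' \<Longrightarrow>
    exec (While b c) s (1 + t + u) s''"


section \<open>Certifying algorithms for coloring\<close>

text \<open>
  An input graph has vertex set \<open>{..<n}\<close>. Array 0 holds \<open>n\<close>, and array 1 holds the adjacency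
  matrix row by row. All other cells are initially 0.
\<close>

definition graph_state :: "nat graph \<Rightarrow> state" where
  "graph_state G = (let n = card (verts G) in
     (\<lambda>x i. if x = 0 \<and> i = 0 then n
            else if x = 1 \<and> i < n * n then of_bool (adj G (i div n) (i mod n))
            else 0))"

text \<open>
  A certificate consists of a tag (cell 0 of array 2) and one number per vertex (array 3).
  If the tag is nonzero, the numbers are the colors of the vertices; if it is 0, they are the
  characteristic function of the vertex set of an induced subgraph (nonzero meaning membership).
\<close>

definition valid_certificate :: "nat \<Rightarrow> nat graph \<Rightarrow> nat \<Rightarrow> (nat \<Rightarrow> nat) \<Rightarrow> bool" where
  "valid_certificate k G tag w \<longleftrightarrow>
     (if tag \<noteq> 0 then proper_coloring k G w
      else vertex_critical (k + 1) (induced G {v \<in> verts G. w v \<noteq> 0}))"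

definition certificate_state :: "nat graph \<Rightarrow> nat \<Rightarrow> (nat \<Rightarrow> nat) \<Rightarrow> state" where
  "certificate_state G tag w =
     (\<lambda>x i. if x = 2 \<and> i = 0 then tag
            else if x = 3 \<and> i < card (verts G) then w i
            else graph_state G x i)"

definition input_graph :: "(nat graph \<Rightarrow> bool) \<Rightarrow> nat graph \<Rightarrow> bool" where
  "input_graph C G \<longleftrightarrow> simple_graph G \<and> (\<exists>n. verts G = {..<n}) \<and> C G"

definition solves_coloring_in_polytime :: "nat \<Rightarrow> (nat graph \<Rightarrow> bool) \<Rightarrow> com \<Rightarrow> bool" where
  "solves_coloring_in_polytime k C A \<longleftrightarrow>
     (\<exists>p :: nat poly. \<forall>G. input_graph C G \<longrightarrow>
        (\<exists>t s. exec A (graph_state G) t s \<and> t \<le> poly p (card (verts G)) \<and>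
           (s 2 0 \<noteq> 0 \<longleftrightarrow> colorable k G) \<and>
           valid_certificate k G (s 2 0) (s 3)))"

text \<open>
  A verifier is given a graph of the class together with an arbitrary, possibly wrong,
  certificate; it accepts by halting with 1 in cell 0 of array 4.
\<close>

definition verifies_in_polytime :: "nat \<Rightarrow> (nat graph \<Rightarrow> bool) \<Rightarrow> com \<Rightarrow> bool" where
  "verifies_in_polytime k C B \<longleftrightarrow>
     (\<exists>p :: nat poly. \<forall>G tag w. input_graph C G \<longrightarrow>
        (\<exists>t s. exec B (certificate_state G tag w) t s \<and> t \<le> poly p (card (verts G)) \<and>
           (s 4 0 = 1 \<longleftrightarrow> valid_certificate k G tag w)))"

definition polytime_certifying :: "nat \<Rightarrow> (nat graph \<Rightarrow> bool) \<Rightarrow> com \<Rightarrow> bool" where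
  "polytime_certifying k C A \<longleftrightarrow>
     solves_coloring_in_polytime k C A \<and> (\<exists>B. verifies_in_polytime k C B)"

end

theory Submission
  imports Defs "HOL-Library.Ramsey"
begin

text \<open>
Call a homomorphism from a graph onto a proper induced subgraph a fold if it moves at most
\<open>k + 1\<close> vertices and fixes all the others. A fold does not change whether the graph is
\<open>k\<close>-colorable: a coloring of the smaller graph pulls back along the fold. Moreover, folds can be found
in polynomial time by trying all tuples of \<open>2 (k + 1)\<close> vertices. The algorithm folds the graph until
it has no fold, keeping track of the composed retraction, and then tries all assignments of \<open>k\<close>
colors to the first \<open>M\<close> remaining vertices, where \<open>M\<close> depends on \<open>k\<close> only. This decides
colorability (\<open>runs_decide\<close>), because a graph of the class that has no fold and no clique of \<open>k + 1\<close>
vertices has at most \<open>M\<close> vertices (\<open>rigid_graph_bounded\<close>). As the class is hereditary, the same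
procedure applies to all induced subgraphs. So a vertex-critical subgraph is found by deleting vertices
one by one as long as the rest is not \<open>k\<close>-colorable, and criticality of a given subgraph can
be verified (\<open>runs_solver\<close>, \<open>runs_verifier\<close>).

The bound is proved as follows. By Ramsey's theorem it suffices to bound the size \<open>m\<close> of an independent
set. Enlarge its singletons to pairwise anticomplete connected sets
\<open>K\<^sub>0, \<dots>, K\<^sub>m\<^sub>-\<^sub>1\<close> whose union is as large as possible. For a vertex \<open>w\<close> outside of the union consider the set of
indices \<open>i\<close> such that \<open>w\<close> is complete to \<open>K\<^sub>i\<close>, or the complement of this set if it contains at least
half of the indices. As there is no co-gem, these traces form a laminar family (\<open>trace_laminar\<close>) and every index
lies in at most \<open>2 k\<close> of them, because two traces of the same kind (complemented or not) are equal or
disjoint if they belong to nonadjacent vertices. If no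
trace separates \<open>i\<close> from \<open>j\<close>, then \<open>K\<^sub>i\<close> and \<open>K\<^sub>j\<close> are cliques with the same neighborhood, and
one of them folds into the other. Hence the traces separate all indices (\<open>traces_separate\<close>), which
forces the minimal traces to be singletons. By maximality of the union, a singleton trace \<open>{i}\<close> belongs
to a vertex \<open>w\<^sub>i\<close> that is complete to all the sets but \<open>K\<^sub>i\<close>. Pairwise nonadjacent
vertices of this kind induce, together with suitable vertices of the sets \<open>K\<^sub>i\<close>, a complete bipartite graph
minus a perfect matching, and five of them would give rise to a fold since there is no paraglider
(\<open>no_co_matching\<close>). So Ramsey's theorem bounds the number of singleton traces, hence the
number of all traces, and hence \<open>m\<close>.
\<close>

section \<open>Graphs without folds\<close>

definition clique_on :: "('a \<Rightarrow> 'a \<Rightarrow> bool) \<Rightarrow> 'a set \<Rightarrow> bool" where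
  "clique_on E C \<longleftrightarrow> (\<forall>u\<in>C. \<forall>v\<in>C. u \<noteq> v \<longrightarrow> E u v)"

text \<open>
The map that is \<open>f\<close> on \<open>A\<close> and the identity elsewhere is a homomorphism to the subgraph induced by
\<open>V - A\<close>.
\<close>
definition fold_on :: "'a set \<Rightarrow> ('a \<Rightarrow> 'a \<Rightarrow> bool) \<Rightarrow> 'a set \<Rightarrow> ('a \<Rightarrow> 'a) \<Rightarrow> bool" where
  "fold_on V E A f \<longleftrightarrow> A \<subseteq> V \<and> A \<noteq> {} \<and> (\<forall>a\<in>A. f a \<in> V - A) \<and>
     (\<forall>a\<in>A. \<forall>w\<in>V. E a w \<longrightarrow> E (f a) (if w \<in> A then f w else w))"

text \<open>
Except for \<open>x \<noteq> y\<close>, the distinctness of the vertices follows from the prescribed adjacencies. The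
paraglider appears as an edge and a vertex anticomplete to it, all in the common neighborhood of two
nonadjacent vertices.
\<close>
locale free_graph =
  fixes V :: "'a set" and E :: "'a \<Rightarrow> 'a \<Rightarrow> bool"
  assumes finite_V: "finite V"
    and sym: "E u v \<Longrightarrow> E v u"
    and irrefl: "\<not> E v v"
    and co_gem_free: "\<lbrakk>a \<in> V; b \<in> V; c \<in> V; d \<in> V; e \<in> V; E a b; E b c; E c d;
      \<not> E a c; \<not> E a d; \<not> E b d; \<not> E a e; \<not> E b e; \<not> E c e; \<not> E d e\<rbrakk> \<Longrightarrow> False"
    and paraglider_free: "\<lbrakk>x \<in> V; y \<in> V; a \<in> V; b \<in> V; c \<in> V; x \<noteq> y; \<not> E x y;
      E x a; E y a; E x b; E y b; E x c; E y c; E a b\<rbrakk> \<Longrightarrow> E c a \<or> E c b"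

text \<open>
The proofs below need folds of cliques, which move at most \<open>k\<close> vertices, and folds of two vertices. Both kinds are
covered by \<open>k + 1\<close>, as \<open>k\<close> is positive.
\<close>
locale rigid_graph = free_graph +
  fixes k :: nat
  assumes k_pos: "k \<ge> 1"
    and clique_le: "\<lbrakk>C \<subseteq> V; clique_on E C\<rbrakk> \<Longrightarrow> card C \<le> k"
    and no_fold: "fold_on V E A f \<Longrightarrow> card A > k + 1"
begin

lemma no_dominated_vertex:
  assumes "a \<in> V" "b \<in> V" "a \<noteq> b" "\<not> E a b"
    and "\<And>w. w \<in> V \<Longrightarrow> E a w \<Longrightarrow> E b w"
  shows False
proof -
  have "fold_on V E {a} (\<lambda>_. b)"
    using assms irrefl by (auto simp: fold_on_def)
  from no_fold[OF this] show False using k_pos by simp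
qed

text \<open>
An injection of \<open>A\<close> into \<open>B\<close> is a fold; it moves at most \<open>k\<close> vertices, as \<open>A\<close> is a clique.
\<close>
lemma no_dominated_clique:
  assumes A: "A \<subseteq> V" "A \<noteq> {}" "clique_on E A" and B: "B \<subseteq> V" "clique_on E B"
    and disj: "A \<inter> B = {}" and le: "card A \<le> card B"
    and dom: "\<And>a w b. a \<in> A \<Longrightarrow> w \<in> V \<Longrightarrow> w \<notin> A \<Longrightarrow> E a w \<Longrightarrow> b \<in> B \<Longrightarrow> E b w"
  shows False
proof -
  have fin: "finite A" "finite B" using A B finite_V finite_subset by auto
  obtain f where f: "f ` A \<subseteq> B" "inj_on f A" using card_le_inj[OF fin le] by blast
  have "fold_on V E A f"
    unfolding fold_on_def
  proof (intro conjI ballI impI)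
    fix a assume "a \<in> A" then show "f a \<in> V - A" using f B disj by auto
  next
    fix a w assume *: "a \<in> A" "w \<in> V" "E a w"
    have "a \<noteq> w" using * irrefl by auto
    show "E (f a) (if w \<in> A then f w else w)"
    proof (cases "w \<in> A")
      case True
      then have "f a \<noteq> f w" using f(2) * \<open>a \<noteq> w\<close> by (auto dest: inj_onD)
      then show ?thesis using True B(2) f(1) * unfolding clique_on_def by auto
    next
      case False
      then show ?thesis using dom[of a w "f a"] * f(1) by auto
    qed
  qed (use A in auto)
  from no_fold[OF this] clique_le[OF A(1,3)] show False by simp
qed

text \<open>
Among the nonadjacent pairs of a module choose one, \<open>u\<close> and \<open>v\<close>, with the largest common neighborhood \<open>D\<close>
inside of the module. As there is no induced path on four vertices, the closed neighborhoods of
\<open>u\<close> and \<open>v\<close> minus \<open>D\<close> are two disjoint cliques, and inside of the module both have exactly \<open>D\<close> as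
their neighborhood, since otherwise there would be a nonadjacent pair with a larger common
neighborhood. So the smaller clique folds into the larger one.
\<close>
lemma P4_free_module_is_clique:
  assumes M: "M \<subseteq> V"
    and module: "\<And>w x y. w \<in> V \<Longrightarrow> w \<notin> M \<Longrightarrow> x \<in> M \<Longrightarrow> y \<in> M \<Longrightarrow> E x w \<Longrightarrow> E y w"
    and P4_free: "\<And>a b c d. \<lbrakk>a \<in> M; b \<in> M; c \<in> M; d \<in> M; E a b; E b c; E c d;
        \<not> E a c; \<not> E a d; \<not> E b d\<rbrakk> \<Longrightarrow> False"
  shows "clique_on E M"
proof (rule ccontr)
  assume not_clique: "\<not> clique_on E M"
  define common where "common u v = {x \<in> M. E u x \<and> E v x}" for u v
  have finM: "finite M" using M finite_V finite_subset by auto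
  have fin_common: "finite (common u v)" for u v
    using finM by (simp add: common_def)
  define P where "P = (\<lambda>(u, v). u \<in> M \<and> v \<in> M \<and> u \<noteq> v \<and> \<not> E u v)"
  have "\<exists>p. P p" using not_clique by (auto simp: P_def clique_on_def)
  moreover have "card (common u v) \<le> card M" for u v
    by (rule card_mono[OF finM]) (auto simp: common_def)
  then have "\<forall>p. P p \<longrightarrow> card (common (fst p) (snd p)) < Suc (card M)"
    by (auto simp: less_Suc_eq_le)
  ultimately obtain p where p: "P p"
    and max: "\<forall>q. P q \<longrightarrow> card (common (fst q) (snd q)) \<le> card (common (fst p) (snd p))"
    using Lattices_Big.ex_has_greatest_nat[of P _ "\<lambda>p. card (common (fst p) (snd p))"] by blast
  obtain u v where p_def: "p = (u, v)" by force
  have uv: "u \<in> M" "v \<in> M" "u \<noteq> v" "\<not> E u v" using p p_def by (auto simp: P_def)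
  have maxD: "\<not> common u v \<subset> common x y"
    if "x \<in> M" "y \<in> M" "x \<noteq> y" "\<not> E x y" for x y
  proof
    assume "common u v \<subset> common x y"
    then have "card (common u v) < card (common x y)"
      by (rule psubset_card_mono[OF fin_common])
    moreover have "P (x, y)" using that by (simp add: P_def)
    ultimately show False using max[rule_format, of "(x, y)"] by (simp add: p_def)
  qed
  \<comment> \<open>The private neighborhood of \<open>s\<close> together with \<open>s\<close>, relative to the other vertex \<open>t\<close>.\<close>
  define R where "R s t = insert s {x \<in> M. E s x \<and> \<not> E t x}" for s t
  define D where "D = common u v"
  have key: "R s t \<subseteq> M" "clique_on E (R s t)"
    "\<And>a w. a \<in> R s t \<Longrightarrow> w \<in> M \<Longrightarrow> w \<notin> R s t \<Longrightarrow> E a w \<Longrightarrow> w \<in> D"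
    "\<And>a d. a \<in> R s t \<Longrightarrow> d \<in> D \<Longrightarrow> E a d"
    if st: "(s = u \<and> t = v) \<or> (s = v \<and> t = u)" for s t
  proof -
    have s: "s \<in> M" "t \<in> M" "s \<noteq> t" "\<not> E s t" "\<not> E t s" and D: "D = common s t"
      using st uv sym by (auto simp: D_def common_def)
    have maxD: "\<not> D \<subset> common x y"
      if "x \<in> M" "y \<in> M" "x \<noteq> y" "\<not> E x y" for x y
      using maxD[OF that] by (simp add: D_def)
    show sub: "R s t \<subseteq> M" using s by (auto simp: R_def)
    show complete: "E a d" if a: "a \<in> R s t" and d: "d \<in> D" for a d
    proof (cases "a = s")
      case True
      then show ?thesis using d by (auto simp: D common_def)
    next
      case False
      then have a': "a \<in> M" "E s a" "\<not> E t a" using a by (auto simp: R_def)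
      have d': "d \<in> M" "E s d" "E t d" using d by (auto simp: D common_def)
      show ?thesis
        using P4_free[of a s d t] a' d' s sym by blast
    qed
    show "clique_on E (R s t)"
      unfolding clique_on_def
    proof (intro ballI impI, rule ccontr)
      fix a b assume *: "a \<in> R s t" "b \<in> R s t" "a \<noteq> b" "\<not> E a b"
      have "a \<noteq> s" "b \<noteq> s" using * sym by (auto simp: R_def)
      then have "E a s" "E b s" using * sym by (auto simp: R_def)
      then have "insert s D \<subseteq> common a b"
        using complete[OF *(1)] complete[OF *(2)] s by (auto simp: common_def D)
      moreover have "s \<notin> D" using irrefl by (auto simp: D common_def)
      ultimately show False using maxD[of a b] * sub by blast
    qed
    show "w \<in> D" if a: "a \<in> R s t" and w: "w \<in> M" "w \<notin> R s t" and aw: "E a w" for a w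
    proof (cases "E s w")
      case True
      then have "E t w" using w by (auto simp: R_def)
      then show ?thesis using True w by (auto simp: D common_def)
    next
      case False
      then have "a \<noteq> s" using aw by auto
      then have a': "a \<in> M" "E s a" "\<not> E t a" using a by (auto simp: R_def)
      have "w \<noteq> s" using w by (auto simp: R_def)
      have tw: "\<not> E t w"
        using P4_free[of s a w t] a' aw w s False sym by blast
      have "E w d" if d: "d \<in> D" for d
      proof (rule ccontr)
        assume "\<not> E w d"
        moreover have "d \<in> M" "E t d" "E a d"
          using d complete[OF a d] by (auto simp: D common_def)
        ultimately show False
          using P4_free[of w a d t] a' aw w s tw sym by blast
      qed
      then have "insert a D \<subseteq> common w s"
        using a' aw sym by (auto simp: common_def D)
      moreover have "a \<notin> D" using a' by (auto simp: D common_def)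
      ultimately show ?thesis
        using maxD[of w s] False w s \<open>w \<noteq> s\<close> sym by blast
    qed
  qed
  note key_u = key[of u v, simplified] and key_v = key[of v u, simplified]
  have disj: "R u v \<inter> R v u = {}"
    using uv sym irrefl by (auto simp: R_def)
  have dom: "E b w"
    if "(S = R u v \<and> T = R v u) \<or> (S = R v u \<and> T = R u v)"
      "a \<in> S" "w \<in> V" "w \<notin> S" "E a w" "b \<in> T" for S T a w b
  proof (cases "w \<in> M")
    case True
    then have "w \<in> D" using that key_u(3) key_v(3) by auto
    then show ?thesis using that key_u(4) key_v(4) by auto
  next
    case False
    then show ?thesis using module[of w a b] that key_u(1) key_v(1) by auto
  qed
  have ne: "R u v \<noteq> {}" "R v u \<noteq> {}" by (auto simp: R_def)
  have sub: "R u v \<subseteq> V" "R v u \<subseteq> V" using key_u(1) key_v(1) M by auto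
  show False
  proof (cases "card (R u v) \<le> card (R v u)")
    case True
    show False
      by (rule no_dominated_clique[OF sub(1) ne(1) key_u(2) sub(2) key_v(2) disj True])
        (use dom in blast)
  next
    case False
    then have le: "card (R v u) \<le> card (R u v)" by simp
    have disj': "R v u \<inter> R u v = {}" using disj by blast
    show False
      by (rule no_dominated_clique[OF sub(2) ne(2) key_v(2) sub(1) key_u(2) disj' le])
        (use dom in blast)
  qed
qed

end

section \<open>Co-matchings\<close>

lemma ex_less_notin: "finite S \<Longrightarrow> card S < n \<Longrightarrow> \<exists>i<n. i \<notin> S" for S :: "nat set"
  using card_mono[of S "{..<n}"] by fastforce

context free_graph
begin

lemma adj_commute: "E u v \<longleftrightarrow> E v u"
  using sym by blast

text \<open>
The induced subgraph is a complete bipartite graph with sides \<open>v\<close> and \<open>a\<close> minus a perfect matching. With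
five vertices on each side, there remain enough vertices to exhibit a forbidden subgraph after some
indices have been excluded.
\<close>
definition co_matching :: "(nat \<Rightarrow> 'a) \<Rightarrow> (nat \<Rightarrow> 'a) \<Rightarrow> bool" where
  "co_matching v a \<longleftrightarrow> (\<forall>i<5. v i \<in> V \<and> a i \<in> V) \<and>
     (\<forall>i<5. \<forall>j<5. \<not> E (v i) (v j) \<and> \<not> E (a i) (a j) \<and> (E (v i) (a j) \<longleftrightarrow> i \<noteq> j))"

lemma co_matching_swap: "co_matching v a \<Longrightarrow> co_matching a v"
  unfolding co_matching_def using sym by blast

lemma co_matchingD:
  assumes "co_matching v a" "i < 5" "j < 5"
  shows "v i \<in> V" "a i \<in> V" "\<not> E (v i) (v j)" "\<not> E (a i) (a j)"
    "E (v i) (a j) \<longleftrightarrow> i \<noteq> j" "E (a i) (v j) \<longleftrightarrow> i \<noteq> j" "i \<noteq> j \<Longrightarrow> v i \<noteq> v j"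
  using assms sym unfolding co_matching_def by metis+

text \<open>
A vertex \<open>w\<close> that is adjacent to \<open>a l\<close> but not to \<open>a l'\<close> would form a paraglider with these two vertices
and their common neighbors \<open>v i\<close> and \<open>v j\<close>.
\<close>
lemma co_matching_uniform_step:
  assumes cm: "co_matching v a" and w: "w \<in> V"
    and lt: "i < 5" "j < 5" "l < 5" "l' < 5"
    and ne: "i \<noteq> j" "l \<noteq> i" "l \<noteq> j" "l' \<noteq> i" "l' \<noteq> j"
    and adj: "E w (v i)" "E w (v j)" "E w (a l)"
  shows "E w (a l')"
proof -
  have "E (a l') w \<or> E (a l') (a l)"
    by (rule paraglider_free[of "v i" "v j" w "a l" "a l'"])
      (use w lt ne adj co_matchingD[OF cm] in \<open>auto simp: adj_commute\<close>)
  then show ?thesis using sym co_matchingD(4)[OF cm] lt by blast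
qed

lemma co_matching_uniform:
  assumes cm: "co_matching v a" and w: "w \<in> V" and card: "card {i. i < 5 \<and> E w (v i)} \<ge> 3"
    and l: "l < 5" "E w (a l)" "l' < (5::nat)"
  shows "E w (a l')"
proof -
  obtain S where S: "S \<subseteq> {i. i < 5 \<and> E w (v i)}" "card S = 3"
    using obtain_subset_with_card_n[OF card] by metis
  then obtain i j h where ijh: "S = {i, j, h}" "i \<noteq> j" "i \<noteq> h" "j \<noteq> h"
    by (auto simp: card_3_iff)
  then obtain p where p: "p < 5" "p \<notin> S"
    using ex_less_notin[of S 5] S by auto
  have step: "E w (a y)" if "E w (a x)" "x < 5" "y < 5" "x \<notin> S \<or> y \<notin> S" for x y
  proof -
    obtain s t where st: "s \<in> S" "t \<in> S" "s \<noteq> t" "x \<noteq> s" "x \<noteq> t" "y \<noteq> s" "y \<noteq> t"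
    proof -
      consider "x \<notin> S" "y = i" | "x \<notin> S" "y = j" | "x \<notin> S" "y \<noteq> i" "y \<noteq> j"
        | "y \<notin> S" "x = i" | "y \<notin> S" "x = j" | "y \<notin> S" "x \<noteq> i" "x \<noteq> j"
        using \<open>x \<notin> S \<or> y \<notin> S\<close> by blast
      then show thesis
        by cases (use that ijh in \<open>metis insertCI\<close>)+
    qed
    then have "s < 5" "t < 5" "E w (v s)" "E w (v t)" using S by auto
    then show ?thesis
      using co_matching_uniform_step[OF cm w, of s t x y] st \<open>E w (a x)\<close> \<open>x < 5\<close> \<open>y < 5\<close> by blast
  qed
  show ?thesis using step[of l p] step[of p l'] l p by blast
qed

text \<open>
Such a vertex looks like an element of the side \<open>a\<close>.
\<close>
definition attached :: "(nat \<Rightarrow> 'a) \<Rightarrow> (nat \<Rightarrow> 'a) \<Rightarrow> 'a \<Rightarrow> bool" where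
  "attached v a w \<longleftrightarrow> (\<forall>l<5. \<not> E w (a l)) \<and> (\<forall>i<5. \<forall>j<5. i \<noteq> j \<longrightarrow> E w (v i) \<or> E w (v j))"

text \<open>
The vertex \<open>w\<close> is uniform on the side \<open>a\<close>. If it is anticomplete to it and has two nonneighbors \<open>v i\<close> and \<open>v j\<close>, it
forms a co-gem with the path \<open>a i, v j, a l, v i\<close>.
\<close>
lemma attached_or_complete:
  assumes cm: "co_matching v a" and w: "w \<in> V" and card: "card {i. i < 5 \<and> E w (v i)} \<ge> 3"
  shows "attached v a w \<or> (\<forall>i<5. E w (v i) \<and> E w (a i))"
proof (cases "\<exists>l<5. E w (a l)")
  case True
  then have all: "\<forall>l<5. E w (a l)" using co_matching_uniform[OF cm w card] by blast
  then have "{i. i < 5 \<and> E w (a i)} = {..<5}" by auto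
  then have "card {i. i < 5 \<and> E w (a i)} \<ge> 3" by simp
  note * = co_matching_uniform[OF co_matching_swap[OF cm] w this]
  have "{i. i < 5 \<and> E w (v i)} \<noteq> {}" using card by (metis card.empty not_numeral_le_zero)
  then have "\<forall>l<5. E w (v l)" using * by blast
  then show ?thesis using all by blast
next
  case False
  have "E w (v i) \<or> E w (v j)" if ij: "i < 5" "j < 5" "i \<noteq> j" for i j
  proof (rule ccontr)
    assume no: "\<not> (E w (v i) \<or> E w (v j))"
    have "card {i, j} \<le> 2" by (simp add: card_insert_if)
    then obtain l where l: "l < 5" "l \<noteq> i" "l \<noteq> j"
      using ex_less_notin[of "{i, j}" 5] by auto
    show False
      by (rule co_gem_free[of "a i" "v j" "a l" "v i" w])
        (use l ij no w False co_matchingD[OF cm] in \<open>auto simp: adj_commute\<close>)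
  qed
  then show ?thesis using False by (auto simp: attached_def)
qed

text \<open>
A vertex that has at most two neighbors on each side would be anticomplete to one of the induced paths
\<open>a i, v j, a l, v i\<close>, and form a co-gem with it.
\<close>
lemma co_matching_classification:
  assumes cm: "co_matching v a" and w: "w \<in> V"
  shows "attached v a w \<or> attached a v w \<or> (\<forall>i<5. E w (v i) \<and> E w (a i))"
proof -
  let ?X = "{i. i < 5 \<and> E w (v i)}" and ?Y = "{i. i < 5 \<and> E w (a i)}"
  have "card ?X \<ge> 3 \<or> card ?Y \<ge> 3"
  proof (rule ccontr)
    assume "\<not> ?thesis"
    then have small: "card ?X \<le> 2" "card ?Y \<le> 2" by auto
    have "card (?X \<union> ?Y) < 5" using card_Un_le[of ?X ?Y] small by linarith
    then obtain i where i: "i < 5" "i \<notin> ?X" "i \<notin> ?Y" using ex_less_notin[of "?X \<union> ?Y" 5] by auto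
    have "card (insert i ?X) < 5" using small by (simp add: card_insert_if)
    then obtain j where j: "j < 5" "j \<noteq> i" "j \<notin> ?X" using ex_less_notin[of "insert i ?X" 5] by auto
    have "card (insert j (insert i ?Y)) < 5" using small by (simp add: card_insert_if)
    then obtain l where l: "l < 5" "l \<noteq> i" "l \<noteq> j" "l \<notin> ?Y"
      using ex_less_notin[of "insert j (insert i ?Y)" 5] by auto
    show False
      by (rule co_gem_free[of "a i" "v j" "a l" "v i" w])
        (use i j l w co_matchingD[OF cm] in \<open>auto simp: adj_commute\<close>)
  qed
  then show ?thesis
    using attached_or_complete[OF cm w] attached_or_complete[OF co_matching_swap[OF cm] w] by blast
qed

end

context rigid_graph
begin

text \<open>
If \<open>w\<close> and \<open>a j\<close> both miss only \<open>v j\<close> on the side \<open>v\<close>, then \<open>w\<close> is dominated by \<open>a j\<close>: a neighbor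
\<open>x\<close> of \<open>w\<close> that is not adjacent to \<open>a j\<close> gives rise to a paraglider if it is attached like \<open>a j\<close>, and to the
co-gem \<open>a j, v i, w, x\<close> plus \<open>v j\<close> if it is attached like \<open>v i\<close>.
\<close>
lemma attached_unique:
  assumes cm: "co_matching v a" and ij: "i < 5" "j < 5" "i \<noteq> j"
    and w: "w \<in> V" "E w (v i)" "\<not> E w (v j)"
  shows "w = a j"
proof (rule ccontr)
  assume ne: "w \<noteq> a j"
  note D = co_matchingD[OF cm]
  have aw: "attached v a w"
    using co_matching_classification[OF cm w(1)] w ij by (auto simp: attached_def)
  have w_a: "\<not> E w (a l)" "\<not> E (a l) w" if "l < 5" for l
    using aw that sym by (auto simp: attached_def)
  have w_v: "E w (v l)" "E (v l) w" if "l < 5" "l \<noteq> j" for l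
    using aw that w ij sym by (auto simp: attached_def)
  show False
  proof (rule no_dominated_vertex[of w "a j"])
    fix x assume x: "x \<in> V" "E w x"
    show "E (a j) x"
    proof (rule ccontr)
      assume no: "\<not> E (a j) x"
      have no': "\<not> E x (a j)" using no sym by blast
      from co_matching_classification[OF cm x(1)] show False
      proof (elim disjE)
        assume "attached v a x"
        then have x_a: "\<forall>l<5. \<not> E x (a l)"
          and x_v: "\<forall>l<5. \<forall>l'<5. l \<noteq> l' \<longrightarrow> E x (v l) \<or> E x (v l')"
          by (auto simp: attached_def)
        obtain m where m: "m < 5" "\<forall>l<5. l \<noteq> m \<longrightarrow> E x (v l)"
          using x_v ij by (metis)
        obtain s t where st: "s < 5" "t < 5" "s \<noteq> t" "s \<notin> {j, m}" "t \<notin> {j, m}"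
        proof -
          have "card ({..<5} - {j, m}) \<ge> 5 - card {j, m}"
            using diff_card_le_card_Diff[of "{j, m}" "{..<5::nat}"] by simp
          moreover have "card {j, m} \<le> 2" by (simp add: card_insert_if)
          ultimately have "2 \<le> card ({..<5} - {j, m})" by linarith
          then obtain S where "S \<subseteq> {..<5} - {j, m}" "card S = 2"
            by (metis obtain_subset_with_card_n)
          then show thesis using that by (auto simp: card_2_iff)
        qed
        have jr: "j < 5" "j \<noteq> s" "j \<noteq> t" using ij st by auto
        have "E (a j) w \<or> E (a j) x"
          by (rule paraglider_free[of "v s" "v t" w x "a j"])
            (use st jr m w_v x w D in \<open>auto simp: adj_commute\<close>)
        then show False using w_a jr x_a sym by blast
      next
        assume "attached a v x"
        then have x_v: "\<not> E x (v l)" "\<not> E (v l) x" if "l < 5" for l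
          using that sym by (auto simp: attached_def)
        show False
          by (rule co_gem_free[of "a j" "v i" w x "v j"])
            (use ij w w_a x_v x no no' D in \<open>auto simp: adj_commute\<close>)
      next
        assume "\<forall>i<5. E x (v i) \<and> E x (a i)"
        then show False using no' ij by blast
      qed
    qed
  qed (use w ne ij D w_a in auto)
qed

text \<open>
The edge between \<open>v 0\<close> and \<open>a 1\<close> folds onto the edge between \<open>v 1\<close> and \<open>a 0\<close>: by \<open>attached_unique\<close>,
the only neighbor of \<open>v 0\<close> that is not a neighbor of \<open>v 1\<close> is \<open>a 1\<close>, and symmetrically.
\<close>
lemma no_co_matching: "\<not> co_matching v a"
proof
  assume cm: "co_matching v a"
  note D = co_matchingD[OF cm]
  define f where "f x = (if x = v 0 then v 1 else a 0)" for x
  have adj: "E (v 0) (a 1)" "E (v 1) (a 0)" "\<not> E (v 0) (v 1)" "\<not> E (a 0) (a 1)"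
    "\<not> E (a 1) (a 0)" "\<not> E (v 0) (a 0)" "\<not> E (v 1) (a 1)"
    using D[of 0 1] D[of 1 0] D[of 0 0] D[of 1 1] by auto
  then have ne: "v 0 \<noteq> a 1" "v 0 \<noteq> a 0" "v 0 \<noteq> v 1" "a 1 \<noteq> a 0" "a 1 \<noteq> v 1"
    using irrefl by metis+
  have "fold_on V E {v 0, a 1} f"
    unfolding fold_on_def
  proof (intro conjI ballI impI)
    fix x assume "x \<in> {v 0, a 1}"
    then show "f x \<in> V - {v 0, a 1}"
      using D[of 0 0] D[of 1 1] ne by (auto simp: f_def)
  next
    fix x w assume x: "x \<in> {v 0, a 1}" and w: "w \<in> V" "E x w"
    show "E (f x) (if w \<in> {v 0, a 1} then f w else w)"
    proof (cases "w \<in> {v 0, a 1}")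
      case True
      then have "(x = v 0 \<and> w = a 1) \<or> (x = a 1 \<and> w = v 0)"
        using x w irrefl by auto
      then show ?thesis using D[of 1 0] D[of 0 1] ne by (auto simp: f_def)
    next
      case False
      from x consider "x = v 0" | "x = a 1" by blast
      then show ?thesis
      proof cases
        case 1
        then have "E (v 1) w"
          using attached_unique[OF cm, of 0 1 w] w False sym by auto
        then show ?thesis using 1 False by (simp add: f_def)
      next
        case 2
        then have "E (a 0) w"
          using attached_unique[OF co_matching_swap[OF cm], of 1 0 w] w False sym by auto
        then show ?thesis using 2 False ne by (simp add: f_def)
      qed
    qed
  qed (use D[of 0 0] D[of 1 1] in auto)
  from no_fold[OF this] show False using k_pos ne by simp
qed

end

section \<open>Graphs without folds are bounded\<close>

text \<open>
Connectivity in terms of cuts gives directly what is needed about paths: a vertex with both a neighbor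
and a nonneighbor in a connected set has them at the two ends of some edge.
\<close>
definition conn_on :: "('a \<Rightarrow> 'a \<Rightarrow> bool) \<Rightarrow> 'a set \<Rightarrow> bool" where
  "conn_on E S \<longleftrightarrow> (\<forall>X. X \<subset> S \<longrightarrow> X \<noteq> {} \<longrightarrow> (\<exists>x\<in>X. \<exists>y\<in>S - X. E x y))"

lemma conn_onD:
  assumes "conn_on E S" "X \<subset> S" "X \<noteq> {}"
  obtains x y where "x \<in> X" "y \<in> S" "y \<notin> X" "E x y"
proof -
  have "\<exists>x\<in>X. \<exists>y\<in>S - X. E x y" using assms unfolding conn_on_def by blast
  then show thesis using that by blast
qed

lemma conn_on_insert:
  assumes S: "conn_on E S" and x: "x \<in> S" "E w x" "E x w"
  shows "conn_on E (insert w S)"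
  unfolding conn_on_def
proof (intro allI impI)
  fix X assume X: "X \<subset> insert w S" "X \<noteq> {}"
  show "\<exists>x\<in>X. \<exists>y\<in>insert w S - X. E x y"
  proof (cases "X \<inter> S = {} \<or> S \<subseteq> X")
    case True
    then show ?thesis using X x by (cases "w \<in> X") blast+
  next
    case False
    then have "X \<inter> S \<subset> S" "X \<inter> S \<noteq> {}" by auto
    from conn_onD[OF S this] show ?thesis by blast
  qed
qed

context free_graph
begin

definition separated_family :: "(nat \<Rightarrow> 'a set) \<Rightarrow> nat \<Rightarrow> bool" where
  "separated_family K m \<longleftrightarrow> (\<forall>i<m. K i \<subseteq> V \<and> K i \<noteq> {} \<and> conn_on E (K i)) \<and>
     (\<forall>i<m. \<forall>j<m. i \<noteq> j \<longrightarrow> (\<forall>x\<in>K i. \<forall>y\<in>K j. x \<noteq> y \<and> \<not> E x y))"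

end

text \<open>
In the remarks below, \<open>w\<close> is mixed on \<open>K i\<close> if it has both a neighbor and a nonneighbor in \<open>K i\<close>.
\<close>
locale maximal_family = rigid_graph +
  fixes K :: "nat \<Rightarrow> 'a set" and m :: nat
  assumes family: "separated_family K m"
    and maximal: "separated_family K' m \<Longrightarrow> card (\<Union>i<m. K' i) \<le> card (\<Union>i<m. K i)"
    and m_ge: "m \<ge> 5"
begin

definition covered :: "'a set" where "covered = (\<Union>i<m. K i)"

definition outside :: "'a set" where "outside = V - covered"

definition full :: "'a \<Rightarrow> nat set" where "full w = {i. i < m \<and> (\<forall>x\<in>K i. E w x)}"

text \<open>
Complementing the large index sets turns the three possible relations between two of them (comparable,
disjoint, or covering all indices) into laminarity.
\<close>
definition trace :: "'a \<Rightarrow> nat set" where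
  "trace w = (if 2 * card (full w) < m then full w else {..<m} - full w)"

lemma K_props:
  assumes "i < m" shows "K i \<subseteq> V" "K i \<noteq> {}" "conn_on E (K i)"
  using family assms by (auto simp: separated_family_def)

lemma K_in_V: "i < m \<Longrightarrow> x \<in> K i \<Longrightarrow> x \<in> V"
  using K_props by blast

lemma K_apart:
  assumes "i < m" "j < m" "i \<noteq> j" "x \<in> K i" "y \<in> K j" shows "x \<noteq> y" "\<not> E x y"
  using family assms by (auto simp: separated_family_def)

lemma outside_in_V: "w \<in> outside \<Longrightarrow> w \<in> V"
  by (simp add: outside_def)

lemma full_le: "full w \<subseteq> {..<m}" and finite_full: "finite (full w)"
  by (auto simp: full_def)

lemma trace_le: "trace w \<subseteq> {..<m}" and finite_trace: "finite (trace w)"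
  using full_le[of w] finite_full[of w] by (auto simp: trace_def)

text \<open>
Otherwise \<open>w\<close> could be added to \<open>K i\<close>, contradicting the maximality of the union.
\<close>
lemma touches_another:
  assumes w: "w \<in> outside" and i: "i < m" and x: "x \<in> K i" "E w x"
  obtains j y where "j < m" "j \<noteq> i" "y \<in> K j" "E w y"
proof (rule ccontr)
  assume "\<not> thesis"
  with that have none: "\<not> E w y" if "j < m" "j \<noteq> i" "y \<in> K j" for j y
    using \<open>j < m\<close> \<open>j \<noteq> i\<close> \<open>y \<in> K j\<close> by blast
  have w_notin: "w \<notin> K j" if "j < m" for j using w that by (auto simp: outside_def covered_def)
  let ?K = "K(i := insert w (K i))"
  have "separated_family ?K m"
    unfolding separated_family_def
  proof (intro conjI allI impI ballI)
    fix j assume j: "j < m"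
    show "?K j \<subseteq> V" using K_props(1)[OF j] w by (auto simp: outside_def)
    show "?K j \<noteq> {}" using K_props(2)[OF j] by auto
    show "conn_on E (?K j)"
      using K_props(3)[OF j] conn_on_insert[OF K_props(3)[OF i] x sym[OF x(2)]] by auto
  next
    fix j l y z assume *: "j < m" "l < m" "j \<noteq> l" "y \<in> ?K j" "z \<in> ?K l"
    show "y \<noteq> z"
      using * K_apart(1)[of j l y z] w_notin by (auto split: if_splits)
    show "\<not> E y z"
      using * K_apart(2)[of j l y z] none[of l z] none[of j y] sym by (auto split: if_splits)
  qed
  from maximal[OF this] have le: "card (\<Union>j<m. ?K j) \<le> card covered" by (simp add: covered_def)
  have eq: "(\<Union>j<m. ?K j) = insert w covered" using i by (auto simp: covered_def split: if_splits)
  have "covered \<subseteq> V" using K_props(1) by (auto simp: covered_def)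
  then have "finite covered" using finite_V finite_subset by auto
  moreover have "w \<notin> covered" using w by (simp add: outside_def)
  ultimately show False using le eq by simp
qed

text \<open>
Let \<open>w\<close> be adjacent to \<open>a\<close> but not to \<open>b\<close>, where \<open>a\<close> and \<open>b\<close> are adjacent in \<open>K i\<close>, and let \<open>z\<close> be a neighbor of
\<open>w\<close> in another set. Then \<open>z, w, a, b\<close> is an induced path, so \<open>w\<close> is adjacent to every vertex in the
sets other than those of \<open>a\<close> and \<open>z\<close>. Starting from one of these neighbors instead of \<open>z\<close>, the remaining
set is reached as well.
\<close>
lemma mixed_complete_elsewhere:
  assumes w: "w \<in> outside" and i: "i < m" and xy: "x \<in> K i" "E w x" "y \<in> K i" "\<not> E w y"
  shows "{..<m} - {i} \<subseteq> full w"
proof -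
  obtain a b where ab: "a \<in> K i" "E w a" "b \<in> K i" "\<not> E w b" "E a b"
  proof -
    have "{a \<in> K i. E w a} \<subset> K i" "{a \<in> K i. E w a} \<noteq> {}" using xy by auto
    from conn_onD[OF K_props(3)[OF i] this] that show thesis by blast
  qed
  have spread: "E w z'" if z: "j < m" "j \<noteq> i" "z \<in> K j" "E w z"
    and z': "l < m" "l \<noteq> i" "l \<noteq> j" "z' \<in> K l" for j z l z'
  proof (rule ccontr)
    assume no: "\<not> E w z'"
    show False
      by (rule co_gem_free[of z w a b z'])
        (use z z' no w i ab K_in_V outside_in_V K_apart(2)[of j i z] K_apart(2)[of j l z z']
          K_apart(2)[of i l _ z'] sym in blast)+
  qed
  obtain j z where z: "j < m" "j \<noteq> i" "z \<in> K j" "E w z"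
    using touches_another[OF w i xy(1,2)] by blast
  have "card {i, j} \<le> 2" by (simp add: card_insert_if)
  then obtain l where l: "l < m" "l \<noteq> i" "l \<noteq> j"
    using ex_less_notin[of "{i, j}" m] m_ge by auto
  obtain z' where z': "z' \<in> K l" using K_props(2)[OF l(1)] by blast
  have "E w z'" using spread[OF z l z'] .
  show ?thesis
  proof
    fix h assume "h \<in> {..<m} - {i}"
    then have h: "h < m" "h \<noteq> i" by auto
    have "E w y" if "y \<in> K h" for y
    proof (cases "h = j")
      case True
      then show ?thesis using spread[OF l(1,2) z' \<open>E w z'\<close>, of h y] h that l by blast
    next
      case False
      then show ?thesis using spread[OF z, of h y] h that by blast
    qed
    then show "h \<in> full w" using h by (simp add: full_def)
  qed
qed

text \<open>
Without a common nonneighbor, both vertices would be mixed on \<open>K j\<close>, and then complete to all other sets.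
\<close>
lemma common_non_neighbor:
  assumes w: "w \<in> outside" "w' \<in> outside" and ne: "full w \<noteq> full w'" and j: "j < m" "j \<notin> full w" "j \<notin> full w'"
  obtains x where "x \<in> K j" "\<not> E w x" "\<not> E w' x"
proof (rule ccontr)
  assume "\<not> thesis"
  with that have none: "\<forall>x\<in>K j. E w x \<or> E w' x" by blast
  obtain x y where xy: "x \<in> K j" "\<not> E w x" "y \<in> K j" "\<not> E w' y"
    using j by (auto simp: full_def)
  then have "E w' x" "E w y" using none by auto
  then have "{..<m} - {j} \<subseteq> full w" "{..<m} - {j} \<subseteq> full w'"
    using mixed_complete_elsewhere[OF w(1) j(1)] mixed_complete_elsewhere[OF w(2) j(1)] xy by blast+
  then have "full w = {..<m} - {j}" "full w' = {..<m} - {j}" using full_le[of w] full_le[of w'] j by auto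
  then show False using ne by simp
qed

text \<open>
Depending on whether \<open>w\<close> and \<open>w'\<close> are adjacent, there is an induced path \<open>a, w, w', b\<close> or \<open>a, w, b, w'\<close> with
\<open>a\<close> in \<open>K i\<close> and \<open>b\<close> in \<open>K l\<close>. An index outside of both sets would provide the isolated vertex of a co-gem.
\<close>
lemma covering:
  assumes w: "w \<in> outside" "w' \<in> outside" and i: "i \<in> full w" "i \<notin> full w'"
    and l: "l \<in> full w'" "l \<in> full w \<longleftrightarrow> \<not> E w w'"
  shows "full w \<union> full w' = {..<m}"
proof (rule ccontr)
  assume "full w \<union> full w' \<noteq> {..<m}"
  then obtain j where j: "j < m" "j \<notin> full w" "j \<notin> full w'" using full_le[of w] full_le[of w'] by auto
  then obtain e where e: "e \<in> K j" "\<not> E w e" "\<not> E w' e"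
    using common_non_neighbor[OF w _ j] i by blast
  have im: "i < m" "l < m" using i l full_le[of w] full_le[of w'] by auto
  obtain a where a: "a \<in> K i" "\<not> E w' a" "E w a" using i im by (auto simp: full_def)
  have ne: "i \<noteq> l" "i \<noteq> j" "l \<noteq> j" using i l j by auto
  note V = K_in_V[OF im(1) a(1)] K_in_V[OF j(1) e(1)] outside_in_V[OF w(1)] outside_in_V[OF w(2)]
  show False
  proof (cases "E w w'")
    case True
    then obtain b where b: "b \<in> K l" "\<not> E w b" "E w' b" using l im by (auto simp: full_def)
    show False
      by (rule co_gem_free[of a w w' b e])
        (use V a b e True ne im j K_in_V[OF im(2) b(1)] K_apart(2)[of i l a b]
          K_apart(2)[of i j a e] K_apart(2)[of l j b e] sym in blast)+
  next
    case False
    obtain b where b: "b \<in> K l" using K_props(2)[OF im(2)] by blast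
    then have "E w b" "E w' b" using l False by (auto simp: full_def)
    then show False
      by (intro co_gem_free[of a w b w' e])
        (use V a b e False ne im j K_in_V[OF im(2) b(1)] K_apart(2)[of i l a b]
          K_apart(2)[of i j a e] K_apart(2)[of l j b e] sym in blast)+
  qed
qed

lemma full_adjacent:
  assumes "w \<in> outside" "w' \<in> outside" "E w w'"
  shows "full w \<subseteq> full w' \<or> full w' \<subseteq> full w \<or> full w \<union> full w' = {..<m}"
  using covering[OF assms(1,2)] assms(3) by blast

lemma full_nonadjacent:
  assumes "w \<in> outside" "w' \<in> outside" "\<not> E w w'"
  shows "full w = full w' \<or> full w \<inter> full w' = {} \<or> full w \<union> full w' = {..<m}"
  using covering[OF assms(1,2)] covering[OF assms(2,1)] assms(3) sym by blast

lemma full_cover_card: "full w \<union> full w' = {..<m} \<Longrightarrow> m \<le> card (full w) + card (full w')"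
  using card_Un_le[of "full w" "full w'"] by simp

lemma full_disjoint_big:
  assumes "full w \<inter> full w' = {}" "m \<le> 2 * card (full w)" "m \<le> 2 * card (full w')"
  shows "full w \<union> full w' = {..<m}"
proof (rule card_subset_eq)
  show "full w \<union> full w' \<subseteq> {..<m}" using full_le by auto
  then have "card (full w \<union> full w') \<le> m" using card_mono[of "{..<m}"] by fastforce
  moreover have "card (full w \<union> full w') = card (full w) + card (full w')"
    using assms(1) finite_full by (simp add: card_Un_disjoint)
  ultimately show "card (full w \<union> full w') = card {..<m}" using assms(2,3) by simp
qed simp

lemma trace_laminar:
  assumes w: "w \<in> outside" "w' \<in> outside"
  shows "trace w \<inter> trace w' = {} \<or> trace w \<subseteq> trace w' \<or> trace w' \<subseteq> trace w"
proof -
  have le: "full w \<subseteq> full w' \<Longrightarrow> card (full w) \<le> card (full w')" "full w' \<subseteq> full w \<Longrightarrow> card (full w') \<le> card (full w)"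
    using finite_full card_mono by auto
  note sub = full_le[of w] full_le[of w']
  consider "full w \<union> full w' = {..<m}" | "full w = full w'" | "E w w'" "full w \<subseteq> full w' \<or> full w' \<subseteq> full w"
    | "full w \<inter> full w' = {}"
    using full_adjacent[OF w] full_nonadjacent[OF w] by blast
  then show ?thesis
  proof cases
    case 1
    then have "\<not> (2 * card (full w) < m \<and> 2 * card (full w') < m)" using full_cover_card by fastforce
    then show ?thesis using 1 sub by (auto simp: trace_def)
  next
    case 2
    then show ?thesis by (simp add: trace_def)
  next
    case 3
    then show ?thesis using le sub by (auto simp: trace_def)
  next
    case 4
    then show ?thesis using full_disjoint_big[of w w'] sub by (auto simp: trace_def)
  qed
qed

lemma card_image_of_adjacent:
  assumes X: "X \<subseteq> V" and adj: "\<And>w w'. w \<in> X \<Longrightarrow> w' \<in> X \<Longrightarrow> g w \<noteq> g w' \<Longrightarrow> E w w'"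
  shows "card (g ` X) \<le> k"
proof -
  let ?C = "inv_into X g ` g ` X"
  have sub: "?C \<subseteq> X" by (auto intro: inv_into_into)
  have "clique_on E ?C"
    unfolding clique_on_def
  proof (intro ballI impI)
    fix u v assume *: "u \<in> ?C" "v \<in> ?C" "u \<noteq> v"
    then have "g u \<noteq> g v" by (auto simp: f_inv_into_f)
    then show "E u v" using adj[of u v] * sub by blast
  qed
  moreover have "?C \<subseteq> V" using sub X by blast
  ultimately have "card ?C \<le> k" by (rule clique_le[rotated])
  moreover have "card ?C = card (g ` X)" by (rule card_image) (rule inj_on_inv_into, simp)
  ultimately show ?thesis by simp
qed

text \<open>
Distinct traces of the same kind (complemented or not) that share an index belong to adjacent vertices. So
choosing a vertex for each of them gives a clique.
\<close>
lemma card_traces_through_index: "card (trace ` {w \<in> outside. i \<in> trace w}) \<le> 2 * k"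
proof -
  let ?S = "{w \<in> outside. i \<in> trace w \<and> 2 * card (full w) < m}" and ?B = "{w \<in> outside. i \<in> trace w \<and> m \<le> 2 * card (full w)}"
  have "card (trace ` ?S) \<le> k"
  proof (rule card_image_of_adjacent)
    fix w w' assume *: "w \<in> ?S" "w' \<in> ?S" "trace w \<noteq> trace w'"
    then have "full w \<noteq> full w'" "i \<in> full w \<inter> full w'" by (auto simp: trace_def)
    then show "E w w'" using full_nonadjacent[of w w'] full_cover_card[of w w'] * by fastforce
  qed (auto simp: outside_def)
  moreover have "card (trace ` ?B) \<le> k"
  proof (rule card_image_of_adjacent)
    fix w w' assume *: "w \<in> ?B" "w' \<in> ?B" "trace w \<noteq> trace w'"
    then have "full w \<noteq> full w'" "i \<notin> full w \<union> full w'" "i < m"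
      by (auto simp: trace_def split: if_splits)
    then show "E w w'" using full_nonadjacent[of w w'] full_disjoint_big[of w w'] * by blast
  qed (auto simp: outside_def)
  moreover have "{w \<in> outside. i \<in> trace w} = ?S \<union> ?B" by auto
  ultimately show ?thesis
    using card_Un_le[of "trace ` ?S" "trace ` ?B"] by (simp add: image_Un)
qed

text \<open>
An induced path on four vertices in \<open>K i\<close> would form a co-gem with a vertex of another set.
\<close>
lemma unmixed_is_clique:
  assumes i: "i < m" and unmixed: "\<And>w x y. w \<in> outside \<Longrightarrow> x \<in> K i \<Longrightarrow> y \<in> K i \<Longrightarrow> E x w \<Longrightarrow> E y w"
  shows "clique_on E (K i)"
proof (rule P4_free_module_is_clique[OF K_props(1)[OF i]])
  fix w x y assume *: "w \<in> V" "w \<notin> K i" "x \<in> K i" "y \<in> K i" "E x w"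
  show "E y w"
  proof (cases "w \<in> outside")
    case True
    then show ?thesis using unmixed * by blast
  next
    case False
    then obtain j where "j < m" "w \<in> K j" using * by (auto simp: outside_def covered_def)
    then show ?thesis using K_apart(2)[of i j x w] * i by blast
  qed
next
  fix a b c d
  assume *: "a \<in> K i" "b \<in> K i" "c \<in> K i" "d \<in> K i" "E a b" "E b c" "E c d"
    "\<not> E a c" "\<not> E a d" "\<not> E b d"
  obtain j where j: "j < m" "j \<noteq> i" using ex_less_notin[of "{i}" m] m_ge by auto
  obtain e where e: "e \<in> K j" using K_props(2)[OF j(1)] by blast
  show False
    by (rule co_gem_free[of a b c d e]) (use * e i j K_in_V K_apart(2)[of i j _ e] in blast)+
qed

text \<open>
A vertex mixed on \<open>K i\<close> has trace \<open>{i}\<close>. So if no trace separates \<open>i\<close> from \<open>j\<close>, no vertex is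
mixed on \<open>K i\<close> or \<open>K j\<close>, both are cliques with the same neighborhood, and one folds into the other.
\<close>
lemma traces_separate:
  assumes ij: "i < m" "j < m" "i \<noteq> j"
  shows "\<exists>w\<in>outside. (i \<in> trace w) \<noteq> (j \<in> trace w)"
proof (rule ccontr)
  assume "\<not> ?thesis"
  then have same: "i \<in> full w \<longleftrightarrow> j \<in> full w" if "w \<in> outside" for w
    using that ij by (auto simp: trace_def split: if_splits)
  have unmixed: "E y w"
    if w: "w \<in> outside" and h: "h = i \<or> h = j" and xy: "x \<in> K h" "y \<in> K h" "E x w" for w h x y
  proof (rule ccontr)
    assume "\<not> E y w"
    then have "{..<m} - {h} \<subseteq> full w" "h \<notin> full w"
      using mixed_complete_elsewhere[OF w, of h x y] h ij xy sym by (auto simp: full_def)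
    then show False using same[OF w] h ij by auto
  qed
  have cliques: "clique_on E (K i)" "clique_on E (K j)"
    using unmixed_is_clique unmixed ij by blast+
  have T_iff: "h \<in> full w" if "w \<in> outside" "h = i \<or> h = j" "x \<in> K h" "E x w" for w h x
    using unmixed[OF that(1,2,3) _ that(4)] that ij sym by (auto simp: full_def)
  have dom: "E b w"
    if h: "(h = i \<and> l = j) \<or> (h = j \<and> l = i)"
      and *: "a \<in> K h" "w \<in> V" "w \<notin> K h" "E a w" "b \<in> K l" for h l a w b
  proof (cases "w \<in> outside")
    case True
    then have "h \<in> full w" using T_iff[OF True, of h a] h * by blast
    then have "l \<in> full w" using same[OF True] h by blast
    then show ?thesis using * sym by (auto simp: full_def)
  next
    case False
    then obtain g where "g < m" "w \<in> K g" using * by (auto simp: outside_def covered_def)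
    then show ?thesis using K_apart(2)[of h g a w] * ij h by blast
  qed
  have disj: "K i \<inter> K j = {}" "K j \<inter> K i = {}" using K_apart(1)[OF ij] by blast+
  note P = K_props[OF ij(1)] K_props[OF ij(2)]
  show False
  proof (cases "card (K i) \<le> card (K j)")
    case True
    show False
      by (rule no_dominated_clique[OF P(1,2) cliques(1) P(4) cliques(2) disj(1) True])
        (use dom in blast)
  next
    case False
    then have le: "card (K j) \<le> card (K i)" by simp
    show False
      by (rule no_dominated_clique[OF P(4,5) cliques(2) P(1) cliques(1) disj(2) le])
        (use dom in blast)
  qed
qed

definition singleton_traces :: "nat set" where "singleton_traces = {i. \<exists>w\<in>outside. trace w = {i}}"

text \<open>
A singleton trace is complemented: a vertex complete to \<open>K i\<close> only would be mixed on a further set, and then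
be complete to nearly all the sets.
\<close>
lemma singleton_trace_witness:
  assumes "i \<in> singleton_traces"
  shows "i < m" "\<exists>w\<in>outside. full w = {..<m} - {i}"
proof -
  obtain w where w: "w \<in> outside" "trace w = {i}" using assms by (auto simp: singleton_traces_def)
  show i: "i < m" using trace_le[of w] w by auto
  have "full w = {..<m} - {i}"
  proof (cases "2 * card (full w) < m")
    case True
    then have Tw: "full w = {i}" using w by (simp add: trace_def)
    obtain x where x: "x \<in> K i" "E w x" using K_props(2)[OF i] Tw by (auto simp: full_def)
    obtain j y where j: "j < m" "j \<noteq> i" "y \<in> K j" "E w y"
      using touches_another[OF w(1) i x] by blast
    have "j \<notin> full w" using Tw j by simp
    then obtain y' where "y' \<in> K j" "\<not> E w y'" using j by (auto simp: full_def)
    from mixed_complete_elsewhere[OF w(1) j(1,3,4) this] have "{..<m} \<subseteq> {i, j}" using Tw by auto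
    from card_mono[OF _ this] have "m \<le> card {i, j}" by simp
    moreover have "card {i, j} \<le> 2" by (simp add: card_insert_if)
    ultimately show ?thesis using m_ge by simp
  next
    case False
    then show ?thesis using w full_le[of w] by (auto simp: trace_def)
  qed
  then show "\<exists>w\<in>outside. full w = {..<m} - {i}" using w by blast
qed

text \<open>
A trace inside of a given one that has the least number of elements cannot have two of them: by laminarity,
a trace separating them would be a smaller one.
\<close>
lemma trace_contains_singleton:
  assumes w: "w \<in> outside" "trace w \<noteq> {}"
  shows "\<exists>i\<in>singleton_traces. i \<in> trace w"
proof -
  define P where "P u \<longleftrightarrow> u \<in> outside \<and> trace u \<noteq> {} \<and> trace u \<subseteq> trace w" for u
  have "P w" using w by (simp add: P_def)
  then obtain u where u: "P u" and min: "\<And>v. P v \<Longrightarrow> card (trace u) \<le> card (trace v)"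
    using ex_has_least_nat[of P w "\<lambda>u. card (trace u)"] by blast
  obtain i where i: "i \<in> trace u" using u by (auto simp: P_def)
  have "trace u = {i}"
  proof (rule ccontr)
    assume "trace u \<noteq> {i}"
    then obtain j where j: "j \<in> trace u" "j \<noteq> i" using i by blast
    obtain v where v: "v \<in> outside" "(i \<in> trace v) \<noteq> (j \<in> trace v)"
      using traces_separate[of i j] i j trace_le[of u] by blast
    then have "trace v \<subset> trace u" using trace_laminar[of u v] u i j by (auto simp: P_def)
    then have "P v" "card (trace v) < card (trace u)"
      using u v psubset_card_mono[OF finite_trace] by (auto simp: P_def)
    then show False using min[of v] by simp
  qed
  then show ?thesis using u i by (auto simp: singleton_traces_def P_def)
qed

text \<open>
Five pairwise nonadjacent witnesses of singleton traces, each with a nonneighbor in the set that it misses,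
form a co-matching.
\<close>
lemma card_singleton_traces_less:
  assumes R: "\<And>(S::'a set) F. finite S \<Longrightarrow> R \<le> card S \<Longrightarrow>
      \<exists>Q\<subseteq>S. card Q = k + 1 \<and> clique Q F \<or> card Q = 5 \<and> indep Q F"
  shows "card singleton_traces < R"
proof (rule ccontr)
  assume "\<not> card singleton_traces < R"
  obtain g where g: "\<forall>i\<in>singleton_traces. g i \<in> outside \<and> full (g i) = {..<m} - {i}"
    using singleton_trace_witness(2) by metis
  have inj: "inj_on g singleton_traces"
  proof (rule inj_onI)
    fix i j assume *: "i \<in> singleton_traces" "j \<in> singleton_traces" "g i = g j"
    then have "{..<m} - {i} = {..<m} - {j}" using g by metis
    then show "i = j" using singleton_trace_witness(1)[OF *(1)] singleton_trace_witness(1)[OF *(2)] by blast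
  qed
  have sub: "g ` singleton_traces \<subseteq> V" using g outside_in_V by blast
  then have "finite (g ` singleton_traces)" using finite_V finite_subset by blast
  moreover have "R \<le> card (g ` singleton_traces)"
    using \<open>\<not> card singleton_traces < R\<close> card_image[OF inj] by simp
  ultimately obtain Q where Q: "Q \<subseteq> g ` singleton_traces"
    "card Q = k + 1 \<and> clique Q {{u, v} | u v. E u v} \<or> card Q = 5 \<and> indep Q {{u, v} | u v. E u v}"
    using R[of "g ` singleton_traces" "{{u, v} | u v. E u v}"] by blast
  have edge: "{u, v} \<in> {{u, v} | u v. E u v} \<longleftrightarrow> E u v" for u v
    using sym by (auto simp: doubleton_eq_iff)
  show False
    using Q(2)
  proof
    assume *: "card Q = k + 1 \<and> clique Q {{u, v} | u v. E u v}"
    then have "clique_on E Q" unfolding clique_on_def clique_def edge by blast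
    moreover have "Q \<subseteq> V" using Q(1) sub by blast
    ultimately show False using clique_le[of Q] * by simp
  next
    assume *: "card Q = 5 \<and> indep Q {{u, v} | u v. E u v}"
    then have indep: "\<not> E u v" if "u \<in> Q" "v \<in> Q" for u v
      using that irrefl unfolding indep_def edge by metis
    obtain J where J: "J \<subseteq> singleton_traces" "Q = g ` J" using Q(1) subset_imageE by metis
    have injJ: "inj_on g J" using inj J inj_on_subset by blast
    have "card J = 5" using * J card_image[OF injJ] by simp
    then have "finite J" by (metis card.infinite zero_neq_numeral)
    then obtain h where h: "bij_betw h {0..<5::nat} J"
      using ex_bij_betw_nat_finite[of J] \<open>card J = 5\<close> by auto
    have hJ: "h i \<in> J" "h i < m" "h i \<in> singleton_traces" "g (h i) \<in> outside" "full (g (h i)) = {..<m} - {h i}"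
      if "i < 5" for i
    proof -
      show "h i \<in> J" using bij_betwE[OF h] that by simp
      then show "h i \<in> singleton_traces" using J(1) by blast
      then show "h i < m" "g (h i) \<in> outside" "full (g (h i)) = {..<m} - {h i}"
        using singleton_trace_witness(1) g by blast+
    qed
    have h_ne: "h i \<noteq> h j" if "i < 5" "j < 5" "i \<noteq> j" for i j
      using h that by (auto simp: bij_betw_def inj_on_def)
    have "\<forall>i\<in>{..<5}. \<exists>x. x \<in> K (h i) \<and> \<not> E (g (h i)) x"
    proof
      fix i :: nat assume "i \<in> {..<5}"
      then have "i < 5" by simp
      then have "h i < m" "h i \<notin> full (g (h i))" using hJ by auto
      then show "\<exists>x. x \<in> K (h i) \<and> \<not> E (g (h i)) x" by (auto simp: full_def)
    qed
    then obtain x where x: "\<forall>i\<in>{..<5}. x i \<in> K (h i) \<and> \<not> E (g (h i)) (x i)" by metis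
    have "co_matching x (\<lambda>i. g (h i))"
      unfolding co_matching_def
    proof (intro conjI allI impI)
      fix i :: nat assume i: "i < 5"
      show "x i \<in> V" using x i K_in_V hJ by blast
      show "g (h i) \<in> V" using hJ[OF i] outside_in_V by blast
    next
      fix i j :: nat assume ij: "i < 5" "j < 5"
      show "\<not> E (g (h i)) (g (h j))" using indep hJ ij J(2) by blast
      show "\<not> E (x i) (x j)"
        using K_apart(2)[of "h i" "h j" "x i" "x j"] h_ne[OF ij] x ij hJ irrefl
        by (cases "i = j") auto
      show "E (x i) (g (h j)) \<longleftrightarrow> i \<noteq> j"
      proof (cases "i = j")
        case True
        then show ?thesis using x ij sym by blast
      next
        case False
        then have "h i \<in> full (g (h j))" using hJ h_ne[OF ij] ij by auto
        then have "E (g (h j)) (x i)" using x ij by (auto simp: full_def)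
        then show ?thesis using False sym by blast
      qed
    qed
    then show False using no_co_matching by blast
  qed
qed

text \<open>
Every trace contains a singleton trace and every index lies in at most \<open>2 k\<close> traces, which bounds the number of
traces. As the traces separate the indices, an index is determined by the set of traces containing it.
\<close>
lemma m_bound:
  assumes "card singleton_traces \<le> R"
  shows "m \<le> 2 ^ (R * (2 * k))"
proof -
  define traces where "traces = trace ` outside - {{}}"
  have fin_outside: "finite outside" using finite_V by (simp add: outside_def)
  have fin: "finite traces" using fin_outside by (simp add: traces_def)
  have fin_singletons: "finite singleton_traces"
    using singleton_trace_witness(1) by (intro finite_subset[of singleton_traces "{..<m}"]) auto
  have "traces \<subseteq> (\<Union>i\<in>singleton_traces. trace ` {w \<in> outside. i \<in> trace w})"
    using trace_contains_singleton by (fastforce simp: traces_def)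
  then have "card traces \<le> card (\<Union>i\<in>singleton_traces. trace ` {w \<in> outside. i \<in> trace w})"
    using fin_singletons fin_outside by (intro card_mono) auto
  also have "\<dots> \<le> (\<Sum>i\<in>singleton_traces. card (trace ` {w \<in> outside. i \<in> trace w}))"
    by (rule card_UN_le[OF fin_singletons])
  also have "\<dots> \<le> card singleton_traces * (2 * k)"
    using sum_bounded_above[of singleton_traces "\<lambda>i. card (trace ` {w \<in> outside. i \<in> trace w})" "2 * k"]
      card_traces_through_index by simp
  also have "\<dots> \<le> R * (2 * k)" using assms by simp
  finally have le: "card traces \<le> R * (2 * k)" .
  have "inj_on (\<lambda>i. {X \<in> traces. i \<in> X}) {..<m}"
  proof (rule inj_onI, rule ccontr)
    fix i j assume *: "i \<in> {..<m}" "j \<in> {..<m}" "{X \<in> traces. i \<in> X} = {X \<in> traces. j \<in> X}" "i \<noteq> j"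
    then obtain w where w: "w \<in> outside" "(i \<in> trace w) \<noteq> (j \<in> trace w)" using traces_separate[of i j] by auto
    then have "trace w \<in> traces" by (auto simp: traces_def)
    then show False using * w by blast
  qed
  moreover have "(\<lambda>i. {X \<in> traces. i \<in> X}) ` {..<m} \<subseteq> Pow traces" by auto
  ultimately have "card {..<m} \<le> card (Pow traces)" using fin by (meson card_inj_on_le finite_Pow_iff)
  then have "m \<le> 2 ^ card traces" using fin by (simp add: card_Pow)
  also have "\<dots> \<le> 2 ^ (R * (2 * k))" using le by simp
  finally show ?thesis .
qed

end

lemma ramsey_number_exists:
  "\<exists>R. \<forall>(S :: 'a set) F. finite S \<longrightarrow> R \<le> card S \<longrightarrow>
    (\<exists>Q\<subseteq>S. card Q = p \<and> clique Q F \<or> card Q = q \<and> indep Q F)"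
proof -
  obtain R where "\<forall>(S :: 'a set) F. finite S \<and> R \<le> card S \<longrightarrow>
      (\<exists>Q\<subseteq>S. card Q = p \<and> clique Q F \<or> card Q = q \<and> indep Q F)"
    using ramsey2[of p q] by (elim exE conjE)
  then show ?thesis by (intro exI[of _ R]) simp
qed

text \<open>
Ramsey's theorem yields a large independent set, whose singletons are a separated family. Any family of
the same length with largest union then contradicts \<open>m_bound\<close>.
\<close>
theorem rigid_graph_bounded:
  "\<exists>M. \<forall>(V :: 'a set) E. rigid_graph V E k \<longrightarrow> card V \<le> M"
proof -
  from ramsey_number_exists[of "k + 1" 5]
  obtain R where R: "\<forall>(S::'a set) F. finite S \<longrightarrow> R \<le> card S \<longrightarrow>
      (\<exists>Q\<subseteq>S. card Q = k + 1 \<and> clique Q F \<or> card Q = 5 \<and> indep Q F)" by (rule exE)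
  \<comment> \<open>Above the bound of \<open>m_bound\<close>, and at least five as the locale demands.\<close>
  define m where "m = 2 ^ (R * (2 * k)) + (5::nat)"
  from ramsey_number_exists[of "k + 1" m]
  obtain M where M: "\<forall>(S::'a set) F. finite S \<longrightarrow> M \<le> card S \<longrightarrow>
      (\<exists>Q\<subseteq>S. card Q = k + 1 \<and> clique Q F \<or> card Q = m \<and> indep Q F)" by (rule exE)
  have "card V \<le> M" if "rigid_graph V E k" for V :: "'a set" and E
  proof (rule ccontr)
    assume big: "\<not> card V \<le> M"
    interpret rigid_graph V E k by fact
    obtain Q where Q: "Q \<subseteq> V"
      "card Q = k + 1 \<and> clique Q {{u, v} | u v. E u v} \<or> card Q = m \<and> indep Q {{u, v} | u v. E u v}"
      using M[rule_format, OF finite_V, of "{{u, v} | u v. E u v}"] big by auto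
    have edge: "{u, v} \<in> {{u, v} | u v. E u v} \<longleftrightarrow> E u v" for u v
      using sym by (auto simp: doubleton_eq_iff)
    have "\<not> (card Q = k + 1 \<and> clique Q {{u, v} | u v. E u v})"
      using clique_le[OF Q(1)] unfolding clique_on_def clique_def edge by force
    then have cardQ: "card Q = m" and "indep Q {{u, v} | u v. E u v}" using Q(2) by auto
    then have indep: "\<not> E u v" if "u \<in> Q" "v \<in> Q" for u v
      using that irrefl unfolding indep_def edge by metis
    have "finite Q" using Q(1) finite_V finite_subset by blast
    then obtain h where h: "bij_betw h {0..<m} Q"
      using ex_bij_betw_nat_finite[of Q] cardQ by auto
    have "separated_family (\<lambda>i. {h i}) m"
      unfolding separated_family_def
    proof (intro conjI allI impI ballI)
      fix i j x y assume *: "i < m" "j < m" "i \<noteq> j" "x \<in> {h i}" "y \<in> {h j}"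
      then have "x \<in> Q" "y \<in> Q" using bij_betwE[OF h] by simp_all
      then show "\<not> E x y" by (rule indep)
      have "inj_on h {0..<m}" using h by (simp add: bij_betw_def)
      then show "x \<noteq> y" using * by (auto dest: inj_onD)
    next
      fix i assume "i < m"
      then show "{h i} \<subseteq> V" "{h i} \<noteq> {}" using bij_betwE[OF h] Q(1) by auto
      show "conn_on E {h i}" by (auto simp: conn_on_def)
    qed
    moreover have "card (\<Union>i<m. K i) < Suc (card V)" if "separated_family K m" for K
      using that finite_V by (auto simp: separated_family_def less_Suc_eq_le intro!: card_mono)
    ultimately obtain K where "separated_family K m"
      "\<And>K'. separated_family K' m \<Longrightarrow> card (\<Union>i<m. K' i) \<le> card (\<Union>i<m. K i)"
      using Lattices_Big.ex_has_greatest_nat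
        [of "\<lambda>K. separated_family K m" _ "\<lambda>K. card (\<Union>i<m. K i)" "Suc (card V)"] by blast
    then interpret maximal_family V E k K m
      by unfold_locales (auto simp: m_def)
    have "card singleton_traces \<le> R" using card_singleton_traces_less[of R] R by simp
    from m_bound[OF this] show False by (simp add: m_def)
  qed
  then show ?thesis by blast
qed

section \<open>Reasoning about programs and their running time\<close>

text \<open>
Total correctness with a time bound. The bound need not be exact, so the two branches of a conditional can be
weakened to a common one.
\<close>
definition runs :: "com \<Rightarrow> state \<Rightarrow> nat \<Rightarrow> (state \<Rightarrow> bool) \<Rightarrow> bool" where
  "runs c s t Q \<longleftrightarrow> (\<exists>u s'. exec c s u s' \<and> u \<le> t \<and> Q s')"

lemma runs_weaken:
  "runs c s t Q \<Longrightarrow> t \<le> t' \<Longrightarrow> (\<And>s'. Q s' \<Longrightarrow> Q' s') \<Longrightarrow> runs c s t' Q'"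
  unfolding runs_def by (meson le_trans)

lemma runs_Skip: "Q s \<Longrightarrow> runs Skip s 1 Q"
  unfolding runs_def using exec.Skip by blast

lemma runs_Store:
  "Q (s(x := (s x)(aval a s := aval b s))) \<Longrightarrow> runs (Store x a b) s 1 Q"
  unfolding runs_def using exec.Store by blast

lemma runs_Seq:
  assumes "runs c s t Q" and "\<And>s'. Q s' \<Longrightarrow> runs d s' u R"
  shows "runs (Seq c d) s (t + u) R"
proof -
  obtain t' s' where 1: "exec c s t' s'" "t' \<le> t" "Q s'" using assms(1) by (auto simp: runs_def)
  obtain u' s'' where 2: "exec d s' u' s''" "u' \<le> u" "R s''"
    using assms(2)[OF 1(3)] by (auto simp: runs_def)
  have "exec (Seq c d) s (t' + u') s''" using exec.Seq[OF 1(1) 2(1)] .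
  then show ?thesis using 1 2 unfolding runs_def by (meson add_mono)
qed

lemma runs_Cond:
  assumes "bval b s \<Longrightarrow> runs c s t Q" and "\<not> bval b s \<Longrightarrow> runs d s t Q"
  shows "runs (Cond b c d) s (1 + t) Q"
proof (cases "bval b s")
  case True
  then obtain t' s' where "exec c s t' s'" "t' \<le> t" "Q s'" using assms(1) by (auto simp: runs_def)
  then show ?thesis unfolding runs_def by (meson True exec.CondTrue add_left_mono)
next
  case False
  then obtain t' s' where "exec d s t' s'" "t' \<le> t" "Q s'" using assms(2) by (auto simp: runs_def)
  then show ?thesis unfolding runs_def by (meson False exec.CondFalse add_left_mono)
qed

lemma runs_conditional_Store:
  assumes "Q (if bval b s then s(x := (s x)(aval a s := aval e s)) else s)"
  shows "runs (Cond b (Store x a e) Skip) s 2 Q"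
proof -
  have "runs (Cond b (Store x a e) Skip) s (1 + 1) Q"
    by (rule runs_Cond) (use assms in \<open>simp_all add: runs_Store runs_Skip del: One_nat_def\<close>)
  then show ?thesis by (simp add: numeral_2_eq_2)
qed

text \<open>
Arrays that are never assigned to keep their contents. Hence loop invariants only have to speak about
the arrays that the loop computes.
\<close>
fun writes :: "com \<Rightarrow> nat set" where
  "writes Skip = {}"
| "writes (Store x a b) = {x}"
| "writes (Seq c d) = writes c \<union> writes d"
| "writes (Cond b c d) = writes c \<union> writes d"
| "writes (While b c) = writes c"

definition agree :: "nat set \<Rightarrow> state \<Rightarrow> state \<Rightarrow> bool" where
  "agree X s s' \<longleftrightarrow> (\<forall>x. x \<notin> X \<longrightarrow> s' x = s x)"

lemma agreeD: "agree X s s' \<Longrightarrow> x \<notin> X \<Longrightarrow> s' x = s x"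
  by (simp add: agree_def)

lemma agree_mono: "agree X s s' \<Longrightarrow> X \<subseteq> Y \<Longrightarrow> agree Y s s'"
  by (auto simp: agree_def)

lemma agree_trans: "agree X s s' \<Longrightarrow> agree Y s' s'' \<Longrightarrow> X \<subseteq> Z \<Longrightarrow> Y \<subseteq> Z \<Longrightarrow> agree Z s s''"
  unfolding agree_def by (metis subsetD)

lemma exec_frame: "exec c s t s' \<Longrightarrow> agree (writes c) s s'"
  by (induction rule: exec.induct) (auto simp: agree_def)

lemma runs_frame: "runs c s t Q \<Longrightarrow> runs c s t (\<lambda>s'. Q s' \<and> agree (writes c) s s')"
  unfolding runs_def using exec_frame by blast

definition for_loop :: "nat \<Rightarrow> nat \<Rightarrow> aexp \<Rightarrow> com \<Rightarrow> com" where
  "for_loop x i b c = Seq (Store x (Num i) (Num 0))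
     (While (Less (Get x (Num i)) b) (Seq c (Store x (Num i) (Plus (Get x (Num i)) (Num 1)))))"

lemma writes_for_loop [simp]: "writes (for_loop x i b c) = insert x (writes c)"
  by (auto simp: for_loop_def)

lemma runs_while_counter:
  assumes step: "\<And>j s. j < n \<Longrightarrow> P j s \<Longrightarrow> s x i = j \<Longrightarrow>
      runs c s t (\<lambda>s'. s' x i = j \<and> P (Suc j) (s'(x := (s' x)(i := Suc j))))"
    and bound: "\<And>j s. P j s \<Longrightarrow> aval b s = n"
    and "P j s" "s x i = j" "j \<le> n"
  shows "runs (While (Less (Get x (Num i)) b) (Seq c (Store x (Num i) (Plus (Get x (Num i)) (Num 1)))))
    s ((n - j) * (t + 2) + 1) (P n)"
  using assms(3-5)
proof (induction "n - j" arbitrary: j s)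
  case 0
  then have "j = n" by simp
  have "\<not> bval (Less (Get x (Num i)) b) s"
    using bound[OF \<open>P j s\<close>] \<open>s x i = j\<close> \<open>j = n\<close> by simp
  from exec.WhileFalse[OF this] show ?case
    unfolding runs_def using \<open>j = n\<close> \<open>P j s\<close> by (intro exI conjI) auto
next
  case (Suc d)
  then have j: "j < n" by simp
  let ?w = "While (Less (Get x (Num i)) b) (Seq c (Store x (Num i) (Plus (Get x (Num i)) (Num 1))))"
  have "runs (Seq c (Store x (Num i) (Plus (Get x (Num i)) (Num 1)))) s (t + 1)
      (\<lambda>s'. s' x i = Suc j \<and> P (Suc j) s')"
  proof (rule runs_Seq[OF step[OF j \<open>P j s\<close> \<open>s x i = j\<close>]])
    fix s' assume "s' x i = j \<and> P (Suc j) (s'(x := (s' x)(i := Suc j)))"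
    then show "runs (Store x (Num i) (Plus (Get x (Num i)) (Num 1))) s' 1
        (\<lambda>s'. s' x i = Suc j \<and> P (Suc j) s')"
      by (intro runs_Store) simp
  qed
  then obtain u s' where 1: "exec (Seq c (Store x (Num i) (Plus (Get x (Num i)) (Num 1)))) s u s'"
    "u \<le> t + 1" "s' x i = Suc j" "P (Suc j) s'" by (auto simp: runs_def)
  have "runs ?w s' ((n - Suc j) * (t + 2) + 1) (P n)"
    by (rule Suc.hyps(1)) (use Suc 1 j in auto)
  then obtain v s'' where 2: "exec ?w s' v s''" "v \<le> (n - Suc j) * (t + 2) + 1" "P n s''"
    by (auto simp: runs_def)
  have "bval (Less (Get x (Num i)) b) s" using bound[OF \<open>P j s\<close>] \<open>s x i = j\<close> j by simp
  then have "exec ?w s (1 + u + v) s''" using exec.WhileTrue 1(1) 2(1) by blast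
  moreover have "n - j = Suc (n - Suc j)" using j by simp
  then have "1 + u + v \<le> (n - j) * (t + 2) + 1" using 1(2) 2(2) by simp
  ultimately show ?case using 2(3) unfolding runs_def by blast
qed

text \<open>
The counter is a single cell of the array \<open>x\<close>, since the nested loops of \<open>tuple_for\<close> keep their counters in
one array.
\<close>
lemma runs_for_loop:
  assumes "P 0 (s(x := (s x)(i := 0)))"
    and "\<And>j s. j < n \<Longrightarrow> P j s \<Longrightarrow> s x i = j \<Longrightarrow>
      runs c s t (\<lambda>s'. s' x i = j \<and> P (Suc j) (s'(x := (s' x)(i := Suc j))))"
    and "\<And>j s. P j s \<Longrightarrow> aval b s = n"
  shows "runs (for_loop x i b c) s (n * (t + 2) + 2) (P n)"
proof -
  let ?w = "While (Less (Get x (Num i)) b) (Seq c (Store x (Num i) (Plus (Get x (Num i)) (Num 1))))"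
  have "runs (for_loop x i b c) s (1 + ((n - 0) * (t + 2) + 1)) (P n)"
    unfolding for_loop_def
  proof (rule runs_Seq)
    show "runs (Store x (Num i) (Num 0)) s 1 (\<lambda>s'. P 0 s' \<and> s' x i = 0)"
      by (rule runs_Store) (use assms(1) in simp)
    show "runs ?w s' ((n - 0) * (t + 2) + 1) (P n)" if "P 0 s' \<and> s' x i = 0" for s'
      by (rule runs_while_counter[of n P x i c t b 0]) (use assms that in auto)
  qed
  then show ?thesis by simp
qed

lemma runs_for:
  assumes x: "x \<notin> writes c"
    and init: "P 0 s"
    and insens: "\<And>j s f. P j s \<Longrightarrow> P j (s(x := f))"
    and step: "\<And>j s'. j < n \<Longrightarrow> P j s' \<Longrightarrow> s' x 0 = j \<Longrightarrow> agree (insert x (writes c)) s s' \<Longrightarrow>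
      runs c s' t (P (Suc j))"
    and bound: "\<And>s'. agree (insert x (writes c)) s s' \<Longrightarrow> aval b s' = n"
  shows "runs (for_loop x 0 b c) s (n * (t + 2) + 2)
    (\<lambda>s'. P n s' \<and> agree (insert x (writes c)) s s')"
proof (rule runs_for_loop)
  let ?A = "agree (insert x (writes c))"
  show "P 0 (s(x := (s x)(0 := 0))) \<and> ?A s (s(x := (s x)(0 := 0)))"
    using init insens by (auto simp: agree_def)
  fix j s' assume P: "P j s' \<and> ?A s s'"
  then show "aval b s' = n" using bound by blast
  assume j: "j < n" "s' x 0 = j"
  show "runs c s' t (\<lambda>s''. s'' x 0 = j \<and>
      P (Suc j) (s''(x := (s'' x)(0 := Suc j))) \<and> ?A s (s''(x := (s'' x)(0 := Suc j))))"
    by (rule runs_weaken[OF runs_frame[OF step[of j s']]])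
      (use P j x insens in \<open>auto simp: agree_def\<close>)
qed

text \<open>
Universal quantification: the loop clears the flag \<open>y\<close> if some test fails.
\<close>
lemma runs_check_loop:
  assumes x: "x \<notin> writes c" "x \<noteq> y" and init: "s y 0 = of_bool b0"
    and step: "\<And>j s' b. j < n \<Longrightarrow> s' y 0 = of_bool b \<Longrightarrow> s' x 0 = j \<Longrightarrow>
      agree (insert x (writes c)) s s' \<Longrightarrow> runs c s' t (\<lambda>s''. s'' y 0 = of_bool (b \<and> Q j))"
    and bound: "\<And>s'. agree (insert x (writes c)) s s' \<Longrightarrow> aval e s' = n"
  shows "runs (for_loop x 0 e c) s (n * (t + 2) + 2)
    (\<lambda>s'. s' y 0 = of_bool (b0 \<and> (\<forall>j<n. Q j)) \<and> agree (insert x (writes c)) s s')"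
proof (rule runs_for[where P = "\<lambda>j s'. s' y 0 = of_bool (b0 \<and> (\<forall>i<j. Q i))"])
  fix j s'
  assume "j < n" "s' y 0 = of_bool (b0 \<and> (\<forall>i<j. Q i))" "s' x 0 = j"
    and "agree (insert x (writes c)) s s'"
  from step[OF this] show "runs c s' t (\<lambda>s''. s'' y 0 = of_bool (b0 \<and> (\<forall>i<Suc j. Q i)))"
  proof (rule runs_weaken[OF _ order_refl])
    fix s'' :: state
    assume "s'' y 0 = of_bool ((b0 \<and> (\<forall>i<j. Q i)) \<and> Q j)"
    moreover have "((b0 \<and> (\<forall>i<j. Q i)) \<and> Q j) = (b0 \<and> (\<forall>i<Suc j. Q i))"
      by (auto simp: less_Suc_eq)
    ultimately show "s'' y 0 = of_bool (b0 \<and> (\<forall>i<Suc j. Q i))" by simp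
  qed
qed (use x init bound in auto)

text \<open>
Nested loops, whose counters are the cells of array \<open>x\<close>. So this array holds the current tuple.
\<close>
fun tuple_for :: "nat \<Rightarrow> aexp \<Rightarrow> nat \<Rightarrow> com \<Rightarrow> com" where
  "tuple_for x b 0 c = c"
| "tuple_for x b (Suc d) c = for_loop x d b (tuple_for x b d c)"

lemma writes_tuple_for: "writes (tuple_for x b d c) \<subseteq> insert x (writes c)"
  by (induction d) auto

fun tuple_time :: "nat \<Rightarrow> nat \<Rightarrow> nat \<Rightarrow> nat" where
  "tuple_time n t 0 = t"
| "tuple_time n t (Suc d) = n * (tuple_time n t d + 2) + 2"

lemma runs_tuple_for_aux:
  assumes x: "x \<notin> writes c"
    and J_insens: "\<And>s f. J s \<Longrightarrow> J (s(x := f))"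
    and P_insens: "\<And>w s f. P w s \<Longrightarrow> P w (s(x := f))"
    and P_local: "\<And>w w' s. (\<forall>i<N. w i = w' i) \<Longrightarrow> P w s \<Longrightarrow> P w' s"
    and body: "\<And>s. J s \<Longrightarrow> (\<forall>i<N. s x i < n) \<Longrightarrow>
      runs c s t (\<lambda>s'. J s' \<and> P (s x) s' \<and> (\<forall>w. P w s \<longrightarrow> P w s'))"
    and bound: "\<And>s. J s \<Longrightarrow> aval b s = n"
  shows "d \<le> N \<Longrightarrow> J s \<Longrightarrow> (\<forall>i. d \<le> i \<longrightarrow> i < N \<longrightarrow> s x i < n) \<Longrightarrow>
    runs (tuple_for x b d c) s (tuple_time n t d)
      (\<lambda>s'. J s' \<and> (\<forall>i\<ge>d. s' x i = s x i) \<and> (\<forall>w. P w s \<longrightarrow> P w s') \<and>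
        (\<forall>w. (\<forall>i<d. w i < n) \<longrightarrow> (\<forall>i. d \<le> i \<longrightarrow> i < N \<longrightarrow> w i = s x i) \<longrightarrow> P w s'))"
proof (induction d arbitrary: s)
  case 0
  then have lt: "\<forall>i<N. s x i < n" by simp
  have "runs c s t (\<lambda>s'. (J s' \<and> P (s x) s' \<and> (\<forall>w. P w s \<longrightarrow> P w s')) \<and> agree (writes c) s s')"
    using runs_frame[OF body[OF 0(2) lt]] .
  then show ?case
    unfolding tuple_for.simps tuple_time.simps
  proof (rule runs_weaken)
    fix s'
    assume *: "(J s' \<and> P (s x) s' \<and> (\<forall>w. P w s \<longrightarrow> P w s')) \<and> agree (writes c) s s'"
    have "P w s'" if "\<forall>i<N. w i = s x i" for w
      using P_local[of "s x" w s'] * that by simp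
    then show "J s' \<and> (\<forall>i\<ge>0. s' x i = s x i) \<and> (\<forall>w. P w s \<longrightarrow> P w s') \<and>
        (\<forall>w. (\<forall>i<0. w i < n) \<longrightarrow> (\<forall>i. 0 \<le> i \<longrightarrow> i < N \<longrightarrow> w i = s x i) \<longrightarrow> P w s')"
      using * agreeD[of "writes c" s s' x] x by simp
  qed simp
next
  case (Suc d)
  define I where "I j s' \<longleftrightarrow> J s' \<and> (\<forall>i\<ge>Suc d. s' x i = s x i) \<and> (\<forall>w. P w s \<longrightarrow> P w s') \<and>
    (\<forall>w. (\<forall>i<d. w i < n) \<longrightarrow> w d < j \<longrightarrow> (\<forall>i. Suc d \<le> i \<longrightarrow> i < N \<longrightarrow> w i = s x i) \<longrightarrow> P w s')"
    for j s'
  have "runs (for_loop x d b (tuple_for x b d c)) s (n * (tuple_time n t d + 2) + 2) (I n)"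
  proof (rule runs_for_loop)
    show "I 0 (s(x := (s x)(d := 0)))"
      using Suc.prems J_insens P_insens by (auto simp: I_def)
    fix j s' assume I: "I j s'"
    then show "aval b s' = n" using bound by (auto simp: I_def)
    assume j: "j < n" "s' x d = j"
    have "runs (tuple_for x b d c) s' (tuple_time n t d)
      (\<lambda>s''. J s'' \<and> (\<forall>i\<ge>d. s'' x i = s' x i) \<and> (\<forall>w. P w s' \<longrightarrow> P w s'') \<and>
        (\<forall>w. (\<forall>i<d. w i < n) \<longrightarrow> (\<forall>i. d \<le> i \<longrightarrow> i < N \<longrightarrow> w i = s' x i) \<longrightarrow> P w s''))"
    proof (rule Suc.IH)
      show "d \<le> N" "J s'" using Suc.prems I by (auto simp: I_def)
      show "\<forall>i. d \<le> i \<longrightarrow> i < N \<longrightarrow> s' x i < n"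
      proof (intro allI impI)
        fix i assume "d \<le> i" "i < N"
        then show "s' x i < n"
          using I j Suc.prems(3) by (cases "i = d") (simp_all add: I_def)
      qed
    qed
    then show "runs (tuple_for x b d c) s' (tuple_time n t d)
        (\<lambda>s''. s'' x d = j \<and> I (Suc j) (s''(x := (s'' x)(d := Suc j))))"
    proof (rule runs_weaken[OF _ order_refl])
      fix s''
      assume *: "J s'' \<and> (\<forall>i\<ge>d. s'' x i = s' x i) \<and> (\<forall>w. P w s' \<longrightarrow> P w s'') \<and>
        (\<forall>w. (\<forall>i<d. w i < n) \<longrightarrow> (\<forall>i. d \<le> i \<longrightarrow> i < N \<longrightarrow> w i = s' x i) \<longrightarrow> P w s'')"
      have "P w s''" if w: "\<forall>i<d. w i < n" "w d < Suc j" "\<forall>i. Suc d \<le> i \<longrightarrow> i < N \<longrightarrow> w i = s x i" for w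
      proof (cases "w d < j")
        case True
        then show ?thesis using w I * by (auto simp: I_def)
      next
        case False
        then have "w d = s' x d" using w(2) j by simp
        then have "\<forall>i. d \<le> i \<longrightarrow> i < N \<longrightarrow> w i = s' x i"
          using w(3) I by (metis I_def Suc_leI le_neq_implies_less)
        then show ?thesis using * w(1) by blast
      qed
      then show "s'' x d = j \<and> I (Suc j) (s''(x := (s'' x)(d := Suc j)))"
        using * I j J_insens P_insens by (auto simp: I_def)
    qed
  qed
  then show ?case
    unfolding tuple_for.simps tuple_time.simps
  proof (rule runs_weaken[OF _ order_refl])
    fix s' assume "I n s'"
    then show "J s' \<and> (\<forall>i\<ge>Suc d. s' x i = s x i) \<and> (\<forall>w. P w s \<longrightarrow> P w s') \<and>
        (\<forall>w. (\<forall>i<Suc d. w i < n) \<longrightarrow> (\<forall>i. Suc d \<le> i \<longrightarrow> i < N \<longrightarrow> w i = s x i) \<longrightarrow> P w s')"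
      by (auto simp: I_def)
  qed
qed

text \<open>
\<open>P w s\<close> states what is known once the tuple \<open>w\<close> has been processed. It has to be stable under later runs of
the body, and to depend on the first \<open>N\<close> entries of \<open>w\<close> only.
\<close>
lemma runs_tuple_for:
  assumes "x \<notin> writes c"
    and "\<And>s f. J s \<Longrightarrow> J (s(x := f))"
    and "\<And>w s f. P w s \<Longrightarrow> P w (s(x := f))"
    and "\<And>w w' s. (\<forall>i<N. w i = w' i) \<Longrightarrow> P w s \<Longrightarrow> P w' s"
    and "\<And>s. J s \<Longrightarrow> (\<forall>i<N. s x i < n) \<Longrightarrow>
      runs c s t (\<lambda>s'. J s' \<and> P (s x) s' \<and> (\<forall>w. P w s \<longrightarrow> P w s'))"
    and "\<And>s. J s \<Longrightarrow> aval b s = n"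
    and "J s"
  shows "runs (tuple_for x b N c) s (tuple_time n t N)
    (\<lambda>s'. J s' \<and> (\<forall>w. (\<forall>i<N. w i < n) \<longrightarrow> P w s'))"
proof -
  have "runs (tuple_for x b N c) s (tuple_time n t N)
      (\<lambda>s'. J s' \<and> (\<forall>i\<ge>N. s' x i = s x i) \<and> (\<forall>w. P w s \<longrightarrow> P w s') \<and>
        (\<forall>w. (\<forall>i<N. w i < n) \<longrightarrow> (\<forall>i. N \<le> i \<longrightarrow> i < N \<longrightarrow> w i = s x i) \<longrightarrow> P w s'))"
    by (rule runs_tuple_for_aux[where N = N and J = J and P = P]) (fact assms | simp)+
  then show ?thesis by (rule runs_weaken) simp_all
qed

definition all_of :: "bexp list \<Rightarrow> bexp" where
  "all_of bs = foldr And bs (Eq (Num 0) (Num 0))"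

lemma bval_all_of [simp]: "bval (all_of bs) s \<longleftrightarrow> (\<forall>b\<in>set bs. bval b s)"
  by (induction bs) (auto simp: all_of_def)

definition Implies :: "bexp \<Rightarrow> bexp \<Rightarrow> bexp" where
  "Implies b c = Not (And b (Not c))"

lemma bval_Implies [simp]: "bval (Implies b c) s \<longleftrightarrow> (bval b s \<longrightarrow> bval c s)"
  by (simp add: Implies_def)

definition poly_bounded :: "(nat \<Rightarrow> nat) \<Rightarrow> bool" where
  "poly_bounded f \<longleftrightarrow> (\<exists>p :: nat poly. \<forall>n. f n \<le> poly p n)"

lemma poly_bounded_const [intro, simp]: "poly_bounded (\<lambda>n. a)"
  unfolding poly_bounded_def by (intro exI[of _ "[:a:]"]) simp

lemma poly_bounded_id [intro, simp]: "poly_bounded (\<lambda>n. n)"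
  unfolding poly_bounded_def by (intro exI[of _ "[:0, 1:]"]) simp

lemma poly_bounded_add [intro]:
  assumes "poly_bounded f" "poly_bounded g" shows "poly_bounded (\<lambda>n. f n + g n)"
proof -
  obtain p q where "\<forall>n. f n \<le> poly p n" "\<forall>n. g n \<le> poly q n"
    using assms by (auto simp: poly_bounded_def)
  then have "\<forall>n. f n + g n \<le> poly (p + q) n" by (simp add: add_mono)
  then show ?thesis unfolding poly_bounded_def by blast
qed

lemma poly_bounded_mult [intro]:
  assumes "poly_bounded f" "poly_bounded g" shows "poly_bounded (\<lambda>n. f n * g n)"
proof -
  obtain p q where "\<forall>n. f n \<le> poly p n" "\<forall>n. g n \<le> poly q n"
    using assms by (auto simp: poly_bounded_def)
  then have "\<forall>n. f n * g n \<le> poly (p * q) n" by (simp add: mult_mono)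
  then show ?thesis unfolding poly_bounded_def by blast
qed

lemma poly_bounded_tuple_time [intro]:
  assumes "poly_bounded b" "poly_bounded t" shows "poly_bounded (\<lambda>n. tuple_time (b n) (t n) d)"
proof (induction d)
  case 0
  then show ?case using assms(2) by simp
next
  case (Suc d)
  then show ?case
    unfolding tuple_time.simps by (intro poly_bounded_add poly_bounded_mult poly_bounded_const assms(1))
qed

section \<open>Retractions\<close>

definition proper_on :: "nat \<Rightarrow> ('a \<Rightarrow> 'a \<Rightarrow> bool) \<Rightarrow> 'a set \<Rightarrow> ('a \<Rightarrow> nat) \<Rightarrow> bool" where
  "proper_on k E X c \<longleftrightarrow> (\<forall>v\<in>X. c v < k) \<and> (\<forall>u\<in>X. \<forall>v\<in>X. E u v \<longrightarrow> c u \<noteq> c v)"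

definition colorable_on :: "nat \<Rightarrow> ('a \<Rightarrow> 'a \<Rightarrow> bool) \<Rightarrow> 'a set \<Rightarrow> bool" where
  "colorable_on k E X \<longleftrightarrow> (\<exists>c. proper_on k E X c)"

lemma colorable_on_subset: "colorable_on k E Y \<Longrightarrow> X \<subseteq> Y \<Longrightarrow> colorable_on k E X"
  unfolding colorable_on_def proper_on_def by blast

lemma free_graph_subset:
  assumes "free_graph V E" and X: "X \<subseteq> V"
  shows "free_graph X E"
proof -
  interpret free_graph V E by fact
  show ?thesis
  proof
    show "finite X" using X finite_V by (rule finite_subset)
    show "E v u" if "E u v" for u v using that by (rule sym)
    show "\<not> E v v" for v by (rule irrefl)
    show False
      if "a \<in> X" "b \<in> X" "c \<in> X" "d \<in> X" "e \<in> X" and adj: "E a b" "E b c" "E c d"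
        "\<not> E a c" "\<not> E a d" "\<not> E b d" "\<not> E a e" "\<not> E b e" "\<not> E c e" "\<not> E d e" for a b c d e
      by (rule co_gem_free[of a b c d e]) (use that(1-5) X in blast, use that(1-5) X in blast,
        use that(1-5) X in blast, use that(1-5) X in blast, use that(1-5) X in blast, fact+)
    show "E c a \<or> E c b"
      if "x \<in> X" "y \<in> X" "a \<in> X" "b \<in> X" "c \<in> X" and adj: "x \<noteq> y" "\<not> E x y"
        "E x a" "E y a" "E x b" "E y b" "E x c" "E y c" "E a b" for x y a b c
      by (rule paraglider_free[of x y a b c]) (use that(1-5) X in blast, use that(1-5) X in blast,
        use that(1-5) X in blast, use that(1-5) X in blast, use that(1-5) X in blast, fact+)
  qed
qed

text \<open>
A folded graph is represented by the map that sends each vertex to its image under the folds so far. The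
vertices of the folded graph are the fixed points of this map. Vertices outside of the subgraph \<open>X\<close> under
consideration are mapped to \<open>n\<close>, which is not a vertex.
\<close>
definition alive :: "nat \<Rightarrow> (nat \<Rightarrow> nat) \<Rightarrow> nat set" where
  "alive n r = {v. v < n \<and> r v = v}"

definition retraction :: "nat \<Rightarrow> (nat \<Rightarrow> nat \<Rightarrow> bool) \<Rightarrow> nat set \<Rightarrow> (nat \<Rightarrow> nat) \<Rightarrow> bool" where
  "retraction n E X r \<longleftrightarrow> X \<subseteq> {..<n} \<and> (\<forall>v<n. v \<notin> X \<longrightarrow> r v = n) \<and>
     (\<forall>v\<in>X. r v \<in> X \<and> r (r v) = r v) \<and> (\<forall>u\<in>X. \<forall>v\<in>X. E u v \<longrightarrow> E (r u) (r v))"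

lemma alive_subset: "retraction n E X r \<Longrightarrow> alive n r \<subseteq> X"
  by (fastforce simp: retraction_def alive_def)

lemma finite_alive: "finite (alive n r)"
  by (simp add: alive_def)

lemma alive_cong: "(\<And>v. v < n \<Longrightarrow> r v = r' v) \<Longrightarrow> alive n r = alive n r'"
  by (auto simp: alive_def)

lemma retraction_cong:
  assumes "retraction n E X r" "\<And>v. v < n \<Longrightarrow> r' v = r v"
  shows "retraction n E X r'"
proof -
  have "r' v = r v" if "v \<in> X" for v using that assms by (auto simp: retraction_def)
  then show ?thesis using assms by (auto simp: retraction_def)
qed

text \<open>
The effect of replacing \<open>a 0\<close> by \<open>b 0\<close>, then \<open>a 1\<close> by \<open>b 1\<close>, and so on. If no \<open>b i\<close> is among the \<open>a j\<close>,
an entry is changed at most once.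
\<close>
fun redirect :: "(nat \<Rightarrow> 'a) \<Rightarrow> (nat \<Rightarrow> 'a) \<Rightarrow> nat \<Rightarrow> 'a \<Rightarrow> 'a" where
  "redirect a b 0 y = y"
| "redirect a b (Suc l) y = (if redirect a b l y = a l then b l else redirect a b l y)"

lemma redirect_cases:
  assumes "\<And>i j. i < N \<Longrightarrow> j < N \<Longrightarrow> b i \<noteq> a j" "l \<le> N"
  shows "(redirect a b l y = y \<and> (\<forall>i<l. y \<noteq> a i)) \<or> (\<exists>i<l. y = a i \<and> redirect a b l y = b i)"
  using assms(2)
proof (induction l)
  case (Suc l)
  then have "(redirect a b l y = y \<and> (\<forall>i<l. y \<noteq> a i)) \<or> (\<exists>i<l. y = a i \<and> redirect a b l y = b i)"
    by simp
  then show ?case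
  proof (elim disjE exE conjE)
    assume "redirect a b l y = y" "\<forall>i<l. y \<noteq> a i"
    then show ?thesis by (cases "y = a l") (auto simp: less_Suc_eq)
  next
    fix i assume i: "i < l" "y = a i" "redirect a b l y = b i"
    then have "redirect a b (Suc l) y = b i" using assms(1)[of i l] Suc.prems by simp
    then show ?thesis using i less_Suc_eq by blast
  qed
qed simp

text \<open>
The first \<open>N\<close> entries of \<open>t\<close> are the vertices to be moved, the next \<open>N\<close> entries are their images. Repeated
entries make folds of fewer than \<open>N\<close> vertices possible.
\<close>
definition is_fold :: "nat \<Rightarrow> (nat \<Rightarrow> nat \<Rightarrow> bool) \<Rightarrow> nat \<Rightarrow> (nat \<Rightarrow> nat) \<Rightarrow> (nat \<Rightarrow> nat) \<Rightarrow> bool" where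
  "is_fold n E N r t \<longleftrightarrow>
     ((\<forall>i<2 * N. r (t i) = t i) \<and>
      (\<forall>i<N. \<forall>j<N. t (N + i) \<noteq> t j \<and> (E (t i) (t j) \<longrightarrow> E (t (N + i)) (t (N + j))))) \<and>
     (\<forall>w<n. r w = w \<longrightarrow> (\<forall>j<N. w \<noteq> t j) \<longrightarrow> (\<forall>i<N. E (t i) w \<longrightarrow> E (t (N + i)) w))"

definition fold_free :: "nat \<Rightarrow> (nat \<Rightarrow> nat \<Rightarrow> bool) \<Rightarrow> nat \<Rightarrow> (nat \<Rightarrow> nat) \<Rightarrow> bool" where
  "fold_free n E N r \<longleftrightarrow> (\<forall>t. (\<forall>i<2 * N. t i < n) \<longrightarrow> \<not> is_fold n E N r t)"

lemma is_fold_cong: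
  assumes "\<And>v. v < n \<Longrightarrow> r v = r' v" "\<forall>i<2 * N. t i < n"
  shows "is_fold n E N r t \<longleftrightarrow> is_fold n E N r' t"
  using assms unfolding is_fold_def by simp

lemma is_fold_local:
  assumes "\<forall>i<2 * N. t i = t' i"
  shows "is_fold n E N r t \<longleftrightarrow> is_fold n E N r t'"
proof -
  have "t i = t' i" "t (N + i) = t' (N + i)" if "i < N" for i using assms that by simp_all
  then show ?thesis using assms unfolding is_fold_def by simp
qed

lemma fold_free_cong:
  assumes "\<And>v. v < n \<Longrightarrow> r v = r' v"
  shows "fold_free n E N r \<longleftrightarrow> fold_free n E N r'"
proof -
  have "is_fold n E N r t \<longleftrightarrow> is_fold n E N r' t" if "\<forall>i<2 * N. t i < n" for t
    by (rule is_fold_cong) (fact assms that)+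
  then show ?thesis by (simp add: fold_free_def cong: imp_cong)
qed

lemma retraction_fold:
  assumes r: "retraction n E X r" and sym: "\<And>u v. E u v \<Longrightarrow> E v u" and N: "N \<ge> 1"
    and t: "\<forall>i<2 * N. t i < n" and fold: "is_fold n E N r t"
    and r': "\<And>v. v < n \<Longrightarrow> r' v = redirect t (\<lambda>i. t (N + i)) N (r v)"
  shows "retraction n E X r'" "alive n r' \<subset> alive n r"
proof -
  let ?b = "\<lambda>i. t (N + i)"
  let ?\<phi> = "redirect t ?b N"
  have X: "X \<subseteq> {..<n}" using r by (simp add: retraction_def)
  have ne: "?b i \<noteq> t j" if "i < N" "j < N" for i j
    using fold that by (simp add: is_fold_def)
  have \<phi>: "(?\<phi> y = y \<and> (\<forall>i<N. y \<noteq> t i)) \<or> (\<exists>i<N. y = t i \<and> ?\<phi> y = ?b i)" for y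
    by (rule redirect_cases[OF ne order_refl])
  have fix_t: "r (t i) = t i" "t i < n" if "i < 2 * N" for i
    using fold t that by (simp_all add: is_fold_def)
  have t_alive: "t i \<in> alive n r" if "i < 2 * N" for i
    using fix_t[OF that] by (simp add: alive_def)
  then have tX: "t i \<in> X" if "i < 2 * N" for i
    using alive_subset[OF r] that by blast
  have alive_r: "r v \<in> alive n r" "r v \<in> X" "r v < n" if "v \<in> X" for v
    using r X that by (auto simp: retraction_def alive_def)
  have \<phi>_alive: "?\<phi> y \<in> alive n r \<and> (\<forall>i<N. ?\<phi> y \<noteq> t i)" if "y \<in> alive n r" for y
    using \<phi>[of y]
  proof (elim disjE exE conjE)
    fix i assume i: "i < N" "y = t i" "?\<phi> y = ?b i"
    have "?b i \<in> alive n r" using i by (intro t_alive) simp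
    then show ?thesis using i(3) ne[OF i(1)] by metis
  qed (use that in simp)
  have \<phi>_id: "?\<phi> (?\<phi> y) = ?\<phi> y" if "y \<in> alive n r" for y
    using \<phi>[of "?\<phi> y"] \<phi>_alive[OF that] by auto
  have hom: "E (?\<phi> p) (?\<phi> q)" if pq: "p \<in> alive n r" "q \<in> alive n r" "E p q" for p q
  proof -
    have out: "E (?b i) w" if "i < N" "w \<in> alive n r" "\<forall>j<N. w \<noteq> t j" "E (t i) w" for i w
      using fold that by (simp add: is_fold_def alive_def)
    have inside: "E (?b i) (?b j)" if "i < N" "j < N" "E (t i) (t j)" for i j
      using fold that by (simp add: is_fold_def)
    from \<phi>[of p] \<phi>[of q] show ?thesis
    proof (elim disjE exE conjE)
      assume "?\<phi> p = p" "?\<phi> q = q"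
      then show ?thesis using pq by simp
    next
      fix i assume "?\<phi> p = p" "\<forall>j<N. p \<noteq> t j" "i < N" "q = t i" "?\<phi> q = ?b i"
      then show ?thesis using out[of i p] pq sym by metis
    next
      fix i assume "?\<phi> q = q" "\<forall>j<N. q \<noteq> t j" "i < N" "p = t i" "?\<phi> p = ?b i"
      then show ?thesis using out[of i q] pq by metis
    next
      fix i j assume "i < N" "p = t i" "?\<phi> p = ?b i" "j < N" "q = t j" "?\<phi> q = ?b j"
      then show ?thesis using inside[of i j] pq by metis
    qed
  qed
  have alive_X: "alive n r \<subseteq> X" by (rule alive_subset[OF r])
  have r'_X: "r' v = ?\<phi> (r v)" if "v \<in> X" for v using r' X that by auto
  have rid: "r y = y" if "y \<in> alive n r" for y using that by (simp add: alive_def)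
  show "retraction n E X r'"
    unfolding retraction_def
  proof (intro conjI X ballI allI impI)
    fix v assume "v < n" "v \<notin> X"
    then have "r v = n" using r by (simp add: retraction_def)
    moreover have "n \<noteq> t i" if "i < N" for i using fix_t[of i] that by simp
    ultimately have "?\<phi> (r v) = n" using \<phi>[of n] by auto
    then show "r' v = n" using r' \<open>v < n\<close> by simp
  next
    fix v assume v: "v \<in> X"
    have *: "?\<phi> (r v) \<in> alive n r" using \<phi>_alive alive_r v by blast
    then show "r' v \<in> X" using r'_X[OF v] alive_X by auto
    show "r' (r' v) = r' v"
      using r'_X[OF v] r'_X[of "?\<phi> (r v)"] * alive_X rid[OF *] \<phi>_id alive_r v by auto
  next
    fix u v assume "u \<in> X" "v \<in> X" "E u v"
    then show "E (r' u) (r' v)"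
      using hom[of "r u" "r v"] r'_X alive_r r by (simp add: retraction_def)
  qed
  have "alive n r' \<subseteq> alive n r"
  proof
    fix v assume v: "v \<in> alive n r'"
    have "v \<in> X"
    proof (rule ccontr)
      assume "v \<notin> X"
      then have "r v = n" using v r by (simp add: retraction_def alive_def)
      moreover have "n \<noteq> t i" if "i < N" for i using fix_t[of i] that by simp
      ultimately show False using v r' \<phi>[of n] by (auto simp: alive_def)
    qed
    then have "?\<phi> (r v) \<in> alive n r" using \<phi>_alive alive_r by blast
    moreover have "?\<phi> (r v) = v" using v r'[of v] by (simp add: alive_def)
    ultimately show "v \<in> alive n r" by simp
  qed
  moreover have "t 0 \<in> alive n r" using t_alive[of 0] N by simp
  moreover have "t 0 \<notin> alive n r'"
  proof
    assume "t 0 \<in> alive n r'"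
    then have "?\<phi> (r (t 0)) = t 0" using r'[of "t 0"] by (simp add: alive_def)
    moreover have "?\<phi> (r (t 0)) \<noteq> t 0"
      using \<phi>_alive[of "r (t 0)"] fix_t[of 0] t_alive[of 0] N by simp
    ultimately show False by simp
  qed
  ultimately show "alive n r' \<subset> alive n r" by blast
qed

lemma fold_free_no_fold:
  assumes free: "fold_free n E N r" and fold: "fold_on (alive n r) E A f"
  shows "card A > N"
proof (rule ccontr)
  assume "\<not> card A > N"
  have A: "A \<subseteq> alive n r" "A \<noteq> {}" using fold by (auto simp: fold_on_def)
  then have finA: "finite A" using finite_alive finite_subset by blast
  obtain h where h: "bij_betw h {0..<card A} A" using ex_bij_betw_nat_finite[OF finA] by blast
  have pos: "0 < card A" using finA A(2) by (simp add: card_gt_0_iff)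
  \<comment> \<open>The tuple is padded with its first entry if \<open>A\<close> has fewer than \<open>N\<close> elements.\<close>
  define a where "a i = (if i < card A then h i else h 0)" for i
  have aA: "a i \<in> A" for i
    using bij_betwE[OF h] pos by (auto simp: a_def)
  have surj: "\<exists>i<N. x = a i" if "x \<in> A" for x
  proof -
    have "x \<in> h ` {0..<card A}" using h \<open>x \<in> A\<close> by (simp add: bij_betw_def)
    then obtain i where "i < card A" "x = h i" by auto
    then show ?thesis using \<open>\<not> card A > N\<close> by (intro exI[of _ i]) (auto simp: a_def)
  qed
  have fA: "f x \<in> alive n r" "f x \<notin> A" if "x \<in> A" for x
    using fold that by (auto simp: fold_on_def)
  have fE: "E (f x) (if w \<in> A then f w else w)" if "x \<in> A" "w \<in> alive n r" "E x w" for x w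
    using fold that unfolding fold_on_def by blast
  define t where "t i = (if i < N then a i else f (a (i - N)))" for i
  have t_alive: "t i \<in> alive n r" for i using aA fA A by (auto simp: t_def)
  have t1: "t i = a i" if "i < N" for i using that by (simp add: t_def)
  have t2: "t (N + i) = f (a i)" for i by (simp add: t_def)
  have "is_fold n E N r t"
    unfolding is_fold_def
  proof (intro conjI allI impI)
    fix i show "r (t i) = t i" using t_alive[of i] by (simp add: alive_def)
  next
    fix i j assume ij: "i < N" "j < N"
    show "t (N + i) \<noteq> t j" using fA(2)[OF aA[of i]] aA[of j] ij by (auto simp: t1 t2)
    assume "E (t i) (t j)"
    then show "E (t (N + i)) (t (N + j))"
      using fE[of "a i" "a j"] aA A ij by (auto simp: t1 t2)
  next
    fix w i assume w: "w < n" "r w = w" "\<forall>j<N. w \<noteq> t j" and i: "i < N" "E (t i) w"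
    have "w \<notin> A" using surj w(3) t1 by metis
    then show "E (t (N + i)) w"
      using fE[of "a i" w] aA w i by (simp add: t1 t2 alive_def)
  qed
  moreover have "\<forall>i<2 * N. t i < n" using t_alive by (simp add: alive_def)
  ultimately show False using free by (simp add: fold_free_def)
qed

text \<open>
A clique of the folded graph is a clique of the \<open>k\<close>-colorable graph \<open>X\<close>, so it has at most \<open>k\<close> vertices.
\<close>
lemma rigid_alive:
  assumes G: "free_graph {..<n} E" and r: "retraction n E X r" and free: "fold_free n E (k + 1) r"
    and col: "colorable_on k E X" and k: "k \<ge> 1"
  shows "rigid_graph (alive n r) E k"
proof (intro rigid_graph.intro rigid_graph_axioms.intro)
  show "free_graph (alive n r) E"
    by (rule free_graph_subset[OF G]) (auto simp: alive_def)
  show "1 \<le> k" by (rule k)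
  show "card A > k + 1" if "fold_on (alive n r) E A f" for A f
    by (rule fold_free_no_fold[OF free that])
  fix C assume C: "C \<subseteq> alive n r" "clique_on E C"
  obtain c where c: "proper_on k E X c" using col by (auto simp: colorable_on_def)
  have CX: "C \<subseteq> X" using C(1) alive_subset[OF r] by blast
  have "inj_on c C"
    using c CX C(2) unfolding inj_on_def proper_on_def clique_on_def by (metis subsetD)
  moreover have "c ` C \<subseteq> {..<k}" using c CX by (auto simp: proper_on_def)
  ultimately show "card C \<le> k" using card_inj_on_le[of c C "{..<k}"] by simp
qed

section \<open>Folding a graph until no fold is left\<close>

text \<open>
The programs use the arrays as follows.

  \<^item> 0 to 4: the number of vertices, the adjacency matrix, the tag of the certificate, its coloring or
    vertex set, and the verdict of the verifier; array 3 also holds the subgraph whose colorability is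
    being decided;
  \<^item> 5: the offsets of the rows of the adjacency matrix, which replace a multiplication;
  \<^item> 6: the retraction;
  \<^item> 7 and 8: the current tuple of vertices, and the current tuple of colors;
  \<^item> 9 and 10: the position of each vertex in the enumeration of the fixed points of the retraction, and the
    number of fixed points found so far;
  \<^item> 11: a flag for the outcome of a test;
  \<^item> 12 and 13: whether a coloring has been found, and the coloring;
  \<^item> 14 to 18: loop counters.
\<close>
definition graph_input :: "nat \<Rightarrow> (nat \<Rightarrow> nat \<Rightarrow> bool) \<Rightarrow> state \<Rightarrow> bool" where
  "graph_input n E s \<longleftrightarrow> s 0 0 = n \<and> (\<forall>u<n. \<forall>v<n. 0 < s 1 (u * n + v) \<longleftrightarrow> E u v) \<and>
     (\<forall>u<n. s 5 u = u * n)"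

lemma graph_input_agree:
  "graph_input n E s \<Longrightarrow> agree X s s' \<Longrightarrow> 0 \<notin> X \<Longrightarrow> 1 \<notin> X \<Longrightarrow> 5 \<notin> X \<Longrightarrow> graph_input n E s'"
  unfolding graph_input_def agree_def by metis

lemma graph_input_update:
  "graph_input n E s \<Longrightarrow> x \<noteq> 0 \<Longrightarrow> x \<noteq> 1 \<Longrightarrow> x \<noteq> 5 \<Longrightarrow> graph_input n E (s(x := f))"
  by (simp add: graph_input_def)

definition scalar :: "nat \<Rightarrow> aexp" where "scalar x = Get x (Num 0)"

lemma aval_scalar [simp]: "aval (scalar x) s = s x 0"
  by (simp add: scalar_def)

definition adj_test :: "aexp \<Rightarrow> aexp \<Rightarrow> bexp" where
  "adj_test a b = Less (Num 0) (Get 1 (Plus (Get 5 a) b))"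

lemma bval_adj_test:
  "graph_input n E s \<Longrightarrow> aval a s < n \<Longrightarrow> aval b s < n \<Longrightarrow>
    bval (adj_test a b) s \<longleftrightarrow> E (aval a s) (aval b s)"
  by (simp add: adj_test_def graph_input_def)

abbreviation "tuple_entry i \<equiv> Get 7 (Num i)"

definition fold_pairs_test :: "nat \<Rightarrow> bexp" where
  "fold_pairs_test N = And
     (all_of (map (\<lambda>i. Eq (Get 6 (tuple_entry i)) (tuple_entry i)) [0..<2 * N]))
     (all_of (map (\<lambda>(i, j). And (Not (Eq (tuple_entry (N + i)) (tuple_entry j)))
        (Implies (adj_test (tuple_entry i) (tuple_entry j))
          (adj_test (tuple_entry (N + i)) (tuple_entry (N + j)))))
        (List.product [0..<N] [0..<N])))"

definition fold_vertex_test :: "nat \<Rightarrow> bexp" where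
  "fold_vertex_test N = Implies
     (And (Eq (Get 6 (scalar 16)) (scalar 16))
       (all_of (map (\<lambda>j. Not (Eq (scalar 16) (tuple_entry j))) [0..<N])))
     (all_of (map (\<lambda>i. Implies (adj_test (tuple_entry i) (scalar 16))
       (adj_test (tuple_entry (N + i)) (scalar 16))) [0..<N]))"

fun redirect_entry :: "nat \<Rightarrow> nat \<Rightarrow> com" where
  "redirect_entry N 0 = Skip"
| "redirect_entry N (Suc l) = Seq (redirect_entry N l)
     (Cond (Eq (Get 6 (scalar 15)) (tuple_entry l))
       (Store 6 (scalar 15) (tuple_entry (N + l))) Skip)"

definition try_fold :: "nat \<Rightarrow> com" where
  "try_fold N = Seq (Store 11 (Num 0) (Num 1))
    (Seq (Cond (Not (fold_pairs_test N)) (Store 11 (Num 0) (Num 0)) Skip)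
    (Seq (for_loop 16 0 (scalar 0)
            (Cond (Not (fold_vertex_test N)) (Store 11 (Num 0) (Num 0)) Skip))
      (Cond (Eq (scalar 11) (Num 1)) (for_loop 15 0 (scalar 0) (redirect_entry N N)) Skip)))"

definition try_fold_time :: "nat \<Rightarrow> nat \<Rightarrow> nat" where
  "try_fold_time N n = 1 + (2 + ((n * (2 + 2) + 2) + (1 + (n * ((1 + 2 * N) + 2) + 2))))"

lemma runs_redirect_entry:
  "runs (redirect_entry N l) s (1 + 2 * l)
    (\<lambda>s'. s' = s(6 := (s 6)(s 15 0 := redirect (s 7) (\<lambda>i. s 7 (N + i)) l (s 6 (s 15 0)))))"
proof (induction l)
  case 0
  show ?case using runs_Skip[of _ s] by simp
next
  case (Suc l)
  have "runs (redirect_entry N (Suc l)) s ((1 + 2 * l) + 2)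
    (\<lambda>s'. s' = s(6 := (s 6)(s 15 0 := redirect (s 7) (\<lambda>i. s 7 (N + i)) (Suc l) (s 6 (s 15 0)))))"
    unfolding redirect_entry.simps
    by (rule runs_Seq[OF Suc.IH]) (rule runs_conditional_Store, intro ext, simp)
  then show ?case by (rule runs_weaken) (simp, assumption)
qed

lemma writes_redirect_entry: "writes (redirect_entry N l) \<subseteq> {6}"
  by (induction l) auto

lemma bval_fold_pairs_test:
  assumes "graph_input n E s" "\<forall>i<2 * N. s 7 i < n"
  shows "bval (fold_pairs_test N) s \<longleftrightarrow> (\<forall>i<2 * N. s 6 (s 7 i) = s 7 i) \<and>
      (\<forall>i<N. \<forall>j<N. s 7 (N + i) \<noteq> s 7 j \<and> (E (s 7 i) (s 7 j) \<longrightarrow> E (s 7 (N + i)) (s 7 (N + j))))"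
proof -
  have lt: "s 7 i < n" "s 7 (N + i) < n" if "i < N" for i using assms(2) that by simp_all
  have *: "bval (And (Not (Eq (tuple_entry (N + i)) (tuple_entry j)))
        (Implies (adj_test (tuple_entry i) (tuple_entry j))
          (adj_test (tuple_entry (N + i)) (tuple_entry (N + j))))) s \<longleftrightarrow>
      s 7 (N + i) \<noteq> s 7 j \<and> (E (s 7 i) (s 7 j) \<longrightarrow> E (s 7 (N + i)) (s 7 (N + j)))"
    if "i < N" "j < N" for i j
    using that lt by (simp add: bval_adj_test[OF assms(1)])
  show ?thesis
    unfolding fold_pairs_test_def bval.simps(4) bval_all_of using * by auto
qed

lemma bval_fold_vertex_test:
  assumes "graph_input n E s" "\<forall>i<2 * N. s 7 i < n" "s 16 0 < n"
  shows "bval (fold_vertex_test N) s \<longleftrightarrow> (s 6 (s 16 0) = s 16 0 \<longrightarrow> (\<forall>j<N. s 16 0 \<noteq> s 7 j) \<longrightarrow>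
      (\<forall>i<N. E (s 7 i) (s 16 0) \<longrightarrow> E (s 7 (N + i)) (s 16 0)))"
proof -
  have lt: "s 7 i < n" "s 7 (N + i) < n" if "i < N" for i using assms(2) that by simp_all
  have *: "bval (Implies (adj_test (tuple_entry i) (scalar 16))
       (adj_test (tuple_entry (N + i)) (scalar 16))) s \<longleftrightarrow>
      (E (s 7 i) (s 16 0) \<longrightarrow> E (s 7 (N + i)) (s 16 0))" if "i < N" for i
    using that lt assms(3) by (simp add: bval_adj_test[OF assms(1)])
  show ?thesis
    unfolding fold_vertex_test_def bval_Implies[of "And _ _"] bval.simps(4) bval_all_of using * by auto
qed

lemma runs_try_fold:
  assumes G: "graph_input n E s" and t: "\<forall>i<2 * N. s 7 i < n"
  shows "runs (try_fold N) s (try_fold_time N n) (\<lambda>s'. \<forall>v<n. s' 6 v =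
    (if is_fold n E N (s 6) (s 7) then redirect (s 7) (\<lambda>i. s 7 (N + i)) N (s 6 v) else s 6 v))"
proof -
  let ?r = "s 6" and ?t = "s 7"
  define pairs where "pairs \<longleftrightarrow> (\<forall>i<2 * N. ?r (?t i) = ?t i) \<and>
    (\<forall>i<N. \<forall>j<N. ?t (N + i) \<noteq> ?t j \<and> (E (?t i) (?t j) \<longrightarrow> E (?t (N + i)) (?t (N + j))))"
  define vertex where "vertex w \<longleftrightarrow> (?r w = w \<longrightarrow> (\<forall>j<N. w \<noteq> ?t j) \<longrightarrow>
    (\<forall>i<N. E (?t i) w \<longrightarrow> E (?t (N + i)) w))" for w
  have fold: "is_fold n E N ?r ?t \<longleftrightarrow> pairs \<and> (\<forall>w<n. vertex w)"
    unfolding is_fold_def pairs_def vertex_def by blast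
  have n: "s 0 0 = n" using G by (simp add: graph_input_def)
  have input: "graph_input n E s'" "s' 6 = ?r" "s' 7 = ?t" if "agree {11, 16} s s'" for s'
    using graph_input_agree[OF G that] that by (auto simp: agree_def)
  show ?thesis
    unfolding try_fold_def try_fold_time_def
  proof (intro runs_Seq)
    show "runs (Store 11 (Num 0) (Num 1)) s 1 (\<lambda>s'. agree {11} s s' \<and> s' 11 0 = 1)"
      by (rule runs_Store) (simp add: agree_def)
  next
    fix s1 assume s1: "agree {11} s s1 \<and> s1 11 0 = 1"
    then have a: "agree {11, 16} s s1" by (auto simp: agree_def)
    have "bval (fold_pairs_test N) s1 \<longleftrightarrow> pairs"
      using bval_fold_pairs_test[OF input(1)[OF a], of N] t input(2,3)[OF a]
      by (simp add: pairs_def)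
    then show "runs (Cond (Not (fold_pairs_test N)) (Store 11 (Num 0) (Num 0)) Skip) s1 2
        (\<lambda>s'. agree {11} s s' \<and> s' 11 0 = of_bool pairs)"
      by (intro runs_conditional_Store) (use s1 in \<open>auto simp: agree_def\<close>)
  next
    fix s1 assume s1: "agree {11} s s1 \<and> s1 11 0 = of_bool pairs"
    let ?c = "Cond (Not (fold_vertex_test N)) (Store 11 (Num 0) (Num 0)) Skip"
    have "runs (for_loop 16 0 (scalar 0) ?c) s1 (n * (2 + 2) + 2)
      (\<lambda>s'. s' 11 0 = of_bool (pairs \<and> (\<forall>w<n. vertex w)) \<and> agree (insert 16 (writes ?c)) s1 s')"
    proof (rule runs_check_loop)
      fix j s' b
      assume j: "j < n" and b: "s' 11 0 = of_bool b" "s' 16 0 = j"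
        and ag: "agree (insert 16 (writes ?c)) s1 s'"
      have a: "agree {11, 16} s s'" using s1 ag by (auto simp: agree_def)
      have "bval (fold_vertex_test N) s' \<longleftrightarrow> vertex j"
        using bval_fold_vertex_test[OF input(1)[OF a], of N] t input(2,3)[OF a] b(2) j
        by (simp add: vertex_def)
      then show "runs ?c s' 2 (\<lambda>s'. s' 11 0 = of_bool (b \<and> vertex j))"
        by (intro runs_conditional_Store) (use b in auto)
    next
      fix s' assume "agree (insert 16 (writes ?c)) s1 s'"
      then show "aval (scalar 0) s' = n" using s1 n by (auto simp: agree_def)
    qed (use s1 in auto)
    then show "runs (for_loop 16 0 (scalar 0) ?c) s1 (n * (2 + 2) + 2)
      (\<lambda>s'. agree {11, 16} s s' \<and> s' 11 0 = of_bool (is_fold n E N ?r ?t))"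
      by (rule runs_weaken) (use s1 in \<open>auto simp: agree_def fold\<close>)
  next
    fix s1 assume s1: "agree {11, 16} s s1 \<and> s1 11 0 = of_bool (is_fold n E N ?r ?t)"
    then have eq: "s1 6 = ?r" "s1 7 = ?t" "s1 0 0 = n" using n by (auto simp: agree_def)
    let ?new = "\<lambda>v. redirect ?t (\<lambda>i. ?t (N + i)) N (?r v)"
    show "runs (Cond (Eq (scalar 11) (Num 1)) (for_loop 15 0 (scalar 0) (redirect_entry N N)) Skip)
      s1 (1 + (n * ((1 + 2 * N) + 2) + 2))
      (\<lambda>s'. \<forall>v<n. s' 6 v = (if is_fold n E N ?r ?t then ?new v else ?r v))"
    proof (rule runs_Cond)
      assume "bval (Eq (scalar 11) (Num 1)) s1"
      then have yes: "is_fold n E N ?r ?t" using s1 by (cases "is_fold n E N ?r ?t") simp_all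
      have notin: "15 \<notin> writes (redirect_entry N N)" "0 \<notin> insert 15 (writes (redirect_entry N N))"
        "7 \<notin> insert 15 (writes (redirect_entry N N))"
        using writes_redirect_entry[of N N] by auto
      have "runs (for_loop 15 0 (scalar 0) (redirect_entry N N)) s1 (n * ((1 + 2 * N) + 2) + 2)
        (\<lambda>s'. (\<forall>v<n. s' 6 v = (if v < n then ?new v else ?r v)) \<and>
          agree (insert 15 (writes (redirect_entry N N))) s1 s')"
      proof (rule runs_for[where P = "\<lambda>j s'. \<forall>v<n. s' 6 v = (if v < j then ?new v else ?r v)"])
        fix j s'
        assume j: "j < n" and P: "\<forall>v<n. s' 6 v = (if v < j then ?new v else ?r v)" "s' 15 0 = j"
          and ag: "agree (insert 15 (writes (redirect_entry N N))) s1 s'"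
        have "s' 7 = ?t" using agreeD[OF ag notin(3)] eq by simp
        then show "runs (redirect_entry N N) s' (1 + 2 * N)
            (\<lambda>s'. \<forall>v<n. s' 6 v = (if v < Suc j then ?new v else ?r v))"
          by (intro runs_weaken[OF runs_redirect_entry]) (use P j in \<open>auto simp: less_Suc_eq\<close>)
      next
        fix s' assume "agree (insert 15 (writes (redirect_entry N N))) s1 s'"
        from agreeD[OF this notin(2)] show "aval (scalar 0) s' = n" using eq by simp
      qed (use notin eq in auto)
      then show "runs (for_loop 15 0 (scalar 0) (redirect_entry N N)) s1 (n * ((1 + 2 * N) + 2) + 2)
          (\<lambda>s'. \<forall>v<n. s' 6 v = (if is_fold n E N ?r ?t then ?new v else ?r v))"
        by (rule runs_weaken) (use yes in auto)
    next
      assume "\<not> bval (Eq (scalar 11) (Num 1)) s1"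
      then have "\<not> is_fold n E N ?r ?t" using s1 by (cases "is_fold n E N ?r ?t") simp_all
      then have "runs Skip s1 1 (\<lambda>s'. \<forall>v<n. s' 6 v = (if is_fold n E N ?r ?t then ?new v else ?r v))"
        by (intro runs_Skip) (simp add: eq)
      then show "runs Skip s1 (n * ((1 + 2 * N) + 2) + 2)
          (\<lambda>s'. \<forall>v<n. s' 6 v = (if is_fold n E N ?r ?t then ?new v else ?r v))"
        by (rule runs_weaken) auto
    qed
  qed
qed

lemma writes_try_fold: "writes (try_fold N) \<subseteq> {6, 11, 15, 16}"
  using writes_redirect_entry[of N N] by (auto simp: try_fold_def)

definition fold_round :: "nat \<Rightarrow> com" where
  "fold_round N = tuple_for 7 (scalar 0) (2 * N) (try_fold N)"

definition fold_round_time :: "nat \<Rightarrow> nat \<Rightarrow> nat" where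
  "fold_round_time N n = tuple_time n (try_fold_time N n) (2 * N)"

lemma writes_fold_round: "writes (fold_round N) \<subseteq> {6, 7, 11, 15, 16}"
  using writes_tuple_for[of 7 "scalar 0" "2 * N" "try_fold N"] writes_try_fold[of N]
  by (auto simp: fold_round_def)

text \<open>
A pass over all tuples either applies a fold, so that the number of fixed points decreases, or has tested all the
tuples on the same retraction, which is then free of folds. In particular a retraction that is
free of folds is left unchanged, which makes \<open>n\<close> passes sufficient.
\<close>
lemma runs_fold_round:
  assumes G: "graph_input n E s" and sym: "\<And>u v. E u v \<Longrightarrow> E v u" and N: "N \<ge> 1"
    and r: "retraction n E X (s 6)"
  shows "runs (fold_round N) s (fold_round_time N n) (\<lambda>s'. retraction n E X (s' 6) \<and>
    (fold_free n E N (s' 6) \<or>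
      (\<not> fold_free n E N (s 6) \<and> card (alive n (s' 6)) < card (alive n (s 6)))))"
proof -
  define fewer where "fewer s' \<longleftrightarrow> card (alive n (s' 6)) < card (alive n (s 6))" for s' :: state
  define J where "J s' \<longleftrightarrow> graph_input n E s' \<and> retraction n E X (s' 6) \<and>
    ((\<forall>v<n. s' 6 v = s 6 v) \<or> (fewer s' \<and> \<not> fold_free n E N (s 6)))" for s'
  define P where "P t s' \<longleftrightarrow> \<not> is_fold n E N (s 6) t \<or> fewer s'" for t s'
  have "runs (fold_round N) s (fold_round_time N n)
      (\<lambda>s'. J s' \<and> (\<forall>t. (\<forall>i<2 * N. t i < n) \<longrightarrow> P t s'))"
    unfolding fold_round_def fold_round_time_def
  proof (rule runs_tuple_for[where J = J and P = P])
    show "7 \<notin> writes (try_fold N)" using writes_try_fold[of N] by auto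
    show "J (s'(7 := f))" if "J s'" for s' f
      using that graph_input_update by (simp add: J_def fewer_def)
    show "P t (s'(7 := f))" if "P t s'" for t s' f
      using that by (simp add: P_def fewer_def)
    show "P t' s'" if "\<forall>i<2 * N. t i = t' i" "P t s'" for t t' s'
      using that is_fold_local[OF that(1)] by (simp add: P_def)
    show "aval (scalar 0) s' = n" if "J s'" for s'
      using that by (simp add: J_def graph_input_def)
    show "J s" using G r by (simp add: J_def)
    fix s1 assume J: "J s1" and t: "\<forall>i<2 * N. s1 7 i < n"
    then have G1: "graph_input n E s1" and r1: "retraction n E X (s1 6)" by (simp_all add: J_def)
    have "runs (try_fold N) s1 (try_fold_time N n) (\<lambda>s'. (\<forall>v<n. s' 6 v =
      (if is_fold n E N (s1 6) (s1 7) then redirect (s1 7) (\<lambda>i. s1 7 (N + i)) N (s1 6 v) else s1 6 v))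
      \<and> agree (writes (try_fold N)) s1 s')"
      by (rule runs_frame[OF runs_try_fold[OF G1 t]])
    then show "runs (try_fold N) s1 (try_fold_time N n)
        (\<lambda>s'. J s' \<and> P (s1 7) s' \<and> (\<forall>t. P t s1 \<longrightarrow> P t s'))"
    proof (rule runs_weaken[OF _ order_refl], elim conjE)
      fix s' assume eq: "\<forall>v<n. s' 6 v = (if is_fold n E N (s1 6) (s1 7)
            then redirect (s1 7) (\<lambda>i. s1 7 (N + i)) N (s1 6 v) else s1 6 v)"
        and ag: "agree (writes (try_fold N)) s1 s'"
      have "agree {6, 11, 15, 16} s1 s'" using agree_mono[OF ag writes_try_fold] .
      then have G': "graph_input n E s'" by (rule graph_input_agree[OF G1]) auto
      show "J s' \<and> P (s1 7) s' \<and> (\<forall>t. P t s1 \<longrightarrow> P t s')"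
      proof (cases "is_fold n E N (s1 6) (s1 7)")
        case True
        then have *: "\<And>v. v < n \<Longrightarrow> s' 6 v = redirect (s1 7) (\<lambda>i. s1 7 (N + i)) N (s1 6 v)"
          using eq by simp
        note fold = retraction_fold[OF r1 sym N t True *]
        have lt: "card (alive n (s' 6)) < card (alive n (s1 6))"
          by (rule psubset_card_mono[OF finite_alive fold(2)])
        have "fewer s' \<and> \<not> fold_free n E N (s 6)"
        proof (cases "\<forall>v<n. s1 6 v = s 6 v")
          case same: True
          then have "alive n (s1 6) = alive n (s 6)" by (intro alive_cong) simp
          moreover have "is_fold n E N (s 6) (s1 7)"
            using is_fold_cong[of n "s1 6" "s 6" N "s1 7" E] same t True by simp
          ultimately show ?thesis using lt t by (auto simp: fewer_def fold_free_def)
        next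
          case False
          then have "fewer s1 \<and> \<not> fold_free n E N (s 6)" using J unfolding J_def by blast
          then show ?thesis using lt by (auto simp: fewer_def)
        qed
        then show ?thesis using G' fold(1) by (auto simp: J_def P_def)
      next
        case False
        then have same: "\<And>v. v < n \<Longrightarrow> s' 6 v = s1 6 v" using eq by simp
        then have al: "alive n (s' 6) = alive n (s1 6)" by (intro alive_cong) simp
        have "retraction n E X (s' 6)" by (rule retraction_cong[OF r1]) (rule same)
        then have J': "J s'" using J G' same al by (auto simp: J_def fewer_def)
        have "P (s1 7) s'"
        proof (cases "\<forall>v<n. s1 6 v = s 6 v")
          case True
          then have "is_fold n E N (s1 6) (s1 7) \<longleftrightarrow> is_fold n E N (s 6) (s1 7)"
            using t by (intro is_fold_cong) auto
          then show ?thesis using False by (simp add: P_def)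
        next
          case False
          then show ?thesis using J al unfolding J_def P_def fewer_def by metis
        qed
        then show ?thesis using J' al by (auto simp: P_def fewer_def)
      qed
    qed
  qed
  then show ?thesis
  proof (rule runs_weaken[OF _ order_refl])
    fix s' assume *: "J s' \<and> (\<forall>t. (\<forall>i<2 * N. t i < n) \<longrightarrow> P t s')"
    show "retraction n E X (s' 6) \<and> (fold_free n E N (s' 6) \<or>
      (\<not> fold_free n E N (s 6) \<and> card (alive n (s' 6)) < card (alive n (s 6))))"
    proof (cases "fewer s' \<and> \<not> fold_free n E N (s 6)")
      case True
      then show ?thesis using * by (simp add: J_def fewer_def)
    next
      case False
      then have same: "\<And>v. v < n \<Longrightarrow> s' 6 v = s 6 v" using * by (auto simp: J_def)
      then have "\<not> fewer s'" using alive_cong[of n "s' 6" "s 6"] by (simp add: fewer_def)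
      then have "fold_free n E N (s 6)" using * by (auto simp: P_def fold_free_def)
      then show ?thesis using * fold_free_cong[of n "s' 6" "s 6", OF same] by (simp add: J_def)
    qed
  qed
qed

text \<open>
If each of the \<open>n\<close> passes applies a fold, then no vertex is left; so in any case the result is
free of folds.
\<close>
definition fold_all :: "nat \<Rightarrow> com" where
  "fold_all N = for_loop 17 0 (scalar 0) (fold_round N)"

lemma writes_fold_all: "writes (fold_all N) \<subseteq> {6, 7, 11, 15, 16, 17}"
  using writes_fold_round[of N] by (auto simp: fold_all_def)

lemma runs_fold_all:
  assumes G: "graph_input n E s" and sym: "\<And>u v. E u v \<Longrightarrow> E v u" and N: "N \<ge> 1"
    and r: "retraction n E X (s 6)"
  shows "runs (fold_all N) s (n * (fold_round_time N n + 2) + 2)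
    (\<lambda>s'. retraction n E X (s' 6) \<and> fold_free n E N (s' 6))"
proof -
  define P where "P j s' \<longleftrightarrow> retraction n E X (s' 6) \<and>
    (fold_free n E N (s' 6) \<or> card (alive n (s' 6)) + j \<le> n)" for j and s' :: state
  have notin: "x \<notin> insert 17 (writes (fold_round N))" if "x \<in> {0, 1, 5}" for x
    using writes_fold_round[of N] that by auto
  have "runs (fold_all N) s (n * (fold_round_time N n + 2) + 2)
      (\<lambda>s'. P n s' \<and> agree (insert 17 (writes (fold_round N))) s s')"
    unfolding fold_all_def
  proof (rule runs_for)
    show "17 \<notin> writes (fold_round N)" using writes_fold_round[of N] by auto
    have "card (alive n (s 6)) \<le> card {..<n}" by (rule card_mono) (auto simp: alive_def)
    then show "P 0 s" using r by (simp add: P_def)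
    show "P j (s'(17 := f))" if "P j s'" for j s' f using that by (simp add: P_def)
    fix s' assume ag: "agree (insert 17 (writes (fold_round N))) s s'"
    have G': "graph_input n E s'" by (rule graph_input_agree[OF G ag]) (use notin in auto)
    then show "aval (scalar 0) s' = n" by (simp add: graph_input_def)
    fix j assume "P j s'"
    then show "runs (fold_round N) s' (fold_round_time N n) (P (Suc j))"
      by (intro runs_weaken[OF runs_fold_round[OF G' sym N, where X = X]]) (auto simp: P_def)
  qed
  then show ?thesis
  proof (rule runs_weaken[OF _ order_refl], elim conjE)
    fix s' assume P: "P n s'"
    have "fold_free n E N (s' 6)" if "card (alive n (s' 6)) = 0"
    proof -
      have "alive n (s' 6) = {}" using that finite_alive by simp
      moreover have "0 < 2 * N" using N by simp
      ultimately show ?thesis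
        unfolding fold_free_def is_fold_def alive_def by blast
    qed
    then show "retraction n E X (s' 6) \<and> fold_free n E N (s' 6)"
      using P by (auto simp: P_def)
  qed
qed

section \<open>Deciding colorability of an induced subgraph\<close>

definition number_alive :: com where
  "number_alive = Seq (Store 10 (Num 0) (Num 0)) (for_loop 15 0 (scalar 0)
    (Cond (Eq (Get 6 (scalar 15)) (scalar 15))
      (Seq (Store 9 (scalar 15) (scalar 10)) (Store 10 (Num 0) (Plus (scalar 10) (Num 1)))) Skip))"

definition number_time :: "nat \<Rightarrow> nat" where "number_time n = 1 + (n * ((1 + (1 + 1)) + 2) + 2)"

lemma runs_number_alive:
  assumes n: "s 0 0 = n"
  shows "runs number_alive s (number_time n)
    (\<lambda>s'. \<forall>v\<in>alive n (s 6). s' 9 v = card (alive n (s 6) \<inter> {..<v}))"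
proof -
  let ?A = "alive n (s 6)"
  let ?c = "Cond (Eq (Get 6 (scalar 15)) (scalar 15))
      (Seq (Store 9 (scalar 15) (scalar 10)) (Store 10 (Num 0) (Plus (scalar 10) (Num 1)))) Skip"
  define P where "P j s' \<longleftrightarrow> s' 10 0 = card (?A \<inter> {..<j}) \<and>
    (\<forall>v\<in>?A. v < j \<longrightarrow> s' 9 v = card (?A \<inter> {..<v}))" for j and s' :: state
  show ?thesis
    unfolding number_alive_def number_time_def
  proof (rule runs_Seq)
    show "runs (Store 10 (Num 0) (Num 0)) s 1 (\<lambda>s'. agree {10} s s' \<and> s' 10 0 = 0)"
      by (rule runs_Store) (simp add: agree_def)
    fix s1 assume s1: "agree {10} s s1 \<and> s1 10 0 = 0"
    have "runs (for_loop 15 0 (scalar 0) ?c) s1 (n * ((1 + (1 + 1)) + 2) + 2)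
        (\<lambda>s'. P n s' \<and> agree (insert 15 (writes ?c)) s1 s')"
    proof (rule runs_for)
      show "15 \<notin> writes ?c" by simp
      show "P 0 s1" using s1 by (simp add: P_def)
      show "P j (s'(15 := f))" if "P j s'" for j s' f using that by (simp add: P_def)
      fix s' assume ag: "agree (insert 15 (writes ?c)) s1 s'"
      then have eq: "s' 0 0 = n" "s' 6 = s 6" using s1 n by (simp_all add: agree_def)
      then show "aval (scalar 0) s' = n" by simp
      fix j assume j: "j < n" and P: "P j s'" "s' 15 0 = j"
      show "runs ?c s' (1 + (1 + 1)) (P (Suc j))"
      proof (rule runs_Cond)
        assume "bval (Eq (Get 6 (scalar 15)) (scalar 15)) s'"
        then have "j \<in> ?A" using P j eq by (simp add: alive_def)
        then have "?A \<inter> {..<Suc j} = insert j (?A \<inter> {..<j})" by auto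
        then have card: "card (?A \<inter> {..<Suc j}) = Suc (card (?A \<inter> {..<j}))"
          by (simp add: finite_alive)
        show "runs (Seq (Store 9 (scalar 15) (scalar 10))
            (Store 10 (Num 0) (Plus (scalar 10) (Num 1)))) s' (1 + 1) (P (Suc j))"
        proof (rule runs_Seq)
          show "runs (Store 9 (scalar 15) (scalar 10)) s' 1 (\<lambda>s'. s' 10 0 = card (?A \<inter> {..<j}) \<and>
              (\<forall>v\<in>?A. v < Suc j \<longrightarrow> s' 9 v = card (?A \<inter> {..<v})))"
            by (rule runs_Store) (use P in \<open>auto simp: P_def less_Suc_eq\<close>)
          show "runs (Store 10 (Num 0) (Plus (scalar 10) (Num 1))) s'' 1 (P (Suc j))"
            if "s'' 10 0 = card (?A \<inter> {..<j}) \<and>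
              (\<forall>v\<in>?A. v < Suc j \<longrightarrow> s'' 9 v = card (?A \<inter> {..<v}))" for s''
            by (rule runs_Store) (use that card in \<open>auto simp: P_def\<close>)
        qed
      next
        assume "\<not> bval (Eq (Get 6 (scalar 15)) (scalar 15)) s'"
        then have no: "j \<notin> ?A" using P eq by (simp add: alive_def)
        then have "?A \<inter> {..<Suc j} = ?A \<inter> {..<j}" by (auto simp: less_Suc_eq)
        then have "runs Skip s' 1 (P (Suc j))"
          using P no by (intro runs_Skip) (auto simp: P_def less_Suc_eq)
        then show "runs Skip s' (1 + 1) (P (Suc j))" by (rule runs_weaken) auto
      qed
    qed
    then show "runs (for_loop 15 0 (scalar 0) ?c) s1 (n * ((1 + (1 + 1)) + 2) + 2)
        (\<lambda>s'. \<forall>v\<in>?A. s' 9 v = card (?A \<inter> {..<v}))"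
      by (rule runs_weaken) (auto simp: P_def alive_def)
  qed
qed

lemma rank_less_card: "finite A \<Longrightarrow> v \<in> A \<Longrightarrow> card (A \<inter> {..<v::nat}) < card A"
  by (rule psubset_card_mono) auto

lemma rank_inj:
  assumes "finite A"
  shows "inj_on (\<lambda>v. card (A \<inter> {..<v::nat})) A"
proof -
  have "card (A \<inter> {..<u}) < card (A \<inter> {..<v})" if "u < v" "u \<in> A" for u v
    using assms that by (intro psubset_card_mono) auto
  then show ?thesis unfolding inj_on_def by (metis less_irrefl linorder_neqE_nat)
qed

definition pair_test :: "nat \<Rightarrow> (nat \<Rightarrow> bexp) \<Rightarrow> (nat \<Rightarrow> aexp) \<Rightarrow> bexp" where
  "pair_test k mem col = Implies (And (mem 14) (mem 15)) (And (Less (col 14) (Num k))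
     (Implies (adj_test (scalar 14) (scalar 15)) (Not (Eq (col 14) (col 15)))))"

definition check_coloring :: "nat \<Rightarrow> (nat \<Rightarrow> bexp) \<Rightarrow> (nat \<Rightarrow> aexp) \<Rightarrow> com" where
  "check_coloring k mem col = Seq (Store 11 (Num 0) (Num 1))
    (for_loop 14 0 (scalar 0) (for_loop 15 0 (scalar 0)
      (Cond (Not (pair_test k mem col)) (Store 11 (Num 0) (Num 0)) Skip)))"

definition check_time :: "nat \<Rightarrow> nat" where
  "check_time n = 1 + (n * ((n * (2 + 2) + 2) + 2) + 2)"

lemma writes_check_coloring [simp]: "writes (check_coloring k mem col) = {11, 14, 15}"
  by (auto simp: check_coloring_def)

lemma runs_check_coloring:
  assumes G: "graph_input n E s" and X: "X \<subseteq> {..<n}"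
    and mem: "\<And>s' x. agree {11, 14, 15} s s' \<Longrightarrow> x \<in> {14, 15} \<Longrightarrow> s' x 0 < n \<Longrightarrow>
      bval (mem x) s' \<longleftrightarrow> s' x 0 \<in> X"
    and col: "\<And>s' x. agree {11, 14, 15} s s' \<Longrightarrow> x \<in> {14, 15} \<Longrightarrow> s' x 0 < n \<Longrightarrow>
      aval (col x) s' = c (s' x 0)"
  shows "runs (check_coloring k mem col) s (check_time n)
    (\<lambda>s'. s' 11 0 = of_bool (proper_on k E X c) \<and> agree {11, 14, 15} s s')"
proof -
  define Q where "Q u v \<longleftrightarrow> (u \<in> X \<and> v \<in> X \<longrightarrow> c u < k \<and> (E u v \<longrightarrow> c u \<noteq> c v))" for u v
  have Q: "proper_on k E X c \<longleftrightarrow> (\<forall>u<n. \<forall>v<n. Q u v)"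
    using X unfolding proper_on_def Q_def by blast
  let ?c = "Cond (Not (pair_test k mem col)) (Store 11 (Num 0) (Num 0)) Skip"
  let ?in = "for_loop 15 0 (scalar 0) ?c"
  show ?thesis
    unfolding check_coloring_def check_time_def
  proof (rule runs_Seq)
    show "runs (Store 11 (Num 0) (Num 1)) s 1 (\<lambda>s'. agree {11} s s' \<and> s' 11 0 = of_bool True)"
      by (rule runs_Store) (simp add: agree_def)
    fix s1 assume s1: "agree {11} s s1 \<and> s1 11 0 = of_bool True"
    have n: "aval (scalar 0) s' = n" "agree {11, 14, 15} s s'" if "agree {11, 14, 15} s1 s'" for s'
      using s1 that G by (auto simp: agree_def graph_input_def)
    have w: "insert 14 (writes ?in) = {11, 14, 15}" "insert 15 (writes ?c) = {11, 15}" by auto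
    have "runs (for_loop 14 0 (scalar 0) ?in) s1 (n * ((n * (2 + 2) + 2) + 2) + 2)
      (\<lambda>s'. s' 11 0 = of_bool (True \<and> (\<forall>u<n. \<forall>v<n. Q u v)) \<and> agree (insert 14 (writes ?in)) s1 s')"
    proof (rule runs_check_loop)
      fix u s2 b
      assume u: "u < n" "s2 11 0 = of_bool b" "s2 14 0 = u" and ag2: "agree (insert 14 (writes ?in)) s1 s2"
      have "runs ?in s2 (n * (2 + 2) + 2)
        (\<lambda>s'. s' 11 0 = of_bool (b \<and> (\<forall>v<n. Q u v)) \<and> agree (insert 15 (writes ?c)) s2 s')"
      proof (rule runs_check_loop)
        fix s3 assume "agree (insert 15 (writes ?c)) s2 s3"
        then have ag3: "agree {11, 14, 15} s1 s3" and s3: "s3 14 0 = u"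
          using ag2 u unfolding w by (auto simp: agree_def)
        show "aval (scalar 0) s3 = n" by (rule n(1)[OF ag3])
        fix v b' assume v: "v < n" "s3 11 0 = of_bool b'" "s3 15 0 = v"
        note ag = n(2)[OF ag3]
        have "graph_input n E s3" by (rule graph_input_agree[OF G ag]) auto
        then have "bval (pair_test k mem col) s3 \<longleftrightarrow> Q u v"
          using mem[OF ag, of 14] mem[OF ag, of 15] col[OF ag, of 14] col[OF ag, of 15] s3 u v
          by (simp add: pair_test_def bval_adj_test Q_def)
        then show "runs ?c s3 2 (\<lambda>s'. s' 11 0 = of_bool (b' \<and> Q u v))"
          by (intro runs_conditional_Store) (use v in auto)
      qed (use u in auto)
      then show "runs ?in s2 (n * (2 + 2) + 2) (\<lambda>s'. s' 11 0 = of_bool (b \<and> (\<forall>v<n. Q u v)))"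
        by (rule runs_weaken) auto
    next
      fix s' assume "agree (insert 14 (writes ?in)) s1 s'"
      then show "aval (scalar 0) s' = n" unfolding w by (rule n(1))
    qed (use s1 in auto)
    then show "runs (for_loop 14 0 (scalar 0) ?in) s1 (n * ((n * (2 + 2) + 2) + 2) + 2)
      (\<lambda>s'. s' 11 0 = of_bool (proper_on k E X c) \<and> agree {11, 14, 15} s s')"
      unfolding w by (rule runs_weaken) (use n(2) Q in auto)
  qed
qed

text \<open>
The color of a vertex is the one assigned to its image under the retraction.
\<close>
definition folded_color :: "nat \<Rightarrow> aexp" where
  "folded_color x = Get 8 (Get 9 (Get 6 (scalar x)))"

definition try_coloring :: "nat \<Rightarrow> com" where
  "try_coloring k = Seq (check_coloring k (\<lambda>x. Less (Num 0) (Get 3 (scalar x))) folded_color)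
    (Cond (Eq (scalar 11) (Num 1))
      (Seq (Store 12 (Num 0) (Num 1))
        (for_loop 15 0 (scalar 0) (Store 13 (scalar 15) (folded_color 15)))) Skip)"

definition try_coloring_time :: "nat \<Rightarrow> nat" where
  "try_coloring_time n = check_time n + (1 + (1 + (n * (1 + 2) + 2)))"

definition members :: "nat \<Rightarrow> state \<Rightarrow> nat set" where
  "members n s = {v. v < n \<and> 0 < s 3 v}"

lemma writes_try_coloring [simp]: "writes (try_coloring k) = {11, 12, 13, 14, 15}"
  by (auto simp: try_coloring_def)

lemma proper_on_cong: "(\<And>v. v \<in> X \<Longrightarrow> c v = c' v) \<Longrightarrow> proper_on k E X c \<longleftrightarrow> proper_on k E X c'"
  by (simp add: proper_on_def)

lemma runs_try_coloring:
  assumes G: "graph_input n E s" and X: "X = members n s"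
  defines "c \<equiv> \<lambda>v. s 8 (s 9 (s 6 v))"
  shows "runs (try_coloring k) s (try_coloring_time n)
    (\<lambda>s'. if proper_on k E X c then s' 12 0 = 1 \<and> proper_on k E X (s' 13)
      else s' 12 = s 12 \<and> s' 13 = s 13)"
  unfolding try_coloring_def try_coloring_time_def
proof (rule runs_Seq)
  show "runs (check_coloring k (\<lambda>x. Less (Num 0) (Get 3 (scalar x))) folded_color) s (check_time n)
      (\<lambda>s'. s' 11 0 = of_bool (proper_on k E X c) \<and> agree {11, 14, 15} s s')"
    by (rule runs_check_coloring[OF G])
      (auto simp: X members_def agree_def folded_color_def c_def)
  fix s1 assume s1: "s1 11 0 = of_bool (proper_on k E X c) \<and> agree {11, 14, 15} s s1"
  then have n: "s1 0 0 = n" using G by (simp add: agree_def graph_input_def)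
  show "runs (Cond (Eq (scalar 11) (Num 1)) (Seq (Store 12 (Num 0) (Num 1))
        (for_loop 15 0 (scalar 0) (Store 13 (scalar 15) (folded_color 15)))) Skip)
      s1 (1 + (1 + (n * (1 + 2) + 2)))
      (\<lambda>s'. if proper_on k E X c then s' 12 0 = 1 \<and> proper_on k E X (s' 13)
        else s' 12 = s 12 \<and> s' 13 = s 13)" (is "runs _ _ _ ?R")
  proof (rule runs_Cond)
    assume "bval (Eq (scalar 11) (Num 1)) s1"
    then have yes: "proper_on k E X c" using s1 by (cases "proper_on k E X c") auto
    show "runs (Seq (Store 12 (Num 0) (Num 1))
        (for_loop 15 0 (scalar 0) (Store 13 (scalar 15) (folded_color 15))))
      s1 (1 + (n * (1 + 2) + 2)) ?R"
    proof (rule runs_Seq)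
      show "runs (Store 12 (Num 0) (Num 1)) s1 1 (\<lambda>s'. agree {12} s1 s' \<and> s' 12 0 = 1)"
        by (rule runs_Store) (simp add: agree_def)
      fix s2 assume s2: "agree {12} s1 s2 \<and> s2 12 0 = 1"
      let ?c = "Store 13 (scalar 15) (folded_color 15)"
      have "runs (for_loop 15 0 (scalar 0) ?c) s2 (n * (1 + 2) + 2)
          (\<lambda>s'. (\<forall>v<n. s' 13 v = c v) \<and> agree (insert 15 (writes ?c)) s2 s')"
      proof (rule runs_for[where P = "\<lambda>j s'. \<forall>v<j. s' 13 v = c v"])
        fix s3 assume ag3: "agree (insert 15 (writes ?c)) s2 s3"
        then have eq: "s3 0 0 = n" "s3 8 = s 8" "s3 9 = s 9" "s3 6 = s 6"
          using s1 s2 n by (auto simp: agree_def)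
        then show "aval (scalar 0) s3 = n" by simp
        fix j assume "j < n" "\<forall>v<j. s3 13 v = c v" "s3 15 0 = j"
        then show "runs ?c s3 1 (\<lambda>s'. \<forall>v<Suc j. s' 13 v = c v)"
          by (intro runs_Store) (auto simp: folded_color_def eq c_def less_Suc_eq)
      qed auto
      then show "runs (for_loop 15 0 (scalar 0) ?c) s2 (n * (1 + 2) + 2) ?R"
      proof (rule runs_weaken[OF _ order_refl])
        fix s' assume *: "(\<forall>v<n. s' 13 v = c v) \<and> agree (insert 15 (writes ?c)) s2 s'"
        then have "proper_on k E X (s' 13)"
          using yes proper_on_cong[of X "s' 13" c] by (auto simp: X members_def)
        then show "?R s'" using yes * s2 by (auto simp: agree_def)
      qed
    qed
  next
    assume "\<not> bval (Eq (scalar 11) (Num 1)) s1"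
    then have "\<not> proper_on k E X c" using s1 by auto
    then have "runs Skip s1 1 ?R" by (intro runs_Skip) (use s1 in \<open>simp add: agree_def\<close>)
    then show "runs Skip s1 (1 + (n * (1 + 2) + 2)) ?R" by (rule runs_weaken) auto
  qed
qed

text \<open>
Every candidate coloring is checked on the whole subgraph \<open>X\<close> before it is accepted. So the answer yes is correct
for any value of \<open>M\<close>, and only the answer no relies on the bound for graphs without folds.
\<close>
definition search_coloring :: "nat \<Rightarrow> nat \<Rightarrow> com" where
  "search_coloring k M = Seq (Store 12 (Num 0) (Num 0)) (tuple_for 8 (Num k) M (try_coloring k))"

definition search_time :: "nat \<Rightarrow> nat \<Rightarrow> nat \<Rightarrow> nat" where
  "search_time k M n = 1 + tuple_time k (try_coloring_time n) M"

lemma runs_search_coloring: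
  assumes G: "graph_input n E s" and X: "X = members n s"
  defines "c \<equiv> \<lambda>t v. t (s 9 (s 6 v))"
  shows "runs (search_coloring k M) s (search_time k M n)
    (\<lambda>s'. (s' 12 0 \<noteq> 0 \<longrightarrow> proper_on k E X (s' 13)) \<and>
      (\<forall>t. (\<forall>i<M. t i < k) \<longrightarrow> (\<forall>v\<in>X. s 9 (s 6 v) < M) \<longrightarrow> proper_on k E X (c t) \<longrightarrow> s' 12 0 \<noteq> 0))"
proof -
  define J where "J s' \<longleftrightarrow> agree {8, 11, 12, 13, 14, 15} s s' \<and>
    (s' 12 0 \<noteq> 0 \<longrightarrow> proper_on k E X (s' 13))" for s'
  define P where "P t s' \<longleftrightarrow>
    ((\<forall>v\<in>X. s 9 (s 6 v) < M) \<longrightarrow> proper_on k E X (c t) \<longrightarrow> s' 12 0 \<noteq> 0)" for t and s' :: state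
  show ?thesis
    unfolding search_coloring_def search_time_def
  proof (rule runs_Seq)
    show "runs (Store 12 (Num 0) (Num 0)) s 1 J"
      by (rule runs_Store) (auto simp: J_def agree_def)
    fix s1 assume s1: "J s1"
    have "runs (tuple_for 8 (Num k) M (try_coloring k)) s1 (tuple_time k (try_coloring_time n) M)
        (\<lambda>s'. J s' \<and> (\<forall>t. (\<forall>i<M. t i < k) \<longrightarrow> P t s'))"
    proof (rule runs_tuple_for[where J = J and P = P])
      show "8 \<notin> writes (try_coloring k)" by simp
      show "J (s'(8 := f))" if "J s'" for s' f using that by (simp add: J_def agree_def)
      show "P t (s'(8 := f))" if "P t s'" for t s' f using that by (simp add: P_def)
      show "P t' s'" if "\<forall>i<M. t i = t' i" "P t s'" for t t' s'
        using that proper_on_cong[of X "c t" "c t'"] by (auto simp: P_def c_def)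
      show "aval (Num k) s' = k" for s' by simp
      show "J s1" by fact
      fix s' assume J: "J s'"
      then have ag: "agree {8, 11, 12, 13, 14, 15} s s'" by (simp add: J_def)
      have G': "graph_input n E s'" by (rule graph_input_agree[OF G ag]) auto
      have X': "X = members n s'" using ag X by (simp add: members_def agree_def)
      have c': "(\<lambda>v. s' 8 (s' 9 (s' 6 v))) = c (s' 8)" using ag by (simp add: agree_def c_def)
      from runs_frame[OF runs_try_coloring[OF G' X', of k]]
      show "runs (try_coloring k) s' (try_coloring_time n)
          (\<lambda>s''. J s'' \<and> P (s' 8) s'' \<and> (\<forall>t. P t s' \<longrightarrow> P t s''))"
        unfolding c'
      proof (rule runs_weaken[OF _ order_refl], elim conjE)
        fix s'' assume post: "if proper_on k E X (c (s' 8))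
            then s'' 12 0 = 1 \<and> proper_on k E X (s'' 13) else s'' 12 = s' 12 \<and> s'' 13 = s' 13"
          and "agree (writes (try_coloring k)) s' s''"
        then have "agree {8, 11, 12, 13, 14, 15} s s''" using ag by (auto simp: agree_def)
        then show "J s'' \<and> P (s' 8) s'' \<and> (\<forall>t. P t s' \<longrightarrow> P t s'')"
          using post J by (auto simp: J_def P_def split: if_splits)
      qed
    qed
    then show "runs (tuple_for 8 (Num k) M (try_coloring k)) s1 (tuple_time k (try_coloring_time n) M)
      (\<lambda>s'. (s' 12 0 \<noteq> 0 \<longrightarrow> proper_on k E X (s' 13)) \<and>
      (\<forall>t. (\<forall>i<M. t i < k) \<longrightarrow> (\<forall>v\<in>X. s 9 (s 6 v) < M) \<longrightarrow> proper_on k E X (c t) \<longrightarrow> s' 12 0 \<noteq> 0))"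
      by (rule runs_weaken) (auto simp: J_def P_def)
  qed
qed

definition init_retraction :: com where
  "init_retraction = for_loop 15 0 (scalar 0) (Cond (Less (Num 0) (Get 3 (scalar 15)))
     (Store 6 (scalar 15) (scalar 15)) (Store 6 (scalar 15) (scalar 0)))"

lemma runs_init_retraction:
  assumes n: "s 0 0 = n" and X: "X = members n s"
  shows "runs init_retraction s (n * ((1 + 1) + 2) + 2) (\<lambda>s'. retraction n E X (s' 6))"
proof -
  let ?c = "Cond (Less (Num 0) (Get 3 (scalar 15)))
     (Store 6 (scalar 15) (scalar 15)) (Store 6 (scalar 15) (scalar 0))"
  let ?P = "\<lambda>j s'. \<forall>v<j. s' 6 v = (if v \<in> X then v else n)"
  have "runs init_retraction s (n * ((1 + 1) + 2) + 2)
      (\<lambda>s'. ?P n s' \<and> agree (insert 15 (writes ?c)) s s')"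
    unfolding init_retraction_def
  proof (rule runs_for[where P = ?P])
    fix s' assume "agree (insert 15 (writes ?c)) s s'"
    then have eq: "s' 0 0 = n" "s' 3 = s 3" using n by (simp_all add: agree_def)
    then show "aval (scalar 0) s' = n" by simp
    fix j assume j: "j < n" "?P j s'" "s' 15 0 = j"
    show "runs ?c s' (1 + 1) (?P (Suc j))"
    proof (rule runs_Cond)
      assume "bval (Less (Num 0) (Get 3 (scalar 15))) s'"
      then have "j \<in> X" using j eq by (simp add: X members_def)
      then show "runs (Store 6 (scalar 15) (scalar 15)) s' 1 (?P (Suc j))"
        by (intro runs_Store) (use j in \<open>auto simp: less_Suc_eq\<close>)
    next
      assume "\<not> bval (Less (Num 0) (Get 3 (scalar 15))) s'"
      then have "j \<notin> X" using j eq by (simp add: X members_def)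
      then show "runs (Store 6 (scalar 15) (scalar 0)) s' 1 (?P (Suc j))"
        by (intro runs_Store) (use j eq in \<open>auto simp: less_Suc_eq\<close>)
    qed
  qed auto
  then show ?thesis
    by (rule runs_weaken) (auto simp: retraction_def X members_def)
qed

definition decide :: "nat \<Rightarrow> nat \<Rightarrow> com" where
  "decide k M = Seq init_retraction (Seq (fold_all (k + 1)) (Seq number_alive (search_coloring k M)))"

definition decide_time :: "nat \<Rightarrow> nat \<Rightarrow> nat \<Rightarrow> nat" where
  "decide_time k M n = (n * ((1 + 1) + 2) + 2) + ((n * (fold_round_time (k + 1) n + 2) + 2) +
     (number_time n + search_time k M n))"

lemma writes_decide: "writes (decide k M) \<subseteq> {6..<18}"
  using writes_fold_all[of "k + 1"] writes_tuple_for[of 8 "Num k" M "try_coloring k"]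
  by (auto simp: decide_def init_retraction_def number_alive_def search_coloring_def)

text \<open>
If \<open>X\<close> is colorable, then the folded graph has at most \<open>M\<close> vertices, so its coloring is among the tuples
that are tried, and it pulls back to \<open>X\<close> along the retraction.
\<close>
theorem runs_decide:
  assumes G: "graph_input n E s" and free: "free_graph {..<n} E" and k: "k \<ge> 1"
    and M: "\<And>V. rigid_graph V E k \<Longrightarrow> card (V :: nat set) \<le> M" and X: "X = members n s"
  shows "runs (decide k M) s (decide_time k M n) (\<lambda>s'. (s' 12 0 \<noteq> 0 \<longleftrightarrow> colorable_on k E X) \<and>
    (s' 12 0 \<noteq> 0 \<longrightarrow> proper_on k E X (s' 13)) \<and> agree {6..<18} s s')"
proof -
  interpret free_graph "{..<n}" E by (rule free)
  have n: "s 0 0 = n" using G by (simp add: graph_input_def)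
  have frame: "graph_input n E s'" "members n s' = X" if "agree {6..<18} s s'" for s'
    using graph_input_agree[OF G that] that X by (auto simp: members_def agree_def)
  have w: "writes init_retraction \<subseteq> {6..<18}" "writes (fold_all (k + 1)) \<subseteq> {6..<18}"
      "writes number_alive \<subseteq> {7..<18}"
    using writes_fold_all[of "k + 1"] by (auto simp: init_retraction_def number_alive_def)
  have "runs (decide k M) s (decide_time k M n) (\<lambda>s'. (s' 12 0 \<noteq> 0 \<longleftrightarrow> colorable_on k E X) \<and>
    (s' 12 0 \<noteq> 0 \<longrightarrow> proper_on k E X (s' 13)))"
    unfolding decide_def decide_time_def
  proof (intro runs_Seq)
    show "runs init_retraction s (n * ((1 + 1) + 2) + 2)
        (\<lambda>s'. retraction n E X (s' 6) \<and> agree {6..<18} s s')"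
      by (rule runs_weaken[OF runs_frame[OF runs_init_retraction[OF n X]]])
        (use agree_mono w in auto)
  next
    fix s1 assume s1: "retraction n E X (s1 6) \<and> agree {6..<18} s s1"
    show "runs (fold_all (k + 1)) s1 (n * (fold_round_time (k + 1) n + 2) + 2)
        (\<lambda>s'. retraction n E X (s' 6) \<and> fold_free n E (k + 1) (s' 6) \<and> agree {6..<18} s s')"
      by (rule runs_weaken[OF runs_frame[OF runs_fold_all[OF frame(1) sym, where X = X]]])
        (use s1 agree_trans[OF _ _ order_refl w(2), of s s1] in auto)
  next
    fix s1
    assume s1: "retraction n E X (s1 6) \<and> fold_free n E (k + 1) (s1 6) \<and> agree {6..<18} s s1"
    then have "s1 0 0 = n" using n by (simp add: agree_def)
    from runs_frame[OF runs_number_alive[of s1 n, OF this]]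
    show "runs number_alive s1 (number_time n) (\<lambda>s'. retraction n E X (s' 6) \<and>
        fold_free n E (k + 1) (s' 6) \<and> agree {6..<18} s s' \<and>
        (\<forall>v\<in>alive n (s' 6). s' 9 v = card (alive n (s' 6) \<inter> {..<v})))"
    proof (rule runs_weaken[OF _ order_refl], elim conjE)
      fix s' assume num: "\<forall>v\<in>alive n (s1 6). s' 9 v = card (alive n (s1 6) \<inter> {..<v})"
        and "agree (writes number_alive) s1 s'"
      then have "agree {7..<18} s1 s'" using agree_mono w(3) by blast
      then have "s' 6 = s1 6" "agree {6..<18} s s'" using s1 by (auto simp: agree_def)
      then show "retraction n E X (s' 6) \<and> fold_free n E (k + 1) (s' 6) \<and> agree {6..<18} s s' \<and>
        (\<forall>v\<in>alive n (s' 6). s' 9 v = card (alive n (s' 6) \<inter> {..<v}))"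
        using s1 num by simp
    qed
  next
    fix s1
    assume "retraction n E X (s1 6) \<and> fold_free n E (k + 1) (s1 6) \<and> agree {6..<18} s s1 \<and>
        (\<forall>v\<in>alive n (s1 6). s1 9 v = card (alive n (s1 6) \<inter> {..<v}))"
    then have r: "retraction n E X (s1 6)" and ff: "fold_free n E (k + 1) (s1 6)"
      and ag: "agree {6..<18} s s1"
      and num: "\<forall>v\<in>alive n (s1 6). s1 9 v = card (alive n (s1 6) \<inter> {..<v})" by auto
    let ?A = "alive n (s1 6)" and ?rank = "\<lambda>v. card (alive n (s1 6) \<inter> {..<v})"
    have found: "\<exists>t. (\<forall>i<M. t i < k) \<and> (\<forall>v\<in>X. s1 9 (s1 6 v) < M) \<and>
        proper_on k E X (\<lambda>v. t (s1 9 (s1 6 v)))" if col: "colorable_on k E X"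
    proof -
      have AM: "card ?A \<le> M" by (rule M[OF rigid_alive[OF free r ff col k]])
      obtain c where c: "proper_on k E X c" using col by (auto simp: colorable_on_def)
      \<comment> \<open>Positions beyond the number of fixed points get the color 0, which exists as \<open>k\<close> is positive.\<close>
      define t where "t i = (if i \<in> ?rank ` ?A then c (inv_into ?A ?rank i) else 0)" for i
      have inj: "inj_on ?rank ?A" by (rule rank_inj[OF finite_alive])
      have t_rank: "t (?rank v) = c v" if "v \<in> ?A" for v
        using inv_into_f_f[OF inj that] that by (simp add: t_def)
      have rA: "s1 6 v \<in> ?A" "s1 6 v \<in> X" if "v \<in> X" for v
        using r that by (auto simp: retraction_def alive_def)
      have A_X: "?A \<subseteq> X" by (rule alive_subset[OF r])
      have "t i < k" for i
      proof (cases "i \<in> ?rank ` ?A")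
        case True
        then have "inv_into ?A ?rank i \<in> X" using A_X inv_into_into by (metis subsetD)
        then show ?thesis using c True by (simp add: t_def proper_on_def)
      qed (use k in \<open>simp add: t_def\<close>)
      moreover have "s1 9 (s1 6 v) < M" if "v \<in> X" for v
        using num rA[OF that] rank_less_card[OF finite_alive rA(1)[OF that]] AM by simp
      moreover have t_fold: "t (s1 9 (s1 6 v)) = c (s1 6 v)" if "v \<in> X" for v
        using num rA[OF that] t_rank by simp
      have "proper_on k E X (\<lambda>v. t (s1 9 (s1 6 v)))"
        unfolding proper_on_def
      proof (intro conjI ballI impI)
        fix v assume "v \<in> X"
        then show "t (s1 9 (s1 6 v)) < k" using t_fold rA c by (simp add: proper_on_def)
      next
        fix u v assume uv: "u \<in> X" "v \<in> X" "E u v"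
        then have "E (s1 6 u) (s1 6 v)" using r by (simp add: retraction_def)
        then show "t (s1 9 (s1 6 u)) \<noteq> t (s1 9 (s1 6 v))"
          using t_fold uv rA c by (simp add: proper_on_def)
      qed
      ultimately show ?thesis by blast
    qed
    show "runs (search_coloring k M) s1 (search_time k M n)
        (\<lambda>s'. (s' 12 0 \<noteq> 0 \<longleftrightarrow> colorable_on k E X) \<and> (s' 12 0 \<noteq> 0 \<longrightarrow> proper_on k E X (s' 13)))"
      by (rule runs_weaken[OF runs_search_coloring[OF frame(1)[OF ag] frame(2)[OF ag, symmetric]]])
        (use found in \<open>auto simp: colorable_on_def\<close>)
  qed
  from runs_frame[OF this] show ?thesis
    by (rule runs_weaken) (use agree_mono[OF _ writes_decide] in auto)
qed

section \<open>The solver and the verifier\<close>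

definition row_offsets :: com where
  "row_offsets = for_loop 15 0 (scalar 0)
    (Store 5 (Plus (scalar 15) (Num 1)) (Plus (Get 5 (scalar 15)) (scalar 0)))"

lemma runs_row_offsets:
  assumes n: "s 0 0 = n" and mat: "\<And>u v. u < n \<Longrightarrow> v < n \<Longrightarrow> 0 < s 1 (u * n + v) \<longleftrightarrow> E u v"
    and zero: "s 5 0 = 0"
  shows "runs row_offsets s (n * (1 + 2) + 2) (\<lambda>s'. graph_input n E s' \<and> agree {5, 15} s s')"
proof -
  let ?c = "Store 5 (Plus (scalar 15) (Num 1)) (Plus (Get 5 (scalar 15)) (scalar 0))"
  let ?P = "\<lambda>j s'. \<forall>v\<le>j. s' 5 v = v * n"
  have "runs row_offsets s (n * (1 + 2) + 2) (\<lambda>s'. ?P n s' \<and> agree (insert 15 (writes ?c)) s s')"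
    unfolding row_offsets_def
  proof (rule runs_for[where P = ?P])
    fix s' assume "agree (insert 15 (writes ?c)) s s'"
    then have eq: "s' 0 0 = n" using n by (simp add: agree_def)
    then show "aval (scalar 0) s' = n" by simp
    fix j assume "j < n" "?P j s'" "s' 15 0 = j"
    then show "runs ?c s' 1 (?P (Suc j))"
      by (intro runs_Store) (auto simp: eq le_Suc_eq)
  qed (use zero in auto)
  then show ?thesis
    by (rule runs_weaken) (use n mat in \<open>auto simp: graph_input_def agree_def\<close>)
qed

lemma decide_frame:
  assumes "agree {6..<18} s s'"
  shows "graph_input n E s \<Longrightarrow> graph_input n E s'" "members n s' = members n s"
    "s' 2 = s 2" "s' 4 = s 4" "s' 18 = s 18"
proof -
  show "graph_input n E s'" if "graph_input n E s"
    by (rule graph_input_agree[OF that assms]) auto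
qed (use assms in \<open>auto simp: agree_def members_def\<close>)

lemma members_update: "x \<noteq> 3 \<Longrightarrow> members n (s(x := f)) = members n s"
  by (simp add: members_def)

definition solver :: "nat \<Rightarrow> nat \<Rightarrow> com" where
  "solver k M = Seq row_offsets
    (Seq (for_loop 15 0 (scalar 0) (Store 3 (scalar 15) (Num 1)))
    (Seq (decide k M)
    (Cond (Less (Num 0) (scalar 12))
      (Seq (Store 2 (Num 0) (Num 1))
        (for_loop 15 0 (scalar 0) (Store 3 (scalar 15) (Get 13 (scalar 15)))))
      (for_loop 18 0 (scalar 0)
        (Seq (Store 3 (scalar 18) (Num 0))
        (Seq (decide k M)
        (Cond (Less (Num 0) (scalar 12)) (Store 3 (scalar 18) (Num 1)) Skip)))))))"

definition solver_time :: "nat \<Rightarrow> nat \<Rightarrow> nat \<Rightarrow> nat" where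
  "solver_time k M n = (n * (1 + 2) + 2) + ((n * (1 + 2) + 2) + (decide_time k M n +
     (1 + ((1 + (n * (1 + 2) + 2)) + (n * ((1 + (decide_time k M n + 2)) + 2) + 2)))))"

definition critical_on :: "nat \<Rightarrow> ('a \<Rightarrow> 'a \<Rightarrow> bool) \<Rightarrow> 'a set \<Rightarrow> bool" where
  "critical_on k E X \<longleftrightarrow> \<not> colorable_on k E X \<and> (\<forall>v\<in>X. colorable_on k E (X - {v}))"

text \<open>
Throughout the deletion loop, the remaining set is not colorable, and each vertex already considered is either
deleted or necessary for that. A necessary vertex remains so when further vertices are deleted, since
colorability is inherited by subsets.
\<close>
lemma runs_solver:
  assumes input: "s 0 0 = n" "\<And>u v. u < n \<Longrightarrow> v < n \<Longrightarrow> 0 < s 1 (u * n + v) \<longleftrightarrow> E u v"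
      "s 5 0 = 0" "s 2 0 = 0"
    and free: "free_graph {..<n} E" and k: "k \<ge> 1"
    and M: "\<And>V. rigid_graph V E k \<Longrightarrow> card (V :: nat set) \<le> M"
  shows "runs (solver k M) s (solver_time k M n) (\<lambda>s'.
    (s' 2 0 \<noteq> 0 \<longleftrightarrow> colorable_on k E {..<n}) \<and>
    (if s' 2 0 \<noteq> 0 then proper_on k E {..<n} (s' 3) else critical_on k E (members n s')))"
    (is "runs _ _ _ ?R")
  unfolding solver_def solver_time_def
proof (intro runs_Seq)
  show "runs row_offsets s (n * (1 + 2) + 2) (\<lambda>s'. graph_input n E s' \<and> s' 2 0 = 0)"
    by (rule runs_weaken[OF runs_row_offsets[OF input(1-3)]]) (use input(4) in \<open>auto simp: agree_def\<close>)
next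
  fix s1 assume s1: "graph_input n E s1 \<and> s1 2 0 = 0"
  let ?c = "Store 3 (scalar 15) (Num 1)"
  have "runs (for_loop 15 0 (scalar 0) ?c) s1 (n * (1 + 2) + 2)
      (\<lambda>s'. (\<forall>v<n. s' 3 v = 1) \<and> agree (insert 15 (writes ?c)) s1 s')"
  proof (rule runs_for[where P = "\<lambda>j s'. \<forall>v<j. s' 3 v = 1"])
    fix s' assume "agree (insert 15 (writes ?c)) s1 s'"
    then show "aval (scalar 0) s' = n" using s1 by (simp add: agree_def graph_input_def)
    fix j assume "j < n" "\<forall>v<j. s' 3 v = 1" "s' 15 0 = j"
    then show "runs ?c s' 1 (\<lambda>s'. \<forall>v<Suc j. s' 3 v = 1)"
      by (intro runs_Store) (auto simp: less_Suc_eq)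
  qed auto
  then show "runs (for_loop 15 0 (scalar 0) ?c) s1 (n * (1 + 2) + 2)
      (\<lambda>s'. graph_input n E s' \<and> s' 2 0 = 0 \<and> members n s' = {..<n})"
  proof (rule runs_weaken[OF _ order_refl], elim conjE)
    fix s' assume *: "\<forall>v<n. s' 3 v = 1" "agree (insert 15 (writes ?c)) s1 s'"
    have "graph_input n E s'" by (rule graph_input_agree[OF _ *(2)]) (use s1 in auto)
    then show "graph_input n E s' \<and> s' 2 0 = 0 \<and> members n s' = {..<n}"
      using * s1 by (auto simp: agree_def members_def)
  qed
next
  fix s1 assume s1: "graph_input n E s1 \<and> s1 2 0 = 0 \<and> members n s1 = {..<n}"
  then have G: "graph_input n E s1" and mem: "{..<n} = members n s1" by auto
  show "runs (decide k M) s1 (decide_time k M n) (\<lambda>s'. graph_input n E s' \<and> s' 2 0 = 0 \<and>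
      members n s' = {..<n} \<and> (s' 12 0 \<noteq> 0 \<longleftrightarrow> colorable_on k E {..<n}) \<and>
      (s' 12 0 \<noteq> 0 \<longrightarrow> proper_on k E {..<n} (s' 13)))"
    by (rule runs_weaken[OF runs_decide[OF G free k M mem]])
      (use s1 decide_frame[of s1] in auto)
next
  fix s1 assume s1: "graph_input n E s1 \<and> s1 2 0 = 0 \<and>
      members n s1 = {..<n} \<and> (s1 12 0 \<noteq> 0 \<longleftrightarrow> colorable_on k E {..<n}) \<and>
      (s1 12 0 \<noteq> 0 \<longrightarrow> proper_on k E {..<n} (s1 13))"
  then have G: "graph_input n E s1" by simp
  let ?copy = "for_loop 15 0 (scalar 0) (Store 3 (scalar 15) (Get 13 (scalar 15)))"
  let ?del = "Seq (Store 3 (scalar 18) (Num 0)) (Seq (decide k M)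
        (Cond (Less (Num 0) (scalar 12)) (Store 3 (scalar 18) (Num 1)) Skip))"
  let ?t = "n * ((1 + (decide_time k M n + 2)) + 2) + 2"
  show "runs (Cond (Less (Num 0) (scalar 12)) (Seq (Store 2 (Num 0) (Num 1)) ?copy)
      (for_loop 18 0 (scalar 0) ?del)) s1
    (1 + ((1 + (n * (1 + 2) + 2)) + ?t)) ?R"
  proof (rule runs_Cond)
    assume "bval (Less (Num 0) (scalar 12)) s1"
    then have col: "colorable_on k E {..<n}" "proper_on k E {..<n} (s1 13)" using s1 by auto
    have "runs (Seq (Store 2 (Num 0) (Num 1)) ?copy) s1 (1 + (n * (1 + 2) + 2)) ?R"
    proof (rule runs_Seq)
      show "runs (Store 2 (Num 0) (Num 1)) s1 1 (\<lambda>s'. agree {2} s1 s' \<and> s' 2 0 = 1)"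
        by (rule runs_Store) (simp add: agree_def)
      fix s2 assume s2: "agree {2} s1 s2 \<and> s2 2 0 = 1"
      let ?c = "Store 3 (scalar 15) (Get 13 (scalar 15))"
      have "runs ?copy s2 (n * (1 + 2) + 2)
          (\<lambda>s'. (\<forall>v<n. s' 3 v = s1 13 v) \<and> agree (insert 15 (writes ?c)) s2 s')"
      proof (rule runs_for[where P = "\<lambda>j s'. \<forall>v<j. s' 3 v = s1 13 v"])
        fix s3 assume "agree (insert 15 (writes ?c)) s2 s3"
        then have eq: "s3 0 0 = n" "s3 13 = s1 13"
          using s2 G by (auto simp: agree_def graph_input_def)
        then show "aval (scalar 0) s3 = n" by simp
        fix j assume "j < n" "\<forall>v<j. s3 3 v = s1 13 v" "s3 15 0 = j"
        then show "runs ?c s3 1 (\<lambda>s'. \<forall>v<Suc j. s' 3 v = s1 13 v)"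
          by (intro runs_Store) (auto simp: less_Suc_eq eq)
      qed auto
      then show "runs ?copy s2 (n * (1 + 2) + 2) ?R"
      proof (rule runs_weaken[OF _ order_refl], elim conjE)
        fix s' assume *: "\<forall>v<n. s' 3 v = s1 13 v" "agree (insert 15 (writes ?c)) s2 s'"
        then have "proper_on k E {..<n} (s' 3)"
          using col(2) proper_on_cong[of "{..<n}" "s' 3" "s1 13"] by simp
        moreover have "s' 2 0 = 1" using * s2 by (simp add: agree_def)
        ultimately show "?R s'" using col by simp
      qed
    qed
    then show "runs (Seq (Store 2 (Num 0) (Num 1)) ?copy) s1
        ((1 + (n * (1 + 2) + 2)) + ?t) ?R"
      by (rule runs_weaken) auto
  next
    assume "\<not> bval (Less (Num 0) (scalar 12)) s1"
    then have no: "\<not> colorable_on k E {..<n}" using s1 by simp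
    define P where "P j s' \<longleftrightarrow> s' 2 0 = 0 \<and> \<not> colorable_on k E (members n s') \<and>
      (\<forall>v\<in>members n s'. v < j \<longrightarrow> colorable_on k E (members n s' - {v})) \<and>
      (\<forall>v<n. j \<le> v \<longrightarrow> v \<in> members n s')" for j and s' :: state
    have w: "writes (decide k M) \<subseteq> {6..<18}" by (rule writes_decide)
    have "runs (for_loop 18 0 (scalar 0) ?del) s1 ?t
        (\<lambda>s'. P n s' \<and> agree (insert 18 (writes ?del)) s1 s')"
    proof (rule runs_for)
      show "18 \<notin> writes ?del" using w by auto
      show "P 0 s1" using s1 no by (simp add: P_def)
      show "P j (s'(18 := f))" if "P j s'" for j s' f using that by (simp add: P_def members_def)
      fix s2 assume ag: "agree (insert 18 (writes ?del)) s1 s2"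
      have G2: "graph_input n E s2" by (rule graph_input_agree[OF G ag]) (use w in auto)
      then show "aval (scalar 0) s2 = n" by (simp add: graph_input_def)
      fix j assume j: "j < n" "P j s2" "s2 18 0 = j"
      let ?Y = "members n s2 - {j}"
      show "runs ?del s2 (1 + (decide_time k M n + 2)) (P (Suc j))"
      proof (intro runs_Seq)
        show "runs (Store 3 (scalar 18) (Num 0)) s2 1
            (\<lambda>s'. graph_input n E s' \<and> members n s' = ?Y \<and> s' 2 0 = 0 \<and> s' 18 0 = j)"
          by (rule runs_Store)
            (use j G2 in \<open>auto simp: graph_input_update members_def P_def\<close>)
      next
        fix s3 assume s3: "graph_input n E s3 \<and> members n s3 = ?Y \<and> s3 2 0 = 0 \<and> s3 18 0 = j"
        then have G3: "graph_input n E s3" and m3: "?Y = members n s3" by auto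
        show "runs (decide k M) s3 (decide_time k M n) (\<lambda>s'. members n s' = ?Y \<and> s' 2 0 = 0 \<and>
            s' 18 0 = j \<and> (s' 12 0 \<noteq> 0 \<longleftrightarrow> colorable_on k E ?Y))"
          by (rule runs_weaken[OF runs_decide[OF G3 free k M m3]])
            (use s3 decide_frame[of s3] in auto)
      next
        fix s3 assume s3: "members n s3 = ?Y \<and> s3 2 0 = 0 \<and>
            s3 18 0 = j \<and> (s3 12 0 \<noteq> 0 \<longleftrightarrow> colorable_on k E ?Y)"
        have jm: "j \<in> members n s2" using j by (simp add: P_def)
        show "runs (Cond (Less (Num 0) (scalar 12)) (Store 3 (scalar 18) (Num 1)) Skip) s3 2 (P (Suc j))"
        proof (rule runs_conditional_Store)
          let ?s = "if bval (Less (Num 0) (scalar 12)) s3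
            then s3(3 := (s3 3)(aval (scalar 18) s3 := aval (Num 1) s3)) else s3"
          show "P (Suc j) ?s"
          proof (cases "colorable_on k E ?Y")
            case True
            then have s: "?s = s3(3 := (s3 3)(j := 1))" using s3 by simp
            have "members n ?s = insert j (members n s3)"
              unfolding s using j(1) by (auto simp: members_def)
            then have m: "members n ?s = members n s2" using s3 jm by auto
            have "s3 2 0 = 0" using s3 by simp
            then show ?thesis
              using j(2) True unfolding P_def m by (auto simp: less_Suc_eq)
          next
            case False
            then have s: "?s = s3" using s3 by simp
            have "colorable_on k E (?Y - {v})" if "v \<in> ?Y" "v < Suc j" for v
              by (rule colorable_on_subset[of k E "members n s2 - {v}"])
                (use that j(2) in \<open>auto simp: P_def\<close>)
            moreover have "v \<in> ?Y" if "v < n" "Suc j \<le> v" for v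
              using that j(2) by (auto simp: P_def)
            ultimately show ?thesis unfolding s P_def using s3 False by auto
          qed
        qed
      qed
    qed
    then have "runs (for_loop 18 0 (scalar 0) ?del) s1 ?t ?R"
      by (rule runs_weaken) (use no in \<open>auto simp: P_def critical_on_def members_def\<close>)
    then show "runs (for_loop 18 0 (scalar 0) ?del) s1
        ((1 + (n * (1 + 2) + 2)) + ?t) ?R"
      by (rule runs_weaken) auto
  qed
qed

definition verifier :: "nat \<Rightarrow> nat \<Rightarrow> com" where
  "verifier k M = Seq row_offsets
    (Cond (Less (Num 0) (scalar 2))
      (Seq (check_coloring k (\<lambda>x. Eq (Num 0) (Num 0)) (\<lambda>x. Get 3 (scalar x)))
        (Store 4 (Num 0) (scalar 11)))
      (Seq (decide k M)
      (Seq (Store 4 (Num 0) (Minus (Num 1) (scalar 12)))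
        (for_loop 18 0 (scalar 0)
          (Cond (Less (Num 0) (Get 3 (scalar 18)))
            (Seq (Store 3 (scalar 18) (Num 0))
            (Seq (decide k M)
            (Seq (Cond (Eq (scalar 12) (Num 0)) (Store 4 (Num 0) (Num 0)) Skip)
              (Store 3 (scalar 18) (Num 1)))))
            Skip)))))"

definition verifier_time :: "nat \<Rightarrow> nat \<Rightarrow> nat \<Rightarrow> nat" where
  "verifier_time k M n = (n * (1 + 2) + 2) + (1 + ((check_time n + 1) + (decide_time k M n +
    (1 + (n * ((1 + (1 + (decide_time k M n + (2 + 1)))) + 2) + 2)))))"

lemma runs_verifier:
  assumes input: "s 0 0 = n" "\<And>u v. u < n \<Longrightarrow> v < n \<Longrightarrow> 0 < s 1 (u * n + v) \<longleftrightarrow> E u v" "s 5 0 = 0"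
    and free: "free_graph {..<n} E" and k: "k \<ge> 1"
    and M: "\<And>V. rigid_graph V E k \<Longrightarrow> card (V :: nat set) \<le> M"
  shows "runs (verifier k M) s (verifier_time k M n) (\<lambda>s'. s' 4 0 = 1 \<longleftrightarrow>
    (if s 2 0 \<noteq> 0 then proper_on k E {..<n} (s 3) else critical_on k E (members n s)))"
    (is "runs _ _ _ ?R")
  unfolding verifier_def verifier_time_def
proof (rule runs_Seq)
  show "runs row_offsets s (n * (1 + 2) + 2) (\<lambda>s'. graph_input n E s' \<and> agree {5, 15} s s')"
    by (rule runs_row_offsets[OF input])
  fix s1 assume s1: "graph_input n E s1 \<and> agree {5, 15} s s1"
  then have G: "graph_input n E s1" and eq: "s1 2 = s 2" "s1 3 = s 3" by (simp_all add: agree_def)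
  let ?check = "check_coloring k (\<lambda>x. Eq (Num 0) (Num 0)) (\<lambda>x. Get 3 (scalar x))"
  let ?body = "Cond (Less (Num 0) (Get 3 (scalar 18)))
            (Seq (Store 3 (scalar 18) (Num 0)) (Seq (decide k M)
            (Seq (Cond (Eq (scalar 12) (Num 0)) (Store 4 (Num 0) (Num 0)) Skip)
              (Store 3 (scalar 18) (Num 1))))) Skip"
  let ?loop = "for_loop 18 0 (scalar 0) ?body" and ?t = "n * ((1 + (1 + (decide_time k M n + (2 + 1)))) + 2) + 2"
  show "runs (Cond (Less (Num 0) (scalar 2)) (Seq ?check (Store 4 (Num 0) (scalar 11)))
      (Seq (decide k M) (Seq (Store 4 (Num 0) (Minus (Num 1) (scalar 12))) ?loop))) s1
    (1 + ((check_time n + 1) + (decide_time k M n +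
      (1 + ?t)))) ?R"
  proof (rule runs_Cond)
    assume "bval (Less (Num 0) (scalar 2)) s1"
    then have tag: "s 2 0 \<noteq> 0" using eq by simp
    have "runs (Seq ?check (Store 4 (Num 0) (scalar 11))) s1 (check_time n + 1) ?R"
    proof (rule runs_Seq)
      show "runs ?check s1 (check_time n)
          (\<lambda>s'. s' 11 0 = of_bool (proper_on k E {..<n} (s 3)) \<and> agree {11, 14, 15} s1 s')"
        by (rule runs_check_coloring[OF G]) (auto simp: agree_def eq)
      fix s2 assume "s2 11 0 = of_bool (proper_on k E {..<n} (s 3)) \<and> agree {11, 14, 15} s1 s2"
      then show "runs (Store 4 (Num 0) (scalar 11)) s2 1 ?R"
        by (intro runs_Store) (use tag in simp)
    qed
    then show "runs (Seq ?check (Store 4 (Num 0) (scalar 11))) s1 ((check_time n + 1) +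
        (decide_time k M n + (1 + ?t))) ?R"
      by (rule runs_weaken) auto
  next
    assume "\<not> bval (Less (Num 0) (scalar 2)) s1"
    then have tag: "s 2 0 = 0" using eq by simp
    let ?X = "members n s"
    have m1: "?X = members n s1" by (simp add: members_def eq)
    define Q where "Q j \<longleftrightarrow> \<not> colorable_on k E ?X \<and>
      (\<forall>v\<in>?X. v < j \<longrightarrow> colorable_on k E (?X - {v}))" for j
    have w: "writes (decide k M) \<subseteq> {6..<18}" by (rule writes_decide)
    have "runs (Seq (decide k M) (Seq (Store 4 (Num 0) (Minus (Num 1) (scalar 12))) ?loop)) s1
      (decide_time k M n + (1 + ?t)) ?R"
    proof (intro runs_Seq)
      show "runs (decide k M) s1 (decide_time k M n) (\<lambda>s'. graph_input n E s' \<and>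
          members n s' = ?X \<and> (s' 12 0 \<noteq> 0 \<longleftrightarrow> colorable_on k E ?X))"
        by (rule runs_weaken[OF runs_decide[OF G free k M m1]])
          (use m1 G decide_frame[of s1] in auto)
    next
      fix s2 assume s2: "graph_input n E s2 \<and>
          members n s2 = ?X \<and> (s2 12 0 \<noteq> 0 \<longleftrightarrow> colorable_on k E ?X)"
      show "runs (Store 4 (Num 0) (Minus (Num 1) (scalar 12))) s2 1
          (\<lambda>s'. graph_input n E s' \<and> members n s' = ?X \<and> s' 4 0 = of_bool (Q 0))"
      proof (rule runs_Store)
        have "Q 0 \<longleftrightarrow> s2 12 0 = 0" using s2 by (auto simp: Q_def)
        then have "1 - s2 12 0 = of_bool (Q 0)" by auto
        let ?s = "s2(4 := (s2 4)(aval (Num 0) s2 := aval (Minus (Num 1) (scalar 12)) s2))"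
        show "graph_input n E ?s \<and> members n ?s = ?X \<and> ?s 4 0 = of_bool (Q 0)"
          using s2 \<open>1 - s2 12 0 = of_bool (Q 0)\<close> by (simp add: graph_input_update members_update)
      qed
    next
      fix s2 assume s2: "graph_input n E s2 \<and> members n s2 = ?X \<and> s2 4 0 = of_bool (Q 0)"
      have "runs ?loop s2 ?t
          (\<lambda>s'. (members n s' = ?X \<and> s' 4 0 = of_bool (Q n)) \<and> agree (insert 18 (writes ?body)) s2 s')"
      proof (rule runs_for[where P = "\<lambda>j s'. members n s' = ?X \<and> s' 4 0 = of_bool (Q j)"])
        show "18 \<notin> writes ?body" using w by auto
        show "members n s2 = ?X \<and> s2 4 0 = of_bool (Q 0)" using s2 by simp
        show "members n (s'(18 := f)) = ?X \<and> (s'(18 := f)) 4 0 = of_bool (Q j)"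
          if "members n s' = ?X \<and> s' 4 0 = of_bool (Q j)" for j s' f
          using that by (simp add: members_def)
        fix s3 assume ag: "agree (insert 18 (writes ?body)) s2 s3"
        have G3: "graph_input n E s3" by (rule graph_input_agree[OF _ ag]) (use s2 w in auto)
        then show "aval (scalar 0) s3 = n" by (simp add: graph_input_def)
        fix j assume j: "j < n" "members n s3 = ?X \<and> s3 4 0 = of_bool (Q j)" "s3 18 0 = j"
        show "runs ?body s3 (1 + (1 + (decide_time k M n + (2 + 1))))
            (\<lambda>s'. members n s' = ?X \<and> s' 4 0 = of_bool (Q (Suc j)))" (is "runs _ _ _ ?S")
        proof (rule runs_Cond)
          assume "bval (Less (Num 0) (Get 3 (scalar 18))) s3"
          then have jX: "j \<in> ?X" using j by (auto simp: members_def)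
          have Q: "Q (Suc j) \<longleftrightarrow> Q j \<and> colorable_on k E (?X - {j})"
            using jX by (auto simp: Q_def less_Suc_eq)
          show "runs (Seq (Store 3 (scalar 18) (Num 0)) (Seq (decide k M)
            (Seq (Cond (Eq (scalar 12) (Num 0)) (Store 4 (Num 0) (Num 0)) Skip)
              (Store 3 (scalar 18) (Num 1))))) s3 (1 + (decide_time k M n + (2 + 1))) ?S"
          proof (intro runs_Seq)
            show "runs (Store 3 (scalar 18) (Num 0)) s3 1 (\<lambda>s'. graph_input n E s' \<and>
                members n s' = ?X - {j} \<and> s' 4 0 = of_bool (Q j) \<and> s' 18 0 = j)"
              by (rule runs_Store)
                (use j G3 in \<open>auto simp: graph_input_update members_def\<close>)
          next
            fix s4 assume s4: "graph_input n E s4 \<and>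
                members n s4 = ?X - {j} \<and> s4 4 0 = of_bool (Q j) \<and> s4 18 0 = j"
            then have G4: "graph_input n E s4" and m4: "?X - {j} = members n s4" by auto
            have "runs (decide k M) s4 (decide_time k M n)
                (\<lambda>s'. (s' 12 0 \<noteq> 0 \<longleftrightarrow> colorable_on k E (?X - {j})) \<and>
                  (s' 12 0 \<noteq> 0 \<longrightarrow> proper_on k E (?X - {j}) (s' 13)) \<and> agree {6..<18} s4 s')"
              by (rule runs_decide[OF G4 free k _ m4]) (rule M)
            then show "runs (decide k M) s4 (decide_time k M n) (\<lambda>s'. members n s' = ?X - {j} \<and>
                s' 4 0 = of_bool (Q j) \<and> s' 18 0 = j \<and>
                (s' 12 0 \<noteq> 0 \<longleftrightarrow> colorable_on k E (?X - {j})))"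
            proof (rule runs_weaken[OF _ order_refl], elim conjE)
              fix s' assume *: "s' 12 0 \<noteq> 0 \<longleftrightarrow> colorable_on k E (?X - {j})" "agree {6..<18} s4 s'"
              then show "members n s' = ?X - {j} \<and> s' 4 0 = of_bool (Q j) \<and> s' 18 0 = j \<and>
                  (s' 12 0 \<noteq> 0 \<longleftrightarrow> colorable_on k E (?X - {j}))"
                unfolding decide_frame(2)[OF *(2)] decide_frame(4,5)[OF *(2)] using s4 by simp
            qed
          next
            fix s4 assume "members n s4 = ?X - {j} \<and>
                s4 4 0 = of_bool (Q j) \<and> s4 18 0 = j \<and>
                (s4 12 0 \<noteq> 0 \<longleftrightarrow> colorable_on k E (?X - {j}))"
            then show "runs (Cond (Eq (scalar 12) (Num 0)) (Store 4 (Num 0) (Num 0)) Skip) s4 2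
                (\<lambda>s'. members n s' = ?X - {j} \<and> s' 4 0 = of_bool (Q (Suc j)) \<and> s' 18 0 = j)"
              by (intro runs_conditional_Store) (cases "colorable_on k E (?X - {j})",
                simp_all add: members_update Q)
          next
            fix s4 assume s4: "members n s4 = ?X - {j} \<and> s4 4 0 = of_bool (Q (Suc j)) \<and> s4 18 0 = j"
            have "members n (s4(3 := (s4 3)(j := 1))) = insert j (members n s4)"
              using j(1) by (auto simp: members_def)
            also have "\<dots> = ?X" using s4 jX by auto
            finally have restored: "members n (s4(3 := (s4 3)(j := 1))) = ?X" .
            have s4_18: "s4 18 0 = j" and s4_4: "s4 4 0 = of_bool (Q (Suc j))" using s4 by auto
            show "runs (Store 3 (scalar 18) (Num 1)) s4 1 ?S"
            proof (rule runs_Store)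
              let ?s = "s4(3 := (s4 3)(aval (scalar 18) s4 := aval (Num 1) s4))"
              show "members n ?s = ?X \<and> ?s 4 0 = of_bool (Q (Suc j))"
                unfolding aval_scalar aval.simps s4_18 restored using s4_4 by simp
            qed
          qed
        next
          assume "\<not> bval (Less (Num 0) (Get 3 (scalar 18))) s3"
          then have "j \<notin> members n s3" using j(3) by (simp add: members_def)
          then have "j \<notin> ?X" using j(2) by simp
          then have "Q (Suc j) \<longleftrightarrow> Q j" unfolding Q_def by (metis less_Suc_eq)
          then have "runs Skip s3 1 ?S" by (intro runs_Skip) (use j in simp)
          then show "runs Skip s3 (1 + (decide_time k M n + (2 + 1))) ?S"
            by (rule runs_weaken) auto
        qed
      qed
      then show "runs ?loop s2 ?t ?R"
      proof (rule runs_weaken[OF _ order_refl], elim conjE)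
        fix s' :: state assume "s' 4 0 = of_bool (Q n)"
        moreover have "Q n \<longleftrightarrow> critical_on k E ?X"
          by (auto simp: Q_def critical_on_def members_def)
        ultimately show "?R s'" using tag by simp
      qed
    qed
    then show "runs (Seq (decide k M) (Seq (Store 4 (Num 0) (Minus (Num 1) (scalar 12))) ?loop)) s1
      ((check_time n + 1) + (decide_time k M n +
        (1 + ?t))) ?R"
      by (rule runs_weaken) auto
  qed
qed

lemma poly_bounded_decide_time [intro]: "poly_bounded (decide_time k M)"
  unfolding decide_time_def[abs_def] fold_round_time_def try_fold_time_def number_time_def
    search_time_def try_coloring_time_def check_time_def
  by (intro poly_bounded_add poly_bounded_mult poly_bounded_const poly_bounded_id
      poly_bounded_tuple_time)

lemma poly_bounded_solver_time: "poly_bounded (solver_time k M)"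
  unfolding solver_time_def[abs_def]
  by (intro poly_bounded_add poly_bounded_mult poly_bounded_const poly_bounded_id
      poly_bounded_decide_time)

lemma poly_bounded_verifier_time: "poly_bounded (verifier_time k M)"
  unfolding verifier_time_def[abs_def] check_time_def
  by (intro poly_bounded_add poly_bounded_mult poly_bounded_const poly_bounded_id
      poly_bounded_decide_time)

section \<open>Chromatic numbers and excluded subgraphs\<close>

lemma proper_coloring_induced:
  "X \<subseteq> verts G \<Longrightarrow> proper_coloring k (induced G X) c \<longleftrightarrow> proper_on k (adj G) X c"
  by (auto simp: proper_coloring_def proper_on_def induced_def adj_def)

lemma colorable_induced:
  "X \<subseteq> verts G \<Longrightarrow> colorable k (induced G X) \<longleftrightarrow> colorable_on k (adj G) X"
  by (simp add: colorable_def colorable_on_def proper_coloring_induced)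

text \<open>
A coloring with pairwise distinct colors shows that the least number of colors is attained.
\<close>
lemma chromatic_number_induced_le:
  assumes fin: "finite X" and X: "X \<subseteq> verts G" and irrefl: "\<And>v. \<not> adj G v v"
  shows "chromatic_number (induced G X) \<le> k \<longleftrightarrow> colorable_on k (adj G) X"
proof -
  obtain h where "bij_betw h X {0..<card X}" using ex_bij_betw_finite_nat[OF fin] by blast
  then have "proper_on (card X) (adj G) X h"
    using irrefl unfolding proper_on_def bij_betw_def inj_on_def by force
  then have "colorable (card X) (induced G X)"
    using X by (auto simp: colorable_induced colorable_on_def)
  then have "colorable (chromatic_number (induced G X)) (induced G X)"
    unfolding chromatic_number_def by (rule LeastI)
  then have "colorable_on (chromatic_number (induced G X)) (adj G) X"
    using X by (simp add: colorable_induced)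
  then have "colorable_on k (adj G) X" if "chromatic_number (induced G X) \<le> k"
    using that unfolding colorable_on_def proper_on_def by (meson less_le_trans)
  moreover have "chromatic_number (induced G X) \<le> k" if "colorable_on k (adj G) X"
    using that X unfolding chromatic_number_def by (intro Least_le) (simp add: colorable_induced)
  ultimately show ?thesis by blast
qed

lemma colorable_on_Suc:
  assumes "colorable_on k E (X - {v})" and irrefl: "\<not> E v v"
  shows "colorable_on (Suc k) E X"
proof -
  obtain c where c: "proper_on k E (X - {v}) c" using assms(1) by (auto simp: colorable_on_def)
  have "proper_on (Suc k) E X (c(v := k))"
    unfolding proper_on_def
  proof (intro conjI ballI impI)
    fix u assume "u \<in> X"
    then show "(c(v := k)) u < Suc k" using c by (auto simp: proper_on_def less_Suc_eq)
  next
    fix u w assume uw: "u \<in> X" "w \<in> X" "E u w"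
    have "c u < k" if "u \<noteq> v" using c uw that by (simp add: proper_on_def)
    moreover have "c w < k" if "w \<noteq> v" using c uw that by (simp add: proper_on_def)
    moreover have "c u \<noteq> c w" if "u \<noteq> v" "w \<noteq> v" using c uw that by (simp add: proper_on_def)
    ultimately show "(c(v := k)) u \<noteq> (c(v := k)) w" using uw irrefl
      by (cases "u = v"; cases "w = v") auto
  qed
  then show ?thesis by (auto simp: colorable_on_def)
qed

text \<open>
If \<open>k\<close> colors do not suffice but do so after deleting some vertex, then one additional color for that vertex shows
that the chromatic number is exactly \<open>k + 1\<close>. Such a vertex exists, as the empty graph is colorable.
\<close>
lemma vertex_critical_induced:
  assumes fin: "finite X" and X: "X \<subseteq> verts G" and irrefl: "\<And>v. \<not> adj G v v"
  shows "vertex_critical (k + 1) (induced G X) \<longleftrightarrow> critical_on k (adj G) X"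
proof -
  have verts: "verts (induced G X) = X" using X by (auto simp: induced_def)
  have "induced (induced G X) (X - {v}) = induced G (X - {v})" for v
    using X by (auto simp: induced_def)
  then have del: "chromatic_number (induced (induced G X) (X - {v})) < k + 1 \<longleftrightarrow>
      colorable_on k (adj G) (X - {v})" for v
    using chromatic_number_induced_le[of "X - {v}" G k] fin X irrefl
    by (auto simp: less_Suc_eq_le)
  note chi = chromatic_number_induced_le[OF fin X irrefl]
  show ?thesis
  proof
    assume "vertex_critical (k + 1) (induced G X)"
    then have "chromatic_number (induced G X) = k + 1" "\<forall>v\<in>X. colorable_on k (adj G) (X - {v})"
      unfolding vertex_critical_def verts del by auto
    then show "critical_on k (adj G) X" using chi[of k] by (simp add: critical_on_def)
  next
    assume crit: "critical_on k (adj G) X"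
    then have no: "\<not> chromatic_number (induced G X) \<le> k" using chi by (simp add: critical_on_def)
    have "X \<noteq> {}" using crit by (auto simp: critical_on_def colorable_on_def proper_on_def)
    then have "colorable_on (Suc k) (adj G) X"
      using crit irrefl colorable_on_Suc[of k "adj G" X] by (auto simp: critical_on_def)
    then have "chromatic_number (induced G X) \<le> Suc k" using chi by simp
    then show "vertex_critical (k + 1) (induced G X)"
      using no crit unfolding vertex_critical_def verts del by (simp add: critical_on_def)
  qed
qed

lemma adj_co_gem: "adj co_gem u v \<longleftrightarrow> {u, v} \<in> {{0, 1}, {1, 2}, {2, 3}}"
  by (simp add: adj_def co_gem_def)

lemma adj_paraglider:
  "adj paraglider u v \<longleftrightarrow> {u, v} \<in> {{0, 1}, {0, 3}, {0, 4}, {1, 3}, {1, 4}, {2, 3}, {2, 4}}"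
  by (simp add: adj_def paraglider_def)

lemma verts_co_gem: "verts co_gem = {0, 1, 2, 3, 4}"
  and verts_paraglider: "verts paraglider = {0, 1, 2, 3, 4}"
  by (simp_all add: co_gem_def paraglider_def)

lemma free_graph_of_excluded:
  assumes G: "simple_graph G" and ex: "\<not> contains_induced G co_gem" "\<not> contains_induced G paraglider"
  shows "free_graph (verts G) (adj G)"
proof
  show "finite (verts G)" using G by (simp add: simple_graph_def)
  show sym: "adj G v u" if "adj G u v" for u v using that by (simp add: adj_def insert_commute)
  show irrefl: "\<not> adj G v v" for v
    using G unfolding simple_graph_def adj_def by (metis insert_absorb2 doubleton_eq_iff)
  have comm: "adj G u v \<longleftrightarrow> adj G v u" for u v using sym by blast
  show False
    if V: "a \<in> verts G" "b \<in> verts G" "c \<in> verts G" "d \<in> verts G" "e \<in> verts G"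
      and adj: "adj G a b" "adj G b c" "adj G c d" "\<not> adj G a c" "\<not> adj G a d" "\<not> adj G b d"
        "\<not> adj G a e" "\<not> adj G b e" "\<not> adj G c e" "\<not> adj G d e" for a b c d e
  proof -
    have ne: "a \<noteq> b" "a \<noteq> c" "a \<noteq> d" "a \<noteq> e" "b \<noteq> c" "b \<noteq> d" "b \<noteq> e" "c \<noteq> d" "c \<noteq> e" "d \<noteq> e"
      using adj irrefl comm by metis+
    define f where "f i = (if i = 0 then a else if i = 1 then b else if i = 2 then c
      else if i = 3 then d else e)" for i :: nat
    have f: "f 0 = a" "f (Suc 0) = b" "f 2 = c" "f 3 = d" "f 4 = e" by (simp_all add: f_def)
    have "contains_induced G co_gem"
      unfolding contains_induced_def
    proof (intro exI[of _ f] conjI)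
      show "inj_on f (verts co_gem)" using ne by (auto simp: verts_co_gem f inj_on_def)
      show "f ` verts co_gem \<subseteq> verts G" using V by (auto simp: verts_co_gem f)
      show "\<forall>u\<in>verts co_gem. \<forall>v\<in>verts co_gem. adj co_gem u v \<longleftrightarrow> adj G (f u) (f v)"
        using adj irrefl comm by (simp add: verts_co_gem adj_co_gem f doubleton_eq_iff)
    qed
    then show False using ex(1) by simp
  qed
  show "adj G c a \<or> adj G c b"
    if V: "x \<in> verts G" "y \<in> verts G" "a \<in> verts G" "b \<in> verts G" "c \<in> verts G"
      and adj: "x \<noteq> y" "\<not> adj G x y" "adj G x a" "adj G y a" "adj G x b" "adj G y b"
        "adj G x c" "adj G y c" "adj G a b" for x y a b c
  proof (rule ccontr)
    assume no: "\<not> (adj G c a \<or> adj G c b)"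
    have ne: "x \<noteq> a" "x \<noteq> b" "x \<noteq> c" "y \<noteq> a" "y \<noteq> b" "y \<noteq> c" "a \<noteq> b" "a \<noteq> c" "b \<noteq> c"
      using adj no irrefl comm by metis+
    define f where "f i = (if i = 0 then a else if i = 1 then b else if i = 2 then c
      else if i = 3 then x else y)" for i :: nat
    have f: "f 0 = a" "f (Suc 0) = b" "f 2 = c" "f 3 = x" "f 4 = y" by (simp_all add: f_def)
    have "contains_induced G paraglider"
      unfolding contains_induced_def
    proof (intro exI[of _ f] conjI)
      show "inj_on f (verts paraglider)" using ne adj(1) by (auto simp: verts_paraglider f inj_on_def)
      show "f ` verts paraglider \<subseteq> verts G" using V by (auto simp: verts_paraglider f)
      show "\<forall>u\<in>verts paraglider. \<forall>v\<in>verts paraglider. adj paraglider u v \<longleftrightarrow> adj G (f u) (f v)"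
        using adj no irrefl comm
        by (simp add: verts_paraglider adj_paraglider f doubleton_eq_iff)
    qed
    then show False using ex(2) by simp
  qed
qed

theorem corollary1:
  fixes k :: nat
  assumes "k \<ge> 1"
  shows "\<exists>A. polytime_certifying k
    (\<lambda>G. \<not> contains_induced G co_gem \<and> \<not> contains_induced G paraglider) A"
proof -
  let ?C = "\<lambda>G. \<not> contains_induced G co_gem \<and> \<not> contains_induced G paraglider"
  obtain M where M: "\<forall>(V :: nat set) E. rigid_graph V E k \<longrightarrow> card V \<le> M"
    using rigid_graph_bounded[where ?'a = nat] by blast
  have graph: "verts G = {..<card (verts G)} \<and> free_graph {..<card (verts G)} (adj G) \<and>
      (\<forall>v. \<not> adj G v v)"
    if input: "input_graph ?C G" for G
  proof -
    obtain n where n: "verts G = {..<n}" and G: "simple_graph G" "?C G"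
      using input by (auto simp: input_graph_def)
    then have "free_graph (verts G) (adj G)" by (intro free_graph_of_excluded) auto
    then show ?thesis using n free_graph.irrefl by fastforce
  qed
  have matrix: "0 < graph_state G 1 (u * card (verts G) + v) \<longleftrightarrow> adj G u v"
    if "u < card (verts G)" "v < card (verts G)" for G u v
  proof -
    let ?n = "card (verts G)"
    have "u * ?n + v < Suc u * ?n" using that by simp
    also have "\<dots> \<le> ?n * ?n" using that by (intro mult_right_mono) auto
    finally show ?thesis using that by (simp add: graph_state_def Let_def)
  qed
  have certificate: "valid_certificate k G tag w \<longleftrightarrow>
      (if tag \<noteq> 0 then proper_on k (adj G) {..<card (verts G)} w
       else critical_on k (adj G) {v. v < card (verts G) \<and> 0 < w v})"
    if G: "input_graph ?C G" for G tag w
  proof -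
    define n where "n = card (verts G)"
    have V: "verts G = {..<n}" and irrefl: "\<And>v. \<not> adj G v v"
      using graph[OF G] by (auto simp: n_def)
    have "proper_coloring k G w \<longleftrightarrow> proper_on k (adj G) {..<n} w"
      by (auto simp: proper_coloring_def proper_on_def V)
    moreover have "{v \<in> verts G. w v \<noteq> 0} = {v. v < n \<and> 0 < w v}" by (auto simp: V)
    moreover have "vertex_critical (k + 1) (induced G {v. v < n \<and> 0 < w v}) \<longleftrightarrow>
        critical_on k (adj G) {v. v < n \<and> 0 < w v}"
      by (rule vertex_critical_induced[OF _ _ irrefl]) (auto simp: V)
    ultimately show ?thesis unfolding n_def[symmetric] by (simp add: valid_certificate_def)
  qed
  have "solves_coloring_in_polytime k ?C (solver k M)"
  proof -
    obtain p where p: "\<forall>n. solver_time k M n \<le> poly p n"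
      using poly_bounded_solver_time[of k M] unfolding poly_bounded_def by blast
    have "\<exists>t s. exec (solver k M) (graph_state G) t s \<and> t \<le> poly p (card (verts G)) \<and>
        (s 2 0 \<noteq> 0 \<longleftrightarrow> colorable k G) \<and> valid_certificate k G (s 2 0) (s 3)"
      if G: "input_graph ?C G" for G
    proof -
      let ?n = "card (verts G)"
      have V: "verts G = {..<?n}" using graph[OF G] by auto
      have col: "colorable k G \<longleftrightarrow> colorable_on k (adj G) {..<?n}"
        using arg_cong[OF V, of "\<lambda>X. \<exists>c. proper_on k (adj G) X c"]
        by (simp add: colorable_def colorable_on_def proper_coloring_def proper_on_def)
      have "runs (solver k M) (graph_state G) (solver_time k M ?n) (\<lambda>s'.
        (s' 2 0 \<noteq> 0 \<longleftrightarrow> colorable_on k (adj G) {..<?n}) \<and>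
        (if s' 2 0 \<noteq> 0 then proper_on k (adj G) {..<?n} (s' 3)
         else critical_on k (adj G) (members ?n s')))"
        by (rule runs_solver)
          (use graph[OF G] matrix assms M in \<open>auto simp: graph_state_def Let_def\<close>)
      then obtain t s where *: "exec (solver k M) (graph_state G) t s" "t \<le> solver_time k M ?n"
        "s 2 0 \<noteq> 0 \<longleftrightarrow> colorable_on k (adj G) {..<?n}"
        "if s 2 0 \<noteq> 0 then proper_on k (adj G) {..<?n} (s 3)
         else critical_on k (adj G) (members ?n s)" by (auto simp: runs_def)
      have "t \<le> poly p ?n" using *(2) p le_trans by blast
      moreover have "valid_certificate k G (s 2 0) (s 3)"
        unfolding certificate[OF G] using *(4) by (simp only: members_def)
      ultimately show ?thesis using *(1,3) col by blast
    qed
    then show ?thesis unfolding solves_coloring_in_polytime_def by blast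
  qed
  moreover have "verifies_in_polytime k ?C (verifier k M)"
  proof -
    obtain p where p: "\<forall>n. verifier_time k M n \<le> poly p n"
      using poly_bounded_verifier_time[of k M] unfolding poly_bounded_def by blast
    have "\<exists>t s. exec (verifier k M) (certificate_state G tag w) t s \<and> t \<le> poly p (card (verts G)) \<and>
        (s 4 0 = 1 \<longleftrightarrow> valid_certificate k G tag w)"
      if G: "input_graph ?C G" for G tag w
    proof -
      let ?n = "card (verts G)" and ?s = "certificate_state G tag w"
      have "runs (verifier k M) ?s (verifier_time k M ?n) (\<lambda>s'. s' 4 0 = 1 \<longleftrightarrow>
        (if ?s 2 0 \<noteq> 0 then proper_on k (adj G) {..<?n} (?s 3)
         else critical_on k (adj G) (members ?n ?s)))"
      proof (rule runs_verifier)
        show "?s 0 0 = ?n" "?s 5 0 = 0"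
          by (simp_all add: certificate_state_def graph_state_def Let_def)
        show "0 < ?s 1 (u * ?n + v) \<longleftrightarrow> adj G u v" if "u < ?n" "v < ?n" for u v
          using matrix[OF that] by (simp add: certificate_state_def)
      qed (use graph[OF G] assms M in auto)
      moreover have "?s 2 0 = tag" by (simp add: certificate_state_def)
      moreover have "proper_on k (adj G) {..<?n} (?s 3) \<longleftrightarrow> proper_on k (adj G) {..<?n} w"
        by (rule proper_on_cong) (simp add: certificate_state_def)
      moreover have "members ?n ?s = {v. v < ?n \<and> 0 < w v}"
        by (auto simp: members_def certificate_state_def)
      ultimately have "runs (verifier k M) ?s (verifier_time k M ?n)
          (\<lambda>s'. s' 4 0 = 1 \<longleftrightarrow> valid_certificate k G tag w)"
        by (simp only: certificate[OF G])
      then show ?thesis unfolding runs_def using p le_trans by blast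
    qed
    then show ?thesis unfolding verifies_in_polytime_def by blast
  qed
  ultimately show ?thesis unfolding polytime_certifying_def by blast
qed

end
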